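(* Let $G$ be a Lie group with Lie algebra $\mathfrak g$, and let $L=L(g,\xi_1,\xi_2,\xi_3)$ be a smooth function (Lagrangian) on ${}^{1}TTG=(G\circledS\mathfrak g_1)\circledS(\mathfrak g_2\circledS\mathfrak g_3)$ (as a manifold $G\times\mathfrak g\times\mathfrak g\times\mathfrak g$). A curve $(g(t),\xi_1(t),\xi_2(t),\xi_3(t))$ is an extremal of the action integral $\int_a^b L(g,\xi_1,\xi_2,\xi_3)\,dt$ with respect to the variations $$\delta g=T_eR_g\eta_2,\quad \delta\xi_1=\eta_3+[\xi_1,\eta_2],\quad \delta\xi_2=\dot\eta_2+[\xi_2,\eta_2],\quad \delta\xi_3=\dot\eta_3+[\xi_2,\eta_3]-[\eta_2,\xi_3],$$ where $(\eta_2,\eta_3)$ are arbitrary smooth curves in $\mathfrak g\times\mathfrak g$ vanishing at the end points, if and only if it satisfies the trivialized Euler–Lagrange equations $$\frac{d}{dt}\frac{\delta L}{\delta\xi_2}=T_e^*R_g\frac{\delta L}{\delta g}+ad^*_{\xi_1}\frac{\delta L}{\delta\xi_1}+ad^*_{\xi_2}\frac{\delta L}{\delta\xi_2}+ad^*_{\xi_3}\frac{\delta L}{\delta\xi_3},$$ $$\frac{d}{dt}\frac{\delta L}{\delta\xi_3}=\frac{\delta L}{\delta\xi_1}+ad^*_{\xi_2}\frac{\delta L}{\delta\xi_3}.$$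
   Context: Conventions. $G$ is a (finite-dimensional) Lie group with identity $e$, $\mathfrak g=T_eG$, $\mathfrak g^*$ its dual, $\langle\cdot,\cdot\rangle$ the pairing. $L_g,R_g$ are left and right translations; $T_e^*R_g:T_g^*G\to\mathfrak g^*$ is the dual of $T_eR_g$. $I_g=L_{g^{-1}}\circ R_g$, i.e. $I_g(h)=g^{-1}hg$, and $Ad_g=T_eI_g$. The Lie bracket on $\mathfrak g$ is $[\xi,\eta]=ad_\xi\eta=\frac{d}{dt}|_{t=0}Ad_{\exp(t\xi)}\eta$; equivalently, $\xi\mapsto X_\xi$, $X_\xi(g)=T_eR_g\xi$, is a Lie algebra isomorphism onto right invariant vector fields with the Jacobi–Lie bracket. $ad^*_\xi:\mathfrak g^*\to\mathfrak g^*$ is defined by $\langle ad^*_\xi\mu,\eta\rangle=\langle\mu,[\xi,\eta]\rangle$. $\delta L/\delta g\in T_g^*G$ and $\delta L/\delta\xi_i\in\mathfrak g^*$ denote partial derivatives. $G\circledS\mathfrak g$ is $G\times\mathfrak g$ with multiplication $(g,\xi)(h,\eta)=(gh,\xi+Ad_{g^{-1}}\eta)$; it is the right trivialization of $TG$. ${}^{1}TTG$ is the right trivialization of $T(G\circledS\mathfrak g)$ as (group) $\times$ (its Lie algebra); subscripts on $\mathfrak g_1,\mathfrak g_2,\mathfrak g_3$ only label copies of $\mathfrak g$. The Lie algebra $\mathfrak g\circledS\mathfrak g$ of $G\circledS\mathfrak g$ has bracket $[(\xi_2,\xi_3),(\eta_2,\eta_3)]=([\xi_2,\eta_2],[\xi_2,\eta_3]-[\eta_2,\xi_3])$.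 *)

theory Defs
  imports "HOL-Analysis.Analysis"
begin

section \<open>Smooth maps between normed spaces\<close>

text \<open>Finite-dimensional normed spaces. The library class of Euclidean spaces would exclude
  dimension zero, hence zero-dimensional (discrete) Lie groups; this class does not.\<close>

class finite_dim_normed = real_normed_vector +
  assumes finite_dim: "\<exists>B. finite B \<and> (\<forall>x. \<exists>c. x = (\<Sum>b\<in>B. c b *\<^sub>R b))"

instance euclidean_space \<subseteq> finite_dim_normed
proof
  show "\<exists>B::'a set. finite B \<and> (\<forall>x. \<exists>c. x = (\<Sum>b\<in>B. c b *\<^sub>R b))"
    by (metis euclidean_representation finite_Basis)
qed

text \<open>The following are meant for open sets \<open>S\<close> in finite-dimensional domains, where continuity of
  all directional derivatives of a differentiable map is continuity of its derivative.\<close>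

primrec Ck_on :: "nat \<Rightarrow> 'a::real_normed_vector set \<Rightarrow> ('a \<Rightarrow> 'b::real_normed_vector) \<Rightarrow> bool" where
  "Ck_on 0 S f = continuous_on S f"
| "Ck_on (Suc k) S f =
     ((\<forall>x\<in>S. f differentiable (at x)) \<and> (\<forall>v. Ck_on k S (\<lambda>x. frechet_derivative f (at x) v)))"

definition Cinf_on :: "'a::real_normed_vector set \<Rightarrow> ('a \<Rightarrow> 'b::real_normed_vector) \<Rightarrow> bool" where
  "Cinf_on S f \<longleftrightarrow> (\<forall>k. Ck_on k S f)"

section \<open>Smooth manifolds\<close>

type_synonym ('m, 'e) chart = "'m set \<times> ('m \<Rightarrow> 'e)"

definition smooth_atlas :: "('m::topological_space, 'e::real_normed_vector) chart set \<Rightarrow> bool" where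
  "smooth_atlas A \<longleftrightarrow>
     \<Union> (fst ` A) = UNIV \<and>
     (\<forall>(U, \<phi>)\<in>A. open U \<and> open (\<phi> ` U) \<and> homeomorphism U (\<phi> ` U) \<phi> (inv_into U \<phi>)) \<and>
     (\<forall>(U, \<phi>)\<in>A. \<forall>(V, \<psi>)\<in>A. Cinf_on (\<phi> ` (U \<inter> V)) (\<psi> \<circ> inv_into U \<phi>))"

definition vec_atlas :: "('v, 'v) chart set" where
  "vec_atlas = {(UNIV, id)}"

definition prod_atlas ::
    "('m, 'e) chart set \<Rightarrow> ('n, 'f) chart set \<Rightarrow> ('m \<times> 'n, 'e \<times> 'f) chart set" where
  "prod_atlas A B = {(U \<times> V, map_prod \<phi> \<psi>) | U \<phi> V \<psi>. (U, \<phi>) \<in> A \<and> (V, \<psi>) \<in> B}"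

definition smooth_on_open ::
    "('m::topological_space, 'e::real_normed_vector) chart set \<Rightarrow>
     ('n::topological_space, 'f::real_normed_vector) chart set \<Rightarrow> 'm set \<Rightarrow> ('m \<Rightarrow> 'n) \<Rightarrow> bool" where
  "smooth_on_open A B W f \<longleftrightarrow>
     open W \<and> continuous_on W f \<and>
     (\<forall>(U, \<phi>)\<in>A. \<forall>(V, \<psi>)\<in>B. Cinf_on (\<phi> ` (W \<inter> U \<inter> f -` V)) (\<psi> \<circ> f \<circ> inv_into U \<phi>))"

text \<open>A map on an arbitrary subset (for instance on a compact time interval) is smooth if it is the
  restriction of a smooth map on an open neighbourhood of that subset.\<close>

definition smooth_map ::
    "('m::topological_space, 'e::real_normed_vector) chart set \<Rightarrow>
     ('n::topological_space, 'f::real_normed_vector) chart set \<Rightarrow> 'm set \<Rightarrow> ('m \<Rightarrow> 'n) \<Rightarrow> bool" where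
  "smooth_map A B S f \<longleftrightarrow>
     (\<exists>W F. open W \<and> S \<subseteq> W \<and> smooth_on_open A B W F \<and> (\<forall>x\<in>S. F x = f x))"

section \<open>Tangent vectors\<close>

text \<open>A tangent vector at a point \<open>p\<close> is an equivalence class of curves through \<open>p\<close>, encoded by
  the directional derivative it induces on functions that are smooth near \<open>p\<close>. The value on other
  functions is set to 0, so that equality of tangent vectors is equality of functionals. The
  vector space operations are the pointwise ones.\<close>

type_synonym 'm tvec = "('m \<Rightarrow> real) \<Rightarrow> real"

definition smooth_near ::
    "('m::topological_space, 'e::real_normed_vector) chart set \<Rightarrow> 'm \<Rightarrow> ('m \<Rightarrow> real) \<Rightarrow> bool" where
  "smooth_near A p f \<longleftrightarrow> (\<exists>W. open W \<and> p \<in> W \<and> smooth_map A vec_atlas W f)"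

definition velocity ::
    "('m::topological_space, 'e::real_normed_vector) chart set \<Rightarrow> (real \<Rightarrow> 'm) \<Rightarrow> real \<Rightarrow> 'm tvec" where
  "velocity A c t = (\<lambda>f. if smooth_near A (c t) f then deriv (\<lambda>s. f (c s)) t else 0)"

definition tangent_space ::
    "('m::topological_space, 'e::real_normed_vector) chart set \<Rightarrow> 'm \<Rightarrow> 'm tvec set" where
  "tangent_space A p =
     {velocity A c 0 | c. c 0 = p \<and> (\<exists>\<epsilon>>0. smooth_map vec_atlas A {-\<epsilon><..<\<epsilon>} c)}"

definition tangent_map ::
    "('n::topological_space, 'f::real_normed_vector) chart set \<Rightarrow>
     ('m \<Rightarrow> 'n) \<Rightarrow> 'm \<Rightarrow> 'm tvec \<Rightarrow> 'n tvec" where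
  "tangent_map B F p v = (\<lambda>f. if smooth_near B (F p) f then v (f \<circ> F) else 0)"

text \<open>The Jacobi--Lie bracket of vector fields, \<open>[X, Y] f = X (Y f) - Y (X f)\<close>.\<close>

definition jacobi_lie ::
    "('m::topological_space, 'e::real_normed_vector) chart set \<Rightarrow>
     ('m \<Rightarrow> 'm tvec) \<Rightarrow> ('m \<Rightarrow> 'm tvec) \<Rightarrow> 'm \<Rightarrow> 'm tvec" where
  "jacobi_lie A X Y p =
     (\<lambda>f. if smooth_near A p f then X p (\<lambda>q. Y q f) - Y p (\<lambda>q. X q f) else 0)"

section \<open>Lie groups\<close>

text \<open>The type \<open>'e\<close> is the model space of the manifold. The Lie algebra is a finite-dimensional
  vector space \<open>'a\<close> identified with the tangent space at the identity by an arbitrary linear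
  isomorphism \<open>tvec_of\<close>; in finite dimension the choice of norm on \<open>'a\<close> is immaterial.\<close>

record ('g, 'e, 'a) lie_group_data =
  charts :: "('g, 'e) chart set"
  mult :: "'g \<Rightarrow> 'g \<Rightarrow> 'g"
  ident :: "'g"
  inverse_of :: "'g \<Rightarrow> 'g"
  tvec_of :: "'a \<Rightarrow> 'g tvec"

definition lie_group ::
    "('g::{t2_space,second_countable_topology}, 'e::finite_dim_normed, 'a::finite_dim_normed)
       lie_group_data \<Rightarrow> bool" where
  "lie_group G \<longleftrightarrow>
     smooth_atlas (charts G) \<and>
     group (mult G) (ident G) (inverse_of G) \<and>
     smooth_map (prod_atlas (charts G) (charts G)) (charts G) UNIV (\<lambda>(x, y). mult G x y) \<and>
     smooth_map (charts G) (charts G) UNIV (inverse_of G) \<and>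
     bij_betw (tvec_of G) UNIV (tangent_space (charts G) (ident G)) \<and>
     (\<forall>r \<xi> \<eta> f. tvec_of G (r *\<^sub>R \<xi> + \<eta>) f = r * tvec_of G \<xi> f + tvec_of G \<eta> f)"

text \<open>The tangent map at the identity of right translation by \<open>g\<close>, applied to \<open>\<xi>\<close>. For fixed
  \<open>\<xi>\<close>, this is the right invariant vector field generated by \<open>\<xi>\<close>.\<close>

definition T_right :: "('g::topological_space, 'e::real_normed_vector, 'a) lie_group_data \<Rightarrow>
    'g \<Rightarrow> 'a \<Rightarrow> 'g tvec" where
  "T_right G g \<xi> = tangent_map (charts G) (\<lambda>h. mult G h g) (ident G) (tvec_of G \<xi>)"

text \<open>The Lie bracket is the one that makes \<open>\<xi> \<mapsto> T_right G _ \<xi>\<close> a Lie algebra isomorphism onto the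
  right invariant vector fields. For matrix groups it is \<open>\<eta> \<xi> - \<xi> \<eta>\<close>, the opposite of the
  commutator.\<close>

definition lie_bracket :: "('g::topological_space, 'e::real_normed_vector, 'a) lie_group_data \<Rightarrow>
    'a \<Rightarrow> 'a \<Rightarrow> 'a" where
  "lie_bracket G \<xi> \<eta> =
     inv (tvec_of G)
       (jacobi_lie (charts G) (\<lambda>g. T_right G g \<xi>) (\<lambda>g. T_right G g \<eta>) (ident G))"

text \<open>The dual of the Lie algebra is the space of bounded linear functionals; every linear
  functional is bounded, as the dimension is finite.\<close>

definition ad_star :: "('g::topological_space, 'e::real_normed_vector, 'a::real_normed_vector)
    lie_group_data \<Rightarrow> 'a \<Rightarrow> ('a \<Rightarrow>\<^sub>L real) \<Rightarrow> ('a \<Rightarrow>\<^sub>L real)" where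
  "ad_star G \<xi> \<mu> = Blinfun (\<lambda>\<eta>. blinfun_apply \<mu> (lie_bracket G \<xi> \<eta>))"

text \<open>Covectors on \<open>G\<close> are functionals on tangent vectors; \<open>T_right_dual G g\<close> is the dual of
  \<open>T_right G g\<close>.\<close>

definition T_right_dual :: "('g::topological_space, 'e::real_normed_vector, 'a::real_normed_vector)
    lie_group_data \<Rightarrow> 'g \<Rightarrow> ('g tvec \<Rightarrow> real) \<Rightarrow> ('a \<Rightarrow>\<^sub>L real)" where
  "T_right_dual G g \<alpha> = Blinfun (\<lambda>\<eta>. \<alpha> (T_right G g \<eta>))"

section \<open>Partial derivatives of a Lagrangian and extremals\<close>

definition pd_g :: "('g \<times> 'a \<times> 'a \<times> 'a \<Rightarrow> real) \<Rightarrow> 'g \<Rightarrow> 'a \<Rightarrow> 'a \<Rightarrow> 'a \<Rightarrow> ('g tvec \<Rightarrow> real)" where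
  "pd_g L g x1 x2 x3 = (\<lambda>v. v (\<lambda>h. L (h, x1, x2, x3)))"

definition pd_1 :: "('g \<times> 'a::real_normed_vector \<times> 'a \<times> 'a \<Rightarrow> real) \<Rightarrow>
    'g \<Rightarrow> 'a \<Rightarrow> 'a \<Rightarrow> 'a \<Rightarrow> ('a \<Rightarrow>\<^sub>L real)" where
  "pd_1 L g x1 x2 x3 = Blinfun (frechet_derivative (\<lambda>y. L (g, y, x2, x3)) (at x1))"

definition pd_2 :: "('g \<times> 'a::real_normed_vector \<times> 'a \<times> 'a \<Rightarrow> real) \<Rightarrow>
    'g \<Rightarrow> 'a \<Rightarrow> 'a \<Rightarrow> 'a \<Rightarrow> ('a \<Rightarrow>\<^sub>L real)" where
  "pd_2 L g x1 x2 x3 = Blinfun (frechet_derivative (\<lambda>y. L (g, x1, y, x3)) (at x2))"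

definition pd_3 :: "('g \<times> 'a::real_normed_vector \<times> 'a \<times> 'a \<Rightarrow> real) \<Rightarrow>
    'g \<Rightarrow> 'a \<Rightarrow> 'a \<Rightarrow> 'a \<Rightarrow> ('a \<Rightarrow>\<^sub>L real)" where
  "pd_3 L g x1 x2 x3 = Blinfun (frechet_derivative (\<lambda>y. L (g, x1, x2, y)) (at x3))"

text \<open>A deformation of a curve in \<open>G \<times> \<gg> \<times> \<gg> \<times> \<gg>\<close>, smooth in the pair of
  deformation parameter and time, whose infinitesimal variation is the given field
  \<open>(\<delta>g, \<delta>1, \<delta>2, \<delta>3)\<close> along the curve.\<close>

definition deformation ::
    "('g::topological_space, 'e::real_normed_vector) chart set \<Rightarrow> real \<Rightarrow> real \<Rightarrow>
     (real \<Rightarrow> 'g) \<times> (real \<Rightarrow> 'a::real_normed_vector) \<times> (real \<Rightarrow> 'a) \<times> (real \<Rightarrow> 'a) \<Rightarrow>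
     (real \<Rightarrow> 'g tvec) \<times> (real \<Rightarrow> 'a) \<times> (real \<Rightarrow> 'a) \<times> (real \<Rightarrow> 'a) \<Rightarrow>
     (real \<times> real \<Rightarrow> 'g \<times> 'a \<times> 'a \<times> 'a) \<Rightarrow> bool" where
  "deformation A a b = (\<lambda>(g, \<xi>1, \<xi>2, \<xi>3) (\<delta>g, \<delta>1, \<delta>2, \<delta>3) \<Gamma>.
     (\<exists>\<epsilon>>0. smooth_map vec_atlas (prod_atlas A vec_atlas) ({-\<epsilon><..<\<epsilon>} \<times> {a..b}) \<Gamma>) \<and>
     (\<forall>t\<in>{a..b}. \<Gamma> (0, t) = (g t, \<xi>1 t, \<xi>2 t, \<xi>3 t)) \<and>
     (\<forall>t\<in>{a..b}.
        velocity A (\<lambda>s. fst (\<Gamma> (s, t))) 0 = \<delta>g t \<and>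
        ((\<lambda>s. snd (\<Gamma> (s, t))) has_vector_derivative (\<delta>1 t, \<delta>2 t, \<delta>3 t)) (at 0)))"

text \<open>Extremality of the action with respect to a set \<open>V\<close> of infinitesimal variations.\<close>

definition extremal ::
    "('g::topological_space, 'e::real_normed_vector) chart set \<Rightarrow>
     ('g \<times> 'a::real_normed_vector \<times> 'a \<times> 'a \<Rightarrow> real) \<Rightarrow> real \<Rightarrow> real \<Rightarrow>
     ((real \<Rightarrow> 'g tvec) \<times> (real \<Rightarrow> 'a) \<times> (real \<Rightarrow> 'a) \<times> (real \<Rightarrow> 'a)) set \<Rightarrow>
     (real \<Rightarrow> 'g) \<times> (real \<Rightarrow> 'a) \<times> (real \<Rightarrow> 'a) \<times> (real \<Rightarrow> 'a) \<Rightarrow> bool" where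
  "extremal A L a b V c \<longleftrightarrow>
     (\<forall>\<delta>\<in>V. \<forall>\<Gamma>. deformation A a b c \<delta> \<Gamma> \<longrightarrow>
        ((\<lambda>s. integral {a..b} (\<lambda>t. L (\<Gamma> (s, t)))) has_real_derivative 0) (at 0))"

text \<open>The infinitesimal variations generated by the curves \<open>(\<eta>2, \<eta>3)\<close> in \<open>\<gg> \<times> \<gg>\<close> that vanish
  at the end points.\<close>

definition reduced_variations ::
    "('g::topological_space, 'e::real_normed_vector, 'a::real_normed_vector) lie_group_data \<Rightarrow>
     real \<Rightarrow> real \<Rightarrow>
     (real \<Rightarrow> 'g) \<times> (real \<Rightarrow> 'a) \<times> (real \<Rightarrow> 'a) \<times> (real \<Rightarrow> 'a) \<Rightarrow>
     ((real \<Rightarrow> 'g tvec) \<times> (real \<Rightarrow> 'a) \<times> (real \<Rightarrow> 'a) \<times> (real \<Rightarrow> 'a)) set" where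
  "reduced_variations G a b = (\<lambda>(g, \<xi>1, \<xi>2, \<xi>3).
     {(\<lambda>t. T_right G (g t) (\<eta>2 t),
       \<lambda>t. \<eta>3 t + lie_bracket G (\<xi>1 t) (\<eta>2 t),
       \<lambda>t. vector_derivative \<eta>2 (at t within {a..b}) + lie_bracket G (\<xi>2 t) (\<eta>2 t),
       \<lambda>t. vector_derivative \<eta>3 (at t within {a..b}) + lie_bracket G (\<xi>2 t) (\<eta>3 t)
             - lie_bracket G (\<eta>2 t) (\<xi>3 t)) | \<eta>2 \<eta>3.
       smooth_map vec_atlas vec_atlas {a..b} \<eta>2 \<and> smooth_map vec_atlas vec_atlas {a..b} \<eta>3 \<and>
       \<eta>2 a = 0 \<and> \<eta>2 b = 0 \<and> \<eta>3 a = 0 \<and> \<eta>3 b = 0})"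

end

(* Differentiating the action under the integral sign along a deformation and integrating by parts
   gives the integral of E2(eta2) + E3(eta3), where E2 and E3 are the differences of the two sides of
   the Euler-Lagrange equations. Conversely, every pair eta2 = p v, eta3 = q w with polynomials p and q
   vanishing at the end points comes from a deformation, so an extremal annihilates all of these;
   approximating the coefficients of E2 and E3 by polynomials (Weierstrass) forces both to vanish.
   The differential geometric input is that the partial derivatives of L along the curve are smooth
   in time, and that the Jacobi-Lie bracket of right invariant fields is a tangent vector at the
   identity: otherwise lie_bracket would be an arbitrary value of inv, and not bilinear. *)
theory Submission
  imports Defs
begin

section \<open>Finite-dimensional normed spaces\<close>

text \<open>\<open>extremal\<close> quantifies over deformations, so a variation that no deformation
  realizes imposes no condition. Passing from extremality to the equations therefore hinges on
  constructing deformations. Polynomial test functions are smooth on the whole line, and a factor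
  \<open>(t - a) * (b - t)\<close> makes them vanish at both end points. Tangent vectors are
  functionals on functions, with value 0 away from smooth ones, while the two equations live in the
  dual of a normed space. The link is \<open>tvec_of\<close>, whose inverse is meaningful only on
  the tangent space at the identity. That the bracket lands there rests on the symmetry of second
  derivatives in a chart. Model space and Lie algebra range over \<open>finite_dim_normed\<close>,
  which admits dimension zero and provides no distinguished basis. Boundedness of linear maps, the
  chain rule of order k and componentwise differentiation all go through coordinate functionals
  obtained from a finite spanning set. A curve is smooth on \<open>{a..b}\<close> as the restriction
  of a smooth curve on a neighbourhood. The variational argument is carried out for the extensions
  and transferred back, since extremality and both equations only see the values on
  \<open>{a..b}\<close>.\<close>

text \<open>One half of the equivalence of norms, by induction on the basis. A new vector
  \<open>b\<close> has positive distance \<open>d\<close> from the span of \<open>B\<close>: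
  otherwise combinations of \<open>B\<close> converge to \<open>b\<close>, the bound for
  \<open>B\<close> makes their coefficients Cauchy, and the limit lies in the span. The distance
  \<open>d\<close> then controls the coefficient of \<open>b\<close>.\<close>

lemma coefficients_bounded:
  fixes B :: "'a::real_normed_vector set"
  assumes "finite B" "independent B"
  shows "\<exists>C>0. \<forall>u. (\<Sum>b\<in>B. \<bar>u b\<bar>) \<le> C * norm (\<Sum>b\<in>B. u b *\<^sub>R b)"
  using assms
proof (induction B rule: finite_induct)
  case empty
  show ?case by (intro exI[of _ 1]) auto
next
  case (insert b B)
  have ind: "independent B" and bB: "b \<notin> span B"
    using insert.prems insert.hyps by (auto simp: independent_insert)
  obtain C where C: "C > 0" "\<And>u. (\<Sum>b\<in>B. \<bar>u b\<bar>) \<le> C * norm (\<Sum>b\<in>B. u b *\<^sub>R b)"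
    using insert.IH[OF ind] by blast
  have "\<exists>d>0. \<forall>u. d \<le> norm (b - (\<Sum>b\<in>B. u b *\<^sub>R b))"
  proof (rule ccontr)
    assume "\<not> ?thesis"
    then have "\<exists>u. norm (b - (\<Sum>b\<in>B. u b *\<^sub>R b)) < inverse (Suc n)" for n
      by (meson inverse_positive_iff_positive not_le of_nat_0_less_iff zero_less_Suc)
    then obtain u where u: "\<And>n. norm (b - (\<Sum>b\<in>B. u n b *\<^sub>R b)) < inverse (Suc n)"
      by metis
    define x where "x n = (\<Sum>b\<in>B. u n b *\<^sub>R b)" for n
    have "(\<lambda>n. b - x n) \<longlonglongrightarrow> 0"
      by (rule Lim_null_comparison[OF _ LIMSEQ_inverse_real_of_nat])
        (use u in \<open>auto simp: x_def less_imp_le\<close>)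
    then have xb: "x \<longlonglongrightarrow> b"
      using tendsto_diff[OF tendsto_const[of b]] by fastforce
    then have cx: "Cauchy x" by (rule LIMSEQ_imp_Cauchy)
    have diff: "\<bar>u m c - u n c\<bar> \<le> C * norm (x m - x n)" if "c \<in> B" for m n c
    proof -
      have "\<bar>u m c - u n c\<bar> \<le> (\<Sum>b\<in>B. \<bar>u m b - u n b\<bar>)"
        using that insert.hyps by (intro member_le_sum) auto
      also have "\<dots> \<le> C * norm (\<Sum>b\<in>B. (u m b - u n b) *\<^sub>R b)"
        by (rule C(2))
      finally show ?thesis
        by (simp add: x_def scaleR_diff_left sum_subtractf)
    qed
    have "\<exists>l. (\<lambda>n. u n c) \<longlonglongrightarrow> l" if "c \<in> B" for c
    proof -
      have "Cauchy (\<lambda>n. u n c)"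
      proof (rule CauchyI)
        fix e :: real assume "e > 0"
        then obtain M where M: "\<And>m n. m \<ge> M \<Longrightarrow> n \<ge> M \<Longrightarrow> norm (x m - x n) < e / C"
          using CauchyD[OF cx, of "e / C"] C(1) by auto
        show "\<exists>M. \<forall>m\<ge>M. \<forall>n\<ge>M. norm (u m c - u n c) < e"
        proof (intro exI[of _ M] allI impI)
          fix m n assume "M \<le> m" "M \<le> n"
          then show "norm (u m c - u n c) < e"
            using M[of m n] diff[OF that, of m n] C(1) by (simp add: field_simps)
        qed
      qed
      then show ?thesis
        using convergent_def real_Cauchy_convergent by blast
    qed
    then obtain l where l: "\<And>c. c \<in> B \<Longrightarrow> (\<lambda>n. u n c) \<longlonglongrightarrow> l c" by metis
    have "x \<longlonglongrightarrow> (\<Sum>b\<in>B. l b *\<^sub>R b)"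
      unfolding x_def by (intro tendsto_sum tendsto_scaleR l tendsto_const)
    then have "b = (\<Sum>b\<in>B. l b *\<^sub>R b)"
      using xb LIMSEQ_unique by blast
    moreover have "(\<Sum>b\<in>B. l b *\<^sub>R b) \<in> span B"
      by (intro span_sum span_scale span_base)
    ultimately have "b \<in> span B" by simp
    then show False using bB by blast
  qed
  then obtain d where d: "d > 0" "\<And>u. d \<le> norm (b - (\<Sum>b\<in>B. u b *\<^sub>R b))" by blast
  \<comment> \<open>The coefficient of \<open>b\<close> is at most \<open>norm z / d\<close>. The
    remaining part \<open>z - u b *\<^sub>R b\<close> has norm at most
    \<open>norm z + norm z / d * norm b\<close>, and \<open>C\<close> bounds its coefficients. The
    constant is the sum of the two contributions.\<close>
  have main: "(\<Sum>b\<in>insert b B. \<bar>u b\<bar>) \<le> (1 / d + C * (1 + norm b / d)) *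
      norm (\<Sum>b\<in>insert b B. u b *\<^sub>R b)" for u
  proof -
    define y where "y = (\<Sum>b\<in>B. u b *\<^sub>R b)"
    define z where "z = u b *\<^sub>R b + y"
    have zz: "(\<Sum>b\<in>insert b B. u b *\<^sub>R b) = z"
      using insert.hyps by (simp add: z_def y_def)
    have ub: "\<bar>u b\<bar> * d \<le> norm z"
    proof (cases "u b = 0")
      case False
      \<comment> \<open>Dividing \<open>z\<close> by \<open>u b\<close> turns it into
        \<open>b\<close> minus an element of the span of \<open>B\<close>.\<close>
      have "d \<le> norm (b - (\<Sum>c\<in>B. (- u c / u b) *\<^sub>R c))" by (rule d(2))
      also have "b - (\<Sum>c\<in>B. (- u c / u b) *\<^sub>R c) = (1 / u b) *\<^sub>R z"
        using False by (simp add: z_def y_def scaleR_add_right scaleR_sum_right sum_negf)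
      finally show ?thesis using False by (simp add: field_simps)
    qed simp
    have y: "norm y \<le> norm z + \<bar>u b\<bar> * norm b"
      using norm_triangle_ineq4[of z "u b *\<^sub>R b"] by (simp add: z_def)
    have ub': "\<bar>u b\<bar> \<le> norm z / d" using ub d(1) by (simp add: field_simps)
    have "(\<Sum>b\<in>insert b B. \<bar>u b\<bar>) = \<bar>u b\<bar> + (\<Sum>b\<in>B. \<bar>u b\<bar>)"
      using insert.hyps by simp
    also have "\<dots> \<le> \<bar>u b\<bar> + C * norm y" using C(2)[of u] by (simp add: y_def)
    also have "\<dots> \<le> norm z / d + C * (norm z + norm z / d * norm b)"
      using ub' y C(1) mult_right_mono[OF ub' norm_ge_zero[of b]]
      by (intro add_mono mult_left_mono) auto
    also have "\<dots> = (1 / d + C * (1 + norm b / d)) * norm z"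
      by (simp add: field_simps)
    finally show ?thesis by (simp add: zz)
  qed
  show ?case
    using main C(1) d(1)
    by (intro exI[of _ "1 / d + C * (1 + norm b / d)"])
      (auto intro!: add_pos_nonneg mult_nonneg_nonneg add_nonneg_nonneg)
qed

text \<open>A finite spanning set is thinned to a basis, and \<open>coefficients_bounded\<close>
  makes its coordinates continuous. For \<open>b\<close> outside the basis the coordinate is zero,
  so boundedness holds for every \<open>b\<close>.\<close>

lemma finite_dim_coordinates:
  obtains B :: "'a::finite_dim_normed set" and c :: "'a \<Rightarrow> 'a \<Rightarrow> real"
  where "finite B" "\<And>b. bounded_linear (c b)" "\<And>x. (\<Sum>b\<in>B. c b x *\<^sub>R b) = x"
proof -
  obtain B0 :: "'a set" where B0: "finite B0" "\<And>x. \<exists>c. x = (\<Sum>b\<in>B0. c b *\<^sub>R b)"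
    using finite_dim by blast
  have "x \<in> span B0" for x :: 'a
  proof -
    obtain c where "x = (\<Sum>b\<in>B0. c b *\<^sub>R b)" using B0(2) by blast
    also have "\<dots> \<in> span B0" by (intro span_sum span_scale span_base)
    finally show ?thesis .
  qed
  then have sp0: "span B0 = UNIV" by auto
  obtain B where B: "B \<subseteq> B0" "independent B" "B0 \<subseteq> span B"
    using maximal_independent_subset by blast
  have fin: "finite B" using B B0 finite_subset by blast
  have sp: "span B = UNIV"
    using B(3) sp0 by (metis span_mono span_span top.extremum_uniqueI)
  have rep: "(\<Sum>b\<in>B. representation B x b *\<^sub>R b) = x" for x
    by (rule real_vector.sum_representation_eq[OF B(2) _ fin order_refl]) (simp add: sp)
  obtain C where C: "C > 0" "\<And>u. (\<Sum>b\<in>B. \<bar>u b\<bar>) \<le> C * norm (\<Sum>b\<in>B. u b *\<^sub>R b)"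
    using coefficients_bounded[OF fin B(2)] by blast
  have bl: "bounded_linear (\<lambda>x. representation B x b)" for b
  proof (rule bounded_linear_intro[where K = C])
    show "representation B (x + y) b = representation B x b + representation B y b" for x y
      by (simp add: real_vector.representation_add[OF B(2)] sp)
    show "representation B (r *\<^sub>R x) b = r *\<^sub>R representation B x b" for r x
      by (simp add: real_vector.representation_scale[OF B(2)] sp)
    show "norm (representation B x b) \<le> norm x * C" for x
    proof (cases "b \<in> B")
      case True
      have "\<bar>representation B x b\<bar> \<le> (\<Sum>b\<in>B. \<bar>representation B x b\<bar>)"
        using True fin by (intro member_le_sum) auto
      then show ?thesis using C(2)[of "representation B x"] by (simp add: rep mult.commute)
    next
      case False
      then have "representation B x b = 0"
        using real_vector.representation_ne_zero by blast
      then show ?thesis using C(1) by simp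
    qed
  qed
  show thesis
    by (rule that[of B "\<lambda>b x. representation B x b"]) (simp_all add: fin bl rep)
qed

lemma linear_imp_bounded_linear:
  fixes f :: "'a::finite_dim_normed \<Rightarrow> 'b::real_normed_vector"
  assumes "linear f"
  shows "bounded_linear f"
proof -
  obtain B :: "'a set" and c where c: "finite B" "\<And>b. bounded_linear (c b)"
      "\<And>x. (\<Sum>b\<in>B. c b x *\<^sub>R b) = x"
    using finite_dim_coordinates by blast
  have "f x = (\<Sum>b\<in>B. c b x *\<^sub>R f b)" for x
    by (subst c(3)[of x, symmetric])
      (simp add: linear_sum[OF assms] linear_cmul[OF assms])
  moreover have "bounded_linear (\<lambda>x. \<Sum>b\<in>B. c b x *\<^sub>R f b)"
    by (intro bounded_linear_sum bounded_linear_scaleR_const c(2))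
  ultimately show ?thesis by (metis (no_types, lifting) ext)
qed

text \<open>Expanding the first argument in coordinates leaves the finitely many linear maps
  \<open>h b\<close>, each of them bounded.\<close>

lemma bilinear_imp_bounded_bilinear:
  fixes h :: "'a::finite_dim_normed \<Rightarrow> 'b::finite_dim_normed \<Rightarrow> 'c::real_normed_vector"
  assumes "bilinear h"
  shows "bounded_bilinear h"
proof -
  obtain B :: "'a set" and c where c: "finite B" "\<And>b. bounded_linear (c b)"
      "\<And>x. (\<Sum>b\<in>B. c b x *\<^sub>R b) = x"
    using finite_dim_coordinates by blast
  have lin: "linear (\<lambda>x. h x y)" "linear (h x)" for x y
    using assms by (auto simp: bilinear_def)
  have *: "h x y = (\<Sum>b\<in>B. c b x *\<^sub>R h b y)" for x y
  proof -
    have "h x y = h (\<Sum>b\<in>B. c b x *\<^sub>R b) y" by (simp add: c(3))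
    then show ?thesis
      by (simp add: linear_sum[OF lin(1)[of y]] linear_cmul[OF lin(1)[of y]])
  qed
  have "\<exists>K. \<forall>x y. norm (h x y) \<le> norm x * norm y * K"
  proof -
    have "\<forall>b. \<exists>K. \<forall>x. \<bar>c b x\<bar> \<le> norm x * K"
      using bounded_linear.bounded[OF c(2)] by fastforce
    then obtain K1 where K1: "\<And>b x. \<bar>c b x\<bar> \<le> norm x * K1 b" by metis
    have "\<forall>b. \<exists>K. \<forall>y. norm (h b y) \<le> norm y * K"
      using bounded_linear.bounded[OF linear_imp_bounded_linear[OF lin(2)]] by fastforce
    then obtain K2 where K2: "\<And>b y. norm (h b y) \<le> norm y * K2 b" by metis
    have "norm (h x y) \<le> norm x * norm y * (\<Sum>b\<in>B. K1 b * K2 b)" for x y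
    proof -
      have "norm (h x y) \<le> (\<Sum>b\<in>B. \<bar>c b x\<bar> * norm (h b y))"
        by (subst *) (rule order_trans[OF norm_sum], simp)
      also have "\<dots> \<le> (\<Sum>b\<in>B. (norm x * K1 b) * (norm y * K2 b))"
        by (intro sum_mono mult_mono K1 K2) (auto intro: order_trans[OF _ K1])
      finally show ?thesis by (simp add: sum_distrib_left mult_ac)
    qed
    then show ?thesis by blast
  qed
  then show ?thesis
    by unfold_locales
      (auto simp: linear_add[OF lin(1)] linear_add[OF lin(2)] linear_cmul[OF lin(1)] linear_cmul[OF lin(2)])
qed

text \<open>Products occur both as model spaces of product manifolds and as the vector argument of
  the Lagrangian, a triple of Lie algebra elements.\<close>

instance prod :: (finite_dim_normed, finite_dim_normed) finite_dim_normed
proof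
  obtain B :: "'a set" and c where c: "finite B" "\<And>x. (\<Sum>b\<in>B. c b x *\<^sub>R b) = x"
    using finite_dim_coordinates by metis
  obtain B' :: "'b set" and c' where c': "finite B'" "\<And>x. (\<Sum>b\<in>B'. c' b x *\<^sub>R b) = x"
    using finite_dim_coordinates by metis
  define S where "S = (\<lambda>b. (b, 0::'b)) ` B \<union> (\<lambda>b. (0::'a, b)) ` B'"
  have "x \<in> span S" for x
  proof -
    have "x = (\<Sum>b\<in>B. c b (fst x) *\<^sub>R (b, 0)) + (\<Sum>b\<in>B'. c' b (snd x) *\<^sub>R (0, b))"
      by (rule prod_eqI) (simp_all add: fst_sum snd_sum c c')
    also have "\<dots> \<in> span S"
      by (intro span_add span_sum span_scale span_base) (auto simp: S_def)
    finally show ?thesis .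
  qed
  moreover have fin: "finite S" by (simp add: S_def c c')
  ultimately have "\<forall>x. x \<in> range (\<lambda>c. \<Sum>b\<in>S. c b *\<^sub>R b)"
    by (simp add: span_finite[OF fin])
  then show "\<exists>B::('a \<times> 'b) set. finite B \<and> (\<forall>x. \<exists>c. x = (\<Sum>b\<in>B. c b *\<^sub>R b))"
    using fin by (intro exI[of _ S]) (simp add: image_iff)
qed

section \<open>Differentiation of operator-valued curves\<close>

text \<open>Pointwise differentiability implies differentiability in operator norm because the
  domain is finite-dimensional: every operator \<open>Q\<close> is the finite sum of the
  \<open>J b (Q b)\<close>, where \<open>J b\<close> is bounded linear in its argument.\<close>

lemma has_vector_derivative_blinfun_componentwise:
  fixes P :: "real \<Rightarrow> 'a::finite_dim_normed \<Rightarrow>\<^sub>L 'b::real_normed_vector"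
  shows "(P has_vector_derivative P') (at t within S) \<longleftrightarrow>
    (\<forall>v. ((\<lambda>t. blinfun_apply (P t) v) has_vector_derivative blinfun_apply P' v) (at t within S))"
    (is "?L \<longleftrightarrow> ?R")
proof
  assume ?L
  then show ?R
    by (auto intro: bounded_linear.has_vector_derivative[OF blinfun.bounded_linear_left])
next
  assume R: ?R
  obtain B :: "'a set" and c where c: "finite B" "\<And>b. bounded_linear (c b)"
      "\<And>x. (\<Sum>b\<in>B. c b x *\<^sub>R b) = x"
    using finite_dim_coordinates by blast
  \<comment> \<open>The operator of rank at most one that sends \<open>v\<close> to its
    \<open>b\<close>-th coordinate times \<open>w\<close>.\<close>
  define J where "J b w = Blinfun (\<lambda>v. c b v *\<^sub>R (w::'b))" for b w
  have J: "blinfun_apply (J b w) v = c b v *\<^sub>R w" for b w v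
    unfolding J_def
    by (subst bounded_linear_Blinfun_apply) (auto intro: bounded_linear_scaleR_const c)
  have Jl: "bounded_linear (J b)" for b
  proof -
    obtain K where K: "\<And>x. norm (c b x) \<le> norm x * K"
      using bounded_linear.bounded[OF c(2)] by blast
    show ?thesis
    proof (rule bounded_linear_intro[where K = "\<bar>K\<bar>"])
      show "J b (x + y) = J b x + J b y" for x y
        by (rule blinfun_eqI) (simp add: J blinfun.add_left scaleR_add_right)
      show "J b (r *\<^sub>R x) = r *\<^sub>R J b x" for r x
        by (rule blinfun_eqI) (simp add: J blinfun.scaleR_left mult.commute)
      show "norm (J b w) \<le> norm w * \<bar>K\<bar>" for w
      proof (rule norm_blinfun_bound)
        fix v
        have "norm (J b w v) = \<bar>c b v\<bar> * norm w" by (simp add: J)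
        also have "\<dots> \<le> (norm v * \<bar>K\<bar>) * norm w"
          using order_trans[OF K[of v] mult_left_mono[OF abs_ge_self norm_ge_zero]]
          by (intro mult_right_mono) auto
        finally show "norm (J b w v) \<le> norm w * \<bar>K\<bar> * norm v" by (simp add: mult_ac)
      qed simp
    qed
  qed
  have expand: "Q = (\<Sum>b\<in>B. J b (blinfun_apply Q b))" for Q
  proof (rule blinfun_eqI)
    fix v
    have "blinfun_apply Q v = blinfun_apply Q (\<Sum>b\<in>B. c b v *\<^sub>R b)" by (simp add: c(3))
    also have "\<dots> = blinfun_apply (\<Sum>b\<in>B. J b (blinfun_apply Q b)) v"
      by (simp add: blinfun.sum_right blinfun.sum_left blinfun.scaleR_right J)
    finally show "blinfun_apply Q v = blinfun_apply (\<Sum>b\<in>B. J b (blinfun_apply Q b)) v" .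
  qed
  have "((\<lambda>t. \<Sum>b\<in>B. J b (blinfun_apply (P t) b)) has_vector_derivative
      (\<Sum>b\<in>B. J b (blinfun_apply P' b))) (at t within S)"
    using R by (intro has_vector_derivative_sum bounded_linear.has_vector_derivative[OF Jl]) auto
  then show ?L by (simp flip: expand)
qed

section \<open>Calculus of smooth maps between normed spaces\<close>

lemma has_vector_derivative_chain:
  assumes "(c has_vector_derivative c') (at t within S)" "(f has_derivative f') (at (c t))"
  shows "((\<lambda>t. f (c t)) has_vector_derivative f' c') (at t within S)"
  using vector_derivative_diff_chain_within[OF assms(1) has_derivative_at_withinI[OF assms(2)]]
  by (simp add: o_def)

section \<open>Rules for maps of class C^k\<close>

lemma Ck_on_SucD:
  assumes "Ck_on (Suc k) S f"
  shows "x \<in> S \<Longrightarrow> (f has_derivative frechet_derivative f (at x)) (at x)"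
    and "Ck_on k S (\<lambda>x. frechet_derivative f (at x) v)"
  using assms by (auto simp flip: frechet_derivative_works)

lemma Ck_on_imp_continuous_on: "Ck_on k S f \<Longrightarrow> continuous_on S f"
  by (cases k)
    (auto intro!: continuous_at_imp_continuous_on differentiable_imp_continuous_within)

lemma Ck_on_Suc_imp: "Ck_on (Suc k) S f \<Longrightarrow> Ck_on k S f"
proof (induction k arbitrary: f)
  case 0
  then show ?case using Ck_on_imp_continuous_on by fastforce
next
  case (Suc k)
  show ?case
    unfolding Ck_on.simps(2)[of k]
    using Suc.IH Suc.prems unfolding Ck_on.simps(2)[of "Suc k"] by blast
qed

lemma Ck_on_subset: "Ck_on k S f \<Longrightarrow> T \<subseteq> S \<Longrightarrow> Ck_on k T f"
proof (induction k arbitrary: f)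
  case 0
  then show ?case by (auto intro: continuous_on_subset)
next
  case (Suc k)
  then show ?case by (simp add: subset_iff)
qed

lemma Ck_on_cong:
  assumes "open S" "\<And>x. x \<in> S \<Longrightarrow> f x = g x" "Ck_on k S f"
  shows "Ck_on k S g"
  using assms(2,3)
proof (induction k arbitrary: f g)
  case 0
  then show ?case by (auto cong: continuous_on_cong)
next
  case (Suc k)
  have d: "(g has_derivative frechet_derivative f (at x)) (at x)" if "x \<in> S" for x
    by (rule has_derivative_transform_within_open[OF Ck_on_SucD(1)[OF Suc.prems(2)] assms(1)])
      (use that Suc.prems(1) in auto)
  have e: "frechet_derivative f (at x) = frechet_derivative g (at x)" if "x \<in> S" for x
    using frechet_derivative_at[OF d[OF that]] .
  have "Ck_on k S (\<lambda>x. frechet_derivative g (at x) v)" for v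
    by (rule Suc.IH[OF _ Ck_on_SucD(2)[OF Suc.prems(2)]]) (simp add: e)
  then show ?case using d by (auto simp: differentiable_def)
qed

text \<open>Admits any known derivative in place of the chosen \<open>frechet_derivative\<close>.
  The two agree on \<open>S\<close> only, so openness enters through \<open>Ck_on_cong\<close>,
  where the derivative at a point of \<open>S\<close> must depend on values in \<open>S\<close>
  alone.\<close>

lemma Ck_on_SucI:
  assumes "open S" "\<And>x. x \<in> S \<Longrightarrow> (f has_derivative f' x) (at x)" "\<And>v. Ck_on k S (\<lambda>x. f' x v)"
  shows "Ck_on (Suc k) S f"
proof -
  have "Ck_on k S (\<lambda>x. frechet_derivative f (at x) v)" for v
    by (rule Ck_on_cong[OF assms(1) _ assms(3)[of v]]) (simp add: frechet_derivative_at[OF assms(2)])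
  then show ?thesis using assms(2) by (auto simp: differentiable_def)
qed

lemma Ck_on_local:
  assumes "\<And>x. x \<in> S \<Longrightarrow> \<exists>T. open T \<and> x \<in> T \<and> Ck_on k T f"
  shows "Ck_on k S f"
  using assms
proof (induction k arbitrary: f)
  case 0
  show ?case
    unfolding Ck_on.simps
  proof (rule continuous_at_imp_continuous_on, intro ballI)
    fix x assume "x \<in> S"
    then obtain T where "open T" "x \<in> T" "continuous_on T f" using 0 by auto
    then show "isCont f x" by (simp add: continuous_on_eq_continuous_at)
  qed
next
  case (Suc k)
  have "Ck_on k S (\<lambda>x. frechet_derivative f (at x) v)" for v
    by (rule Suc.IH) (use Suc.prems in fastforce)
  then show ?case using Suc.prems by fastforce
qed

lemma Ck_on_const: "Ck_on k S (\<lambda>x. c)"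
  by (induction k arbitrary: c) auto

lemma Ck_on_linear: "bounded_linear f \<Longrightarrow> open S \<Longrightarrow> Ck_on k S f"
  by (cases k)
    (auto intro!: Ck_on_SucI[where f' = "\<lambda>x. f"] Ck_on_const bounded_linear_imp_has_derivative
      simp del: Ck_on.simps(2) simp: linear_continuous_on)

lemma Ck_on_linear_compose:
  assumes "bounded_linear h" "open S" "Ck_on k S f"
  shows "Ck_on k S (\<lambda>x. h (f x))"
  using assms(3)
proof (induction k arbitrary: f)
  case 0
  then show ?case
    using bounded_linear.continuous_on[OF assms(1)] by simp
next
  case (Suc k)
  show ?case
    by (rule Ck_on_SucI[OF assms(2) bounded_linear.has_derivative[OF assms(1) Ck_on_SucD(1)[OF Suc.prems]]])
      (auto intro: Suc.IH Ck_on_SucD(2)[OF Suc.prems])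
qed

lemma Ck_on_add:
  assumes "open S" "Ck_on k S f" "Ck_on k S g"
  shows "Ck_on k S (\<lambda>x. f x + g x)"
  using assms(2,3)
proof (induction k arbitrary: f g)
  case 0
  then show ?case by (simp add: continuous_on_add)
next
  case (Suc k)
  show ?case
    by (rule Ck_on_SucI[OF assms(1) has_derivative_add[OF Ck_on_SucD(1)[OF Suc.prems(1)]
            Ck_on_SucD(1)[OF Suc.prems(2)]]])
      (auto intro: Suc.IH Ck_on_SucD(2)[OF Suc.prems(1)] Ck_on_SucD(2)[OF Suc.prems(2)])
qed

lemma Ck_on_sum:
  assumes "open S" "\<And>i. i \<in> I \<Longrightarrow> Ck_on k S (f i)"
  shows "Ck_on k S (\<lambda>x. \<Sum>i\<in>I. f i x)"
  using assms(2)
  by (induction I rule: infinite_finite_induct) (auto intro: Ck_on_const Ck_on_add[OF assms(1)])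

text \<open>By the Leibniz rule the derivative pairs one factor with the derivative of the other,
  which lost one order. The undifferentiated factor is lowered to the same order before the
  induction hypothesis applies.\<close>

lemma Ck_on_bilinear:
  assumes "bounded_bilinear p" "open S" "Ck_on k S f" "Ck_on k S g"
  shows "Ck_on k S (\<lambda>x. p (f x) (g x))"
  using assms(3,4)
proof (induction k arbitrary: f g)
  case 0
  then show ?case by (simp add: bounded_bilinear.continuous_on[OF assms(1)])
next
  case (Suc k)
  show ?case
  proof (rule Ck_on_SucI[OF assms(2) bounded_bilinear.FDERIV[OF assms(1) Ck_on_SucD(1)[OF Suc.prems(1)]
            Ck_on_SucD(1)[OF Suc.prems(2)]]])
    fix v
    show "Ck_on k S (\<lambda>x. p (f x) (frechet_derivative g (at x) v) + p (frechet_derivative f (at x) v) (g x))"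
      by (intro Ck_on_add assms Suc.IH Ck_on_Suc_imp[OF Suc.prems(1)] Ck_on_Suc_imp[OF Suc.prems(2)]
          Ck_on_SucD(2)[OF Suc.prems(1)] Ck_on_SucD(2)[OF Suc.prems(2)])
  qed
qed

lemma Ck_on_Pair:
  assumes "open S" "Ck_on k S f" "Ck_on k S g"
  shows "Ck_on k S (\<lambda>x. (f x, g x))"
proof -
  have "bounded_linear (\<lambda>x. (x, 0))" "bounded_linear (\<lambda>y. (0, y))"
    by (auto intro: bounded_linear_intros)
  from Ck_on_add[OF assms(1) Ck_on_linear_compose[OF this(1) assms(1,2)]
      Ck_on_linear_compose[OF this(2) assms(1,3)]]
  show ?thesis by simp
qed

text \<open>The chain rule evaluates the derivative of \<open>g\<close> in the direction
  \<open>frechet_derivative f (at x) v\<close>, which moves with \<open>x\<close>, whereas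
  \<open>Ck_on\<close> controls derivatives in fixed directions. Coordinates in the intermediate
  space rewrite it as a finite sum of products of coordinates of that direction with derivatives in
  the fixed directions \<open>b\<close>.\<close>

lemma Ck_on_compose:
  fixes f :: "'a::real_normed_vector \<Rightarrow> 'b::finite_dim_normed" and g :: "'b \<Rightarrow> 'c::real_normed_vector"
  assumes "open S" "open T" "f ` S \<subseteq> T" "Ck_on k S f" "Ck_on k T g"
  shows "Ck_on k S (\<lambda>x. g (f x))"
  using assms(4,5)
proof (induction k arbitrary: g)
  case 0
  then show ?case using continuous_on_compose2[of T g S f] assms(3) by simp
next
  case (Suc k)
  obtain B :: "'b set" and c where c: "finite B" "\<And>b. bounded_linear (c b)"
      "\<And>x. (\<Sum>b\<in>B. c b x *\<^sub>R b) = x"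
    using finite_dim_coordinates by blast
  have dg: "(g has_derivative frechet_derivative g (at (f x))) (at (f x))" if "x \<in> S" for x
    using Ck_on_SucD(1)[OF Suc.prems(2)] assms(3) that by auto
  show ?case
  proof (rule Ck_on_SucI[OF assms(1) has_derivative_compose[OF Ck_on_SucD(1)[OF Suc.prems(1)] dg]])
    fix v
    have "frechet_derivative g (at (f x)) w = (\<Sum>b\<in>B. c b w *\<^sub>R frechet_derivative g (at (f x)) b)"
      if "x \<in> S" for x w
    proof -
      have lin: "linear (frechet_derivative g (at (f x)))"
        using dg[OF that] has_derivative_linear by blast
      have "frechet_derivative g (at (f x)) w = frechet_derivative g (at (f x)) (\<Sum>b\<in>B. c b w *\<^sub>R b)"
        by (simp add: c(3))
      then show ?thesis by (simp only: linear_sum[OF lin] linear_cmul[OF lin])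
    qed
    note * = this
    show "Ck_on k S (\<lambda>x. frechet_derivative g (at (f x)) (frechet_derivative f (at x) v))"
    proof (rule Ck_on_cong[OF assms(1)])
      show "Ck_on k S (\<lambda>x. \<Sum>b\<in>B. c b (frechet_derivative f (at x) v) *\<^sub>R frechet_derivative g (at (f x)) b)"
        by (intro Ck_on_sum Ck_on_bilinear[OF bounded_bilinear_scaleR] assms(1)
            Ck_on_linear_compose[OF c(2)] Ck_on_SucD(2)[OF Suc.prems(1)]
            Suc.IH[OF Ck_on_Suc_imp[OF Suc.prems(1)]] Ck_on_SucD(2)[OF Suc.prems(2)])
    qed (use * in auto)
  qed auto
qed

lemma Cinf_on_imp_continuous_on: "Cinf_on S f \<Longrightarrow> continuous_on S f"
  using Ck_on_imp_continuous_on unfolding Cinf_on_def by blast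

lemma Cinf_on_has_derivative:
  assumes "Cinf_on S f" "x \<in> S"
  shows "(f has_derivative frechet_derivative f (at x)) (at x)"
  using assms Ck_on_SucD(1) unfolding Cinf_on_def by blast

lemma Cinf_on_frechet_derivative: "Cinf_on S f \<Longrightarrow> Cinf_on S (\<lambda>x. frechet_derivative f (at x) v)"
  using Ck_on_SucD(2) unfolding Cinf_on_def by blast

lemma Cinf_on_subset: "Cinf_on S f \<Longrightarrow> T \<subseteq> S \<Longrightarrow> Cinf_on T f"
  using Ck_on_subset unfolding Cinf_on_def by blast

lemma Cinf_on_cong: "open S \<Longrightarrow> (\<And>x. x \<in> S \<Longrightarrow> f x = g x) \<Longrightarrow> Cinf_on S f \<Longrightarrow> Cinf_on S g"
  using Ck_on_cong unfolding Cinf_on_def by metis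

lemma Cinf_on_local: "(\<And>x. x \<in> S \<Longrightarrow> \<exists>T. open T \<and> x \<in> T \<and> Cinf_on T f) \<Longrightarrow> Cinf_on S f"
  unfolding Cinf_on_def by (meson Ck_on_local)

lemma Cinf_on_const: "Cinf_on S (\<lambda>x. c)"
  using Ck_on_const unfolding Cinf_on_def by blast

lemma Cinf_on_linear: "bounded_linear f \<Longrightarrow> open S \<Longrightarrow> Cinf_on S f"
  using Ck_on_linear unfolding Cinf_on_def by blast

lemma Cinf_on_add: "open S \<Longrightarrow> Cinf_on S f \<Longrightarrow> Cinf_on S g \<Longrightarrow> Cinf_on S (\<lambda>x. f x + g x)"
  using Ck_on_add unfolding Cinf_on_def by blast

lemma Cinf_on_bilinear:
  "bounded_bilinear p \<Longrightarrow> open S \<Longrightarrow> Cinf_on S f \<Longrightarrow> Cinf_on S g \<Longrightarrow> Cinf_on S (\<lambda>x. p (f x) (g x))"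
  using Ck_on_bilinear unfolding Cinf_on_def by blast

lemma Cinf_on_Pair: "open S \<Longrightarrow> Cinf_on S f \<Longrightarrow> Cinf_on S g \<Longrightarrow> Cinf_on S (\<lambda>x. (f x, g x))"
  using Ck_on_Pair unfolding Cinf_on_def by blast

lemma Cinf_on_compose:
  fixes f :: "'a::real_normed_vector \<Rightarrow> 'b::finite_dim_normed"
  shows "open S \<Longrightarrow> open T \<Longrightarrow> f ` S \<subseteq> T \<Longrightarrow> Cinf_on S f \<Longrightarrow> Cinf_on T g \<Longrightarrow> Cinf_on S (\<lambda>x. g (f x))"
  using Ck_on_compose unfolding Cinf_on_def by metis

lemma Cinf_on_real_polynomial_function:
  fixes p :: "'a::real_normed_vector \<Rightarrow> real"
  assumes "real_polynomial_function p" "open S"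
  shows "Cinf_on S p"
  using assms(1)
  by induction
    (auto intro: Cinf_on_linear Cinf_on_const Cinf_on_add Cinf_on_bilinear[OF bounded_bilinear_mult] assms(2))

text \<open>Schwarz's theorem by Leibniz' rule: the increment of \<open>f\<close> along \<open>v\<close> is the integral of the
  derivative along \<open>v\<close>; differentiate it along \<open>w\<close>, then with respect to the upper limit.\<close>

lemma second_derivative_symmetric:
  fixes f :: "'a::real_normed_vector \<Rightarrow> real"
  assumes f: "Cinf_on S f" and S: "open S" "x \<in> S"
  shows "frechet_derivative (\<lambda>y. frechet_derivative f (at y) v) (at x) w =
    frechet_derivative (\<lambda>y. frechet_derivative f (at y) w) (at x) v"
proof -
  let ?D = "\<lambda>v y. frechet_derivative f (at y) v"
  let ?h = "\<lambda>(t, r). x + t *\<^sub>R w + r *\<^sub>R v"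
  let ?DD = "\<lambda>y. frechet_derivative (?D v) (at y) w"
  have cont: "continuous_on UNIV (?h :: real \<times> real \<Rightarrow> 'a)"
    by (auto simp: split_beta intro!: continuous_intros)
  have "open (?h -` S)" "(0, 0) \<in> ?h -` S"
    using open_vimage[OF S(1) cont] S(2) by auto
  then obtain e where e: "e > 0" "ball (0, 0) e \<subseteq> ?h -` S"
    using open_contains_ball by blast
  \<comment> \<open>The norm of \<open>(t, r)\<close> is at most
    \<open>\<bar>t\<bar> + \<bar>r\<bar>\<close>, so halving the radius lets both parameters vary
    independently.\<close>
  define d where "d = e / 2"
  have d: "d > 0" using e by (simp add: d_def)
  have inS: "x + t *\<^sub>R w + r *\<^sub>R v \<in> S" if "\<bar>t\<bar> < d" "\<bar>r\<bar> < d" for t r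
  proof -
    have "norm (t, r) \<le> \<bar>t\<bar> + \<bar>r\<bar>" using norm_Pair_le[of t r] by simp
    then have "(t, r) \<in> ball (0, 0) e" using that by (simp add: d_def dist_norm norm_Pair real_norm_def)
    then show ?thesis using e(2) by auto
  qed
  have DDc: "continuous_on S ?DD" and Dc: "continuous_on S (?D u)" for u
    by (auto intro!: Cinf_on_imp_continuous_on Cinf_on_frechet_derivative f)
  define s where "s = d / 2"
  have s: "0 < s" "s < d" using d by (auto simp: s_def)
  have curve: "((\<lambda>t. x + t *\<^sub>R w + r *\<^sub>R v) has_vector_derivative w) (at t within U)"
    "((\<lambda>t. x + r *\<^sub>R w + t *\<^sub>R v) has_vector_derivative v) (at t within U)" for r t U
    by (auto intro!: derivative_eq_intros)
  have incr: "((\<lambda>r. ?D v (x + t *\<^sub>R w + r *\<^sub>R v)) has_integral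
      f (x + t *\<^sub>R w + u *\<^sub>R v) - f (x + t *\<^sub>R w)) {0..u}" if "\<bar>t\<bar> < d" "0 \<le> u" "u < d" for t u
  proof -
    have "((\<lambda>r. f (x + t *\<^sub>R w + r *\<^sub>R v)) has_vector_derivative ?D v (x + t *\<^sub>R w + r *\<^sub>R v))
        (at r within {0..u})" if "r \<in> {0..u}" for r
      by (rule has_vector_derivative_chain[OF curve(2)], rule Cinf_on_has_derivative[OF f], rule inS)
        (use that \<open>\<bar>t\<bar> < d\<close> \<open>u < d\<close> in auto)
    from fundamental_theorem_of_calculus[OF that(2) this] show ?thesis by simp
  qed
  \<comment> \<open>Both sides are derivatives at \<open>t = 0\<close> of the increment from
    \<open>x + t *\<^sub>R w\<close> along \<open>u *\<^sub>R v\<close>: once as a difference of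
    values of \<open>f\<close>, once as an integral differentiated under the integral sign.\<close>
  have key: "?D w (x + u *\<^sub>R v) - ?D w x = integral {0..u} (\<lambda>r. ?DD (x + r *\<^sub>R v))"
    if u: "0 \<le> u" "u < d" for u
  proof -
    have "((\<lambda>t. integral (cbox 0 u) (\<lambda>r. ?D v (x + t *\<^sub>R w + r *\<^sub>R v))) has_field_derivative
        integral (cbox 0 u) (\<lambda>r. ?DD (x + 0 *\<^sub>R w + r *\<^sub>R v))) (at 0 within {-d<..<d})"
    proof (rule leibniz_rule_field_derivative)
      fix t r assume tr: "t \<in> {-d<..<d}" "r \<in> cbox 0 u"
      have "(?D v has_derivative frechet_derivative (?D v) (at (x + t *\<^sub>R w + r *\<^sub>R v)))
         (at (x + t *\<^sub>R w + r *\<^sub>R v))"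
        by (rule Cinf_on_has_derivative[OF Cinf_on_frechet_derivative[OF f]], rule inS)
          (use tr u in auto)
      from has_vector_derivative_chain[OF curve(1) this]
      show "((\<lambda>t. ?D v (x + t *\<^sub>R w + r *\<^sub>R v)) has_real_derivative ?DD (x + t *\<^sub>R w + r *\<^sub>R v))
          (at t within {-d<..<d})"
        by (simp add: has_real_derivative_iff_has_vector_derivative)
    next
      fix t assume "t \<in> {-d<..<d}"
      then show "(\<lambda>r. ?D v (x + t *\<^sub>R w + r *\<^sub>R v)) integrable_on cbox 0 u"
        using has_integral_integrable[OF incr[of t u]] u by auto
    next
      have "continuous_on ({-d<..<d} \<times> cbox 0 u) (\<lambda>z. ?DD (x + fst z *\<^sub>R w + snd z *\<^sub>R v))"
        by (rule continuous_on_compose2[OF DDc]) (use u in \<open>auto intro!: continuous_intros inS\<close>)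
      then show "continuous_on ({-d<..<d} \<times> cbox 0 u) (\<lambda>(t, r). ?DD (x + t *\<^sub>R w + r *\<^sub>R v))"
        by (simp add: split_beta)
    qed (use d in auto)
    then have 1: "((\<lambda>t. integral {0..u} (\<lambda>r. ?D v (x + t *\<^sub>R w + r *\<^sub>R v))) has_real_derivative
        integral {0..u} (\<lambda>r. ?DD (x + r *\<^sub>R v))) (at 0)"
      using d by (simp add: at_within_open[of 0 "{-d<..<d}"])
    have in': "x + u *\<^sub>R v \<in> S" using inS[of 0 u] u d by simp
    have 2: "((\<lambda>t. f (x + t *\<^sub>R w + u *\<^sub>R v) - f (x + t *\<^sub>R w + 0 *\<^sub>R v)) has_vector_derivative
        ?D w (x + 0 *\<^sub>R w + u *\<^sub>R v) - ?D w (x + 0 *\<^sub>R w + 0 *\<^sub>R v)) (at 0)"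
      by (intro has_vector_derivative_diff has_vector_derivative_chain[OF curve(1)]
          Cinf_on_has_derivative[OF f]) (use in' S in auto)
    have "f (x + t *\<^sub>R w + u *\<^sub>R v) - f (x + t *\<^sub>R w + 0 *\<^sub>R v) =
        integral {0..u} (\<lambda>r. ?D v (x + t *\<^sub>R w + r *\<^sub>R v))" if "t \<in> {-d<..<d}" for t
      using integral_unique[OF incr[of t u]] u that by auto
    from has_vector_derivative_transform_within_open[OF 2 _ _ this, of "{-d<..<d}"]
    have "((\<lambda>t. integral {0..u} (\<lambda>r. ?D v (x + t *\<^sub>R w + r *\<^sub>R v))) has_vector_derivative
        ?D w (x + u *\<^sub>R v) - ?D w x) (at 0)"
      using d by simp
    from vector_derivative_unique_at[OF this 1[unfolded has_real_derivative_iff_has_vector_derivative]]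
    show ?thesis .
  qed
  have c0: "continuous_on {0..s} (\<lambda>r. ?DD (x + r *\<^sub>R v))"
    by (rule continuous_on_compose2[OF DDc])
      (use s inS[of 0] d in \<open>auto intro!: continuous_intros\<close>)
  \<comment> \<open>Since \<open>key\<close> covers only \<open>0 \<le> u\<close>, the derivative in
    the upper limit is taken at 0 from the right, within \<open>{0..s}\<close>. \<open>A\<close>
    gives one order of differentiation and \<open>B\<close> the other.\<close>
  have A: "((\<lambda>u. integral {0..u} (\<lambda>r. ?DD (x + r *\<^sub>R v))) has_vector_derivative ?DD (x + 0 *\<^sub>R v))
      (at 0 within {0..s})"
    by (rule integral_has_vector_derivative[OF c0]) (use s in auto)
  have B0: "((\<lambda>u. ?D w (x + u *\<^sub>R v)) has_vector_derivative frechet_derivative (?D w) (at x) v)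
      (at 0 within {0..s})"
  proof -
    have "((\<lambda>t. x + t *\<^sub>R v) has_vector_derivative v) (at 0 within {0..s})"
      by (auto intro!: derivative_eq_intros)
    from has_vector_derivative_chain[OF this, of "?D w"
        "frechet_derivative (?D w) (at x)"]
    show ?thesis using Cinf_on_has_derivative[OF Cinf_on_frechet_derivative[OF f] S(2)] by simp
  qed
  have B: "((\<lambda>u. integral {0..u} (\<lambda>r. ?DD (x + r *\<^sub>R v))) has_vector_derivative
      frechet_derivative (?D w) (at x) v) (at 0 within {0..s})"
    by (rule has_vector_derivative_transform[OF _ _
          has_vector_derivative_diff[OF B0 has_vector_derivative_const[of "?D w x"], simplified]])
      (use s key in auto)
  show ?thesis
    using vector_derivative_unique_within[OF _ A B] s trivial_limit_within
    by (simp add: at_within_Icc_at_right)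
qed

section \<open>Smooth maps between manifolds\<close>

lemma smooth_atlas_chart:
  assumes "smooth_atlas A" "(U, \<phi>) \<in> A"
  shows "open U" "open (\<phi> ` U)" "continuous_on U \<phi>" "continuous_on (\<phi> ` U) (inv_into U \<phi>)"
    and "x \<in> U \<Longrightarrow> inv_into U \<phi> (\<phi> x) = x" "inj_on \<phi> U"
    and "open N \<Longrightarrow> N \<subseteq> U \<Longrightarrow> open (\<phi> ` N)"
proof -
  have h: "open U" "open (\<phi> ` U)" "homeomorphism U (\<phi> ` U) \<phi> (inv_into U \<phi>)"
    using assms by (auto simp: smooth_atlas_def)
  then show *: "open U" "open (\<phi> ` U)" "continuous_on U \<phi>" "continuous_on (\<phi> ` U) (inv_into U \<phi>)"
    by (auto simp: homeomorphism_def)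
  show i: "inj_on \<phi> U"
    by (rule inj_on_inverseI[of _ "inv_into U \<phi>"]) (rule homeomorphism_apply1[OF h(3)])
  then show "x \<in> U \<Longrightarrow> inv_into U \<phi> (\<phi> x) = x" by simp
  show "open (\<phi> ` N)" if "open N" "N \<subseteq> U"
  proof -
    have "\<phi> ` N = \<phi> ` U \<inter> inv_into U \<phi> -` N"
      using that(2) inv_into_f_f[OF i] by (auto simp: subset_iff)
    then show ?thesis using continuous_open_preimage[OF *(4,2) that(1)] by simp
  qed
qed

lemma smooth_atlas_transition:
  "smooth_atlas A \<Longrightarrow> (U, \<phi>) \<in> A \<Longrightarrow> (V, \<psi>) \<in> A \<Longrightarrow> Cinf_on (\<phi> ` (U \<inter> V)) (\<lambda>x. \<psi> (inv_into U \<phi> x))"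
  unfolding smooth_atlas_def by (fastforce simp: o_def)

lemma smooth_atlas_cover:
  assumes "smooth_atlas A"
  obtains U \<phi> where "(U, \<phi>) \<in> A" "p \<in> U"
proof -
  have "p \<in> \<Union> (fst ` A)" using assms by (simp add: smooth_atlas_def)
  then show thesis using that by (metis (no_types, lifting) UN_E prod.collapse)
qed

lemma smooth_atlas_vec [simp]: "smooth_atlas (vec_atlas :: ('v::real_normed_vector, 'v) chart set)"
  using Cinf_on_linear[OF bounded_linear_ident open_UNIV]
  by (auto simp: smooth_atlas_def vec_atlas_def homeomorphism_def id_def o_def)

lemma smooth_on_open_vec_iff:
  "smooth_on_open vec_atlas vec_atlas W f \<longleftrightarrow> open W \<and> Cinf_on W f"
  by (auto simp: smooth_on_open_def vec_atlas_def Cinf_on_imp_continuous_on)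

lemma prod_atlas_vec [simp]: "prod_atlas vec_atlas vec_atlas = vec_atlas"
  by (auto simp: prod_atlas_def vec_atlas_def map_prod.id)

lemma smooth_on_openD:
  assumes "smooth_on_open A B W f"
  shows "open W" "continuous_on W f"
    and "(U, \<phi>) \<in> A \<Longrightarrow> (V, \<psi>) \<in> B \<Longrightarrow> Cinf_on (\<phi> ` (W \<inter> U \<inter> f -` V)) (\<lambda>x. \<psi> (f (inv_into U \<phi> x)))"
  using assms unfolding smooth_on_open_def by (fastforce simp: o_def)+

lemma smooth_on_openI:
  assumes "open W" "continuous_on W f"
    and "\<And>U \<phi> V \<psi>. (U, \<phi>) \<in> A \<Longrightarrow> (V, \<psi>) \<in> B \<Longrightarrow>
      Cinf_on (\<phi> ` (W \<inter> U \<inter> f -` V)) (\<lambda>x. \<psi> (f (inv_into U \<phi> x)))"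
  shows "smooth_on_open A B W f"
  using assms unfolding smooth_on_open_def by (auto simp: o_def)

text \<open>Local representatives are tested on these sets. Their openness is what permits replacing
  a representative by one that agrees with it there.\<close>

lemma open_chart_domain:
  assumes "smooth_atlas A" "smooth_atlas B" "(U, \<phi>) \<in> A" "(V, \<psi>) \<in> B" "open W" "continuous_on W f"
  shows "open (W \<inter> U \<inter> f -` V)" "open (\<phi> ` (W \<inter> U \<inter> f -` V))"
proof -
  have "open (W \<inter> f -` V)"
    by (rule continuous_open_preimage[OF assms(6,5) smooth_atlas_chart(1)[OF assms(2,4)]])
  then have "open (U \<inter> (W \<inter> f -` V))"
    using smooth_atlas_chart(1)[OF assms(1,3)] by blast
  then show *: "open (W \<inter> U \<inter> f -` V)" by (simp add: Int_ac)
  then show "open (\<phi> ` (W \<inter> U \<inter> f -` V))"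
    by (rule smooth_atlas_chart(7)[OF assms(1,3)]) auto
qed

lemma smooth_on_open_subset:
  "smooth_on_open A B W f \<Longrightarrow> open W' \<Longrightarrow> W' \<subseteq> W \<Longrightarrow> smooth_on_open A B W' f"
  by (auto intro!: smooth_on_openI elim: Cinf_on_subset[rotated] continuous_on_subset
      dest: smooth_on_openD intro: Cinf_on_subset[OF smooth_on_openD(3)])

lemma smooth_on_open_cong:
  assumes A: "smooth_atlas A" "smooth_atlas B"
    and f: "smooth_on_open A B W f" "\<And>x. x \<in> W \<Longrightarrow> f x = g x"
  shows "smooth_on_open A B W g"
proof (rule smooth_on_openI)
  show "open W" "continuous_on W g"
    using smooth_on_openD(1,2)[OF f(1)] f(2) by (auto cong: continuous_on_cong)
  fix U \<phi> V \<psi> assume c: "(U, \<phi>) \<in> A" "(V, \<psi>) \<in> B"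
  have e: "W \<inter> U \<inter> g -` V = W \<inter> U \<inter> f -` V" using f(2) by auto
  show "Cinf_on (\<phi> ` (W \<inter> U \<inter> g -` V)) (\<lambda>x. \<psi> (g (inv_into U \<phi> x)))"
    unfolding e
    by (rule Cinf_on_cong[OF open_chart_domain(2)[OF A c smooth_on_openD(1,2)[OF f(1)]]
          _ smooth_on_openD(3)[OF f(1) c]])
      (auto simp: f(2) smooth_atlas_chart(5)[OF A(1) c(1)])
qed

lemma smooth_on_open_local:
  assumes A: "smooth_atlas A" "smooth_atlas B" and "open W"
    and "\<And>p. p \<in> W \<Longrightarrow> \<exists>N. p \<in> N \<and> smooth_on_open A B N f"
  shows "smooth_on_open A B W f"
proof (rule smooth_on_openI)
  show "continuous_on W f"
  proof -
    have "continuous_on (\<Union> {N. smooth_on_open A B N f}) f"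
      by (rule continuous_on_open_Union) (auto dest: smooth_on_openD)
    then show ?thesis
      by (rule continuous_on_subset) (use assms(4) in blast)
  qed
  fix U \<phi> V \<psi> assume c: "(U, \<phi>) \<in> A" "(V, \<psi>) \<in> B"
  show "Cinf_on (\<phi> ` (W \<inter> U \<inter> f -` V)) (\<lambda>x. \<psi> (f (inv_into U \<phi> x)))"
  proof (rule Cinf_on_local)
    fix x assume "x \<in> \<phi> ` (W \<inter> U \<inter> f -` V)"
    then obtain p where p: "x = \<phi> p" "p \<in> W" "p \<in> U" "f p \<in> V" by auto
    then obtain N where N: "p \<in> N" "smooth_on_open A B N f" using assms(4) by blast
    show "\<exists>T. open T \<and> x \<in> T \<and> Cinf_on T (\<lambda>x. \<psi> (f (inv_into U \<phi> x)))"
      using open_chart_domain(2)[OF A c smooth_on_openD(1,2)[OF N(2)]] p N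
        smooth_on_openD(3)[OF N(2) c]
      by (intro exI[of _ "\<phi> ` (N \<inter> U \<inter> f -` V)"]) auto
  qed
qed (rule assms(3))

text \<open>Near a point \<open>p\<close>, the representative of the composite factors through a
  chart \<open>\<psi>\<close> of the middle manifold around \<open>f p\<close>. The domain is shrunk
  to \<open>N\<close> so that \<open>f\<close> stays where both factors are defined, and smoothness
  is then local.\<close>

lemma smooth_on_open_compose:
  fixes B :: "('n::topological_space, 'f::finite_dim_normed) chart set"
  assumes A: "smooth_atlas A" "smooth_atlas B" "smooth_atlas C"
    and f: "smooth_on_open A B W f" and g: "smooth_on_open B C W' g" and sub: "f ` W \<subseteq> W'"
  shows "smooth_on_open A C W (\<lambda>x. g (f x))"
proof (rule smooth_on_openI)
  show W: "open W" using f by (rule smooth_on_openD)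
  show "continuous_on W (\<lambda>x. g (f x))"
    using continuous_on_compose2[OF smooth_on_openD(2)[OF g] smooth_on_openD(2)[OF f] sub] .
  fix U \<phi> X \<kappa> assume c: "(U, \<phi>) \<in> A" "(X, \<kappa>) \<in> C"
  show "Cinf_on (\<phi> ` (W \<inter> U \<inter> (\<lambda>x. g (f x)) -` X)) (\<lambda>x. \<kappa> (g (f (inv_into U \<phi> x))))"
  proof (rule Cinf_on_local)
    fix x assume "x \<in> \<phi> ` (W \<inter> U \<inter> (\<lambda>x. g (f x)) -` X)"
    then obtain p where p: "x = \<phi> p" "p \<in> W" "p \<in> U" "g (f p) \<in> X" by auto
    obtain V \<psi> where V: "(V, \<psi>) \<in> B" "f p \<in> V" using smooth_atlas_cover[OF A(2)] by metis
    define M where "M = W' \<inter> V \<inter> g -` X"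
    have M: "open M" "open (\<psi> ` M)"
      unfolding M_def using open_chart_domain[OF A(2,3) V(1) c(2) smooth_on_openD(1,2)[OF g]] by auto
    define N where "N = W \<inter> f -` M \<inter> U"
    have N: "open N"
      unfolding N_def
      using continuous_open_preimage[OF smooth_on_openD(2)[OF f] W M(1)] smooth_atlas_chart(1)[OF A(1) c(1)]
      by blast
    then have oN: "open (\<phi> ` N)"
      by (rule smooth_atlas_chart(7)[OF A(1) c(1)]) (auto simp: N_def)
    have 1: "Cinf_on (\<phi> ` N) (\<lambda>x. \<psi> (f (inv_into U \<phi> x)))"
      by (rule Cinf_on_subset[OF smooth_on_openD(3)[OF f c(1) V(1)]]) (auto simp: N_def M_def)
    have 2: "Cinf_on (\<psi> ` M) (\<lambda>x. \<kappa> (g (inv_into V \<psi> x)))"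
      unfolding M_def by (rule smooth_on_openD(3)[OF g V(1) c(2)])
    have "Cinf_on (\<phi> ` N) (\<lambda>x. \<kappa> (g (inv_into V \<psi> (\<psi> (f (inv_into U \<phi> x))))))"
      by (rule Cinf_on_compose[OF oN M(2) _ 1 2])
        (auto simp: N_def smooth_atlas_chart(5)[OF A(1) c(1)])
    then have "Cinf_on (\<phi> ` N) (\<lambda>x. \<kappa> (g (f (inv_into U \<phi> x))))"
      by (rule Cinf_on_cong[OF oN, rotated])
        (auto simp: N_def M_def smooth_atlas_chart(5)[OF A(1) c(1)] smooth_atlas_chart(5)[OF A(2) V(1)])
    moreover have "x \<in> \<phi> ` N" using p V sub by (auto simp: N_def M_def)
    ultimately show "\<exists>T. open T \<and> x \<in> T \<and> Cinf_on T (\<lambda>x. \<kappa> (g (f (inv_into U \<phi> x))))"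
      using oN by blast
  qed
qed

section \<open>Product manifolds\<close>

lemma prod_atlasE:
  assumes "(X, \<kappa>) \<in> prod_atlas A B"
  obtains U \<phi> V \<psi> where "X = U \<times> V" "\<kappa> = map_prod \<phi> \<psi>" "(U, \<phi>) \<in> A" "(V, \<psi>) \<in> B"
  using assms unfolding prod_atlas_def by blast

lemma prod_atlasI: "(U, \<phi>) \<in> A \<Longrightarrow> (V, \<psi>) \<in> B \<Longrightarrow> (U \<times> V, map_prod \<phi> \<psi>) \<in> prod_atlas A B"
  unfolding prod_atlas_def by blast

text \<open>\<open>inv_into\<close> splits only for values in the image of the product chart;
  elsewhere it is an arbitrary choice. Later rewritings of representatives are therefore made on
  chart images alone.\<close>

lemma inv_into_map_prod:
  assumes "smooth_atlas A" "smooth_atlas B" "(U, \<phi>) \<in> A" "(V, \<psi>) \<in> B" "x \<in> \<phi> ` U" "y \<in> \<psi> ` V"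
  shows "inv_into (U \<times> V) (map_prod \<phi> \<psi>) (x, y) = (inv_into U \<phi> x, inv_into V \<psi> y)"
proof (rule inv_into_f_eq)
  show "inj_on (map_prod \<phi> \<psi>) (U \<times> V)"
    using smooth_atlas_chart(6)[OF assms(1,3)] smooth_atlas_chart(6)[OF assms(2,4)]
    by (rule map_prod_inj_on)
qed (use assms in \<open>auto simp: inv_into_into f_inv_into_f\<close>)

lemma smooth_atlas_prod [simp]:
  fixes A :: "('m::topological_space, 'e::finite_dim_normed) chart set"
    and B :: "('n::topological_space, 'f::finite_dim_normed) chart set"
  assumes A: "smooth_atlas A" and B: "smooth_atlas B"
  shows "smooth_atlas (prod_atlas A B)"
  unfolding smooth_atlas_def
proof (intro conjI)
  show "\<Union> (fst ` prod_atlas A B) = UNIV"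
  proof (intro equalityI subsetI UNIV_I)
    fix z :: "'m \<times> 'n"
    obtain U \<phi> where "(U, \<phi>) \<in> A" "fst z \<in> U" by (rule smooth_atlas_cover[OF A])
    moreover obtain V \<psi> where "(V, \<psi>) \<in> B" "snd z \<in> V" by (rule smooth_atlas_cover[OF B])
    ultimately show "z \<in> \<Union> (fst ` prod_atlas A B)"
      by (intro UN_I[OF prod_atlasI]) (auto simp: mem_Times_iff)
  qed
  have im: "map_prod \<phi> \<psi> ` (U \<times> V) = \<phi> ` U \<times> \<psi> ` V" for \<phi> :: "'m \<Rightarrow> 'e" and \<psi> :: "'n \<Rightarrow> 'f" and U V
    by (rule map_prod_surj_on) auto
  {
    fix U \<phi> V \<psi> assume c: "(U, \<phi>) \<in> A" "(V, \<psi>) \<in> B"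
    note cA = smooth_atlas_chart[OF A c(1)] and cB = smooth_atlas_chart[OF B c(2)]
    have "homeomorphism (U \<times> V) (map_prod \<phi> \<psi> ` (U \<times> V)) (map_prod \<phi> \<psi>) (inv_into (U \<times> V) (map_prod \<phi> \<psi>))"
    proof (rule homeomorphismI)
      show "continuous_on (U \<times> V) (map_prod \<phi> \<psi>)"
        unfolding map_prod_def split_beta
        by (intro continuous_on_Pair continuous_on_compose2[OF cA(3)] continuous_on_compose2[OF cB(3)]
            continuous_on_fst continuous_on_snd continuous_on_id) auto
      have "continuous_on (\<phi> ` U \<times> \<psi> ` V) (\<lambda>z. (inv_into U \<phi> (fst z), inv_into V \<psi> (snd z)))"
        by (intro continuous_on_Pair continuous_on_compose2[OF cA(4)] continuous_on_compose2[OF cB(4)]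
            continuous_on_fst continuous_on_snd continuous_on_id) auto
      then show "continuous_on (map_prod \<phi> \<psi> ` (U \<times> V)) (inv_into (U \<times> V) (map_prod \<phi> \<psi>))"
        unfolding im
        by (rule continuous_on_eq) (auto simp: inv_into_map_prod[OF A B c])
    qed (auto simp: inv_into_map_prod[OF A B c] cA(5) cB(5))
    then have "open (U \<times> V) \<and> open (map_prod \<phi> \<psi> ` (U \<times> V)) \<and>
        homeomorphism (U \<times> V) (map_prod \<phi> \<psi> ` (U \<times> V)) (map_prod \<phi> \<psi>) (inv_into (U \<times> V) (map_prod \<phi> \<psi>))"
      using cA(1,2) cB(1,2) by (simp add: im open_Times)
  }
  then show "\<forall>(U, \<phi>)\<in>prod_atlas A B. open U \<and> open (\<phi> ` U) \<and> homeomorphism U (\<phi> ` U) \<phi> (inv_into U \<phi>)"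
    by (auto elim!: prod_atlasE)
  {
    fix U \<phi> V \<psi> U' \<phi>' V' \<psi>'
    assume c: "(U, \<phi>) \<in> A" "(V, \<psi>) \<in> B" and c': "(U', \<phi>') \<in> A" "(V', \<psi>') \<in> B"
    let ?X = "\<phi> ` (U \<inter> U')" and ?Y = "\<psi> ` (V \<inter> V')"
    have o: "open ?X" "open ?Y"
      using smooth_atlas_chart(1,7)[OF A] smooth_atlas_chart(1,7)[OF B] c c' by (meson open_Int inf_le1)+
    have im': "map_prod \<phi> \<psi> ` (U \<times> V \<inter> U' \<times> V') = ?X \<times> ?Y"
      by (simp add: Times_Int_Times im)
    have 1: "Cinf_on (?X \<times> ?Y) (\<lambda>z. (\<phi>' (inv_into U \<phi> (fst z)), \<psi>' (inv_into V \<psi> (snd z))))"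
      by (intro Cinf_on_Pair Cinf_on_compose[OF _ o(1) _ _ smooth_atlas_transition[OF A c(1) c'(1)]]
          Cinf_on_compose[OF _ o(2) _ _ smooth_atlas_transition[OF B c(2) c'(2)]]
          open_Times o Cinf_on_linear bounded_linear_fst bounded_linear_snd) auto
    have "Cinf_on (map_prod \<phi> \<psi> ` (U \<times> V \<inter> U' \<times> V'))
        (map_prod \<phi>' \<psi>' \<circ> inv_into (U \<times> V) (map_prod \<phi> \<psi>))"
      unfolding im'
      by (rule Cinf_on_cong[OF open_Times[OF o] _ 1]) (auto simp: inv_into_map_prod[OF A B c])
  }
  then show "\<forall>(U, \<phi>)\<in>prod_atlas A B. \<forall>(V, \<psi>)\<in>prod_atlas A B.
      Cinf_on (\<phi> ` (U \<inter> V)) (\<psi> \<circ> inv_into U \<phi>)"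
    by (auto elim!: prod_atlasE)
qed

lemma smooth_on_open_Pair:
  fixes A :: "('m::topological_space, 'e::finite_dim_normed) chart set"
    and B :: "('n::topological_space, 'f::finite_dim_normed) chart set"
    and C :: "('o::topological_space, 'h::finite_dim_normed) chart set"
  assumes A: "smooth_atlas A" "smooth_atlas B" "smooth_atlas C"
    and f: "smooth_on_open A B W f" and g: "smooth_on_open A C W g"
  shows "smooth_on_open A (prod_atlas B C) W (\<lambda>x. (f x, g x))"
proof (rule smooth_on_openI)
  show W: "open W" using f by (rule smooth_on_openD)
  show cont: "continuous_on W (\<lambda>x. (f x, g x))"
    using f g by (intro continuous_on_Pair smooth_on_openD)
  fix U \<phi> X \<kappa> assume c: "(U, \<phi>) \<in> A" "(X, \<kappa>) \<in> prod_atlas B C"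
  obtain V \<psi> V' \<psi>' where X: "X = V \<times> V'" "\<kappa> = map_prod \<psi> \<psi>'" "(V, \<psi>) \<in> B" "(V', \<psi>') \<in> C"
    by (rule prod_atlasE[OF c(2)])
  have o: "open (\<phi> ` (W \<inter> U \<inter> (\<lambda>x. (f x, g x)) -` X))"
    by (rule open_chart_domain(2)[OF A(1) smooth_atlas_prod[OF A(2,3)] c W cont])
  show "Cinf_on (\<phi> ` (W \<inter> U \<inter> (\<lambda>x. (f x, g x)) -` X)) (\<lambda>x. \<kappa> (f (inv_into U \<phi> x), g (inv_into U \<phi> x)))"
    unfolding X(2) map_prod_simp
    by (intro Cinf_on_Pair o Cinf_on_subset[OF smooth_on_openD(3)[OF f c(1) X(3)]]
        Cinf_on_subset[OF smooth_on_openD(3)[OF g c(1) X(4)]]) (auto simp: X)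
qed

lemma smooth_on_open_fst:
  fixes A :: "('m::topological_space, 'e::finite_dim_normed) chart set"
    and B :: "('n::topological_space, 'f::finite_dim_normed) chart set"
  assumes A: "smooth_atlas A" "smooth_atlas B" and W: "open W"
  shows "smooth_on_open (prod_atlas A B) A W fst"
proof (rule smooth_on_openI)
  show cont: "continuous_on W fst" by (intro continuous_intros)
  fix X \<kappa> U' \<phi>' assume c: "(X, \<kappa>) \<in> prod_atlas A B" "(U', \<phi>') \<in> A"
  obtain U \<phi> V \<psi> where X: "X = U \<times> V" "\<kappa> = map_prod \<phi> \<psi>" "(U, \<phi>) \<in> A" "(V, \<psi>) \<in> B"
    by (rule prod_atlasE[OF c(1)])
  have o: "open (\<kappa> ` (W \<inter> X \<inter> fst -` U'))"
    by (rule open_chart_domain(2)[OF smooth_atlas_prod[OF A] A(1) c W cont])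
  have o': "open (\<phi> ` (U \<inter> U'))"
    using smooth_atlas_chart(1,7)[OF A(1)] c(2) X(3) by (meson open_Int inf_le1)
  have "Cinf_on (\<kappa> ` (W \<inter> X \<inter> fst -` U')) (\<lambda>z. \<phi>' (inv_into U \<phi> (fst z)))"
    by (rule Cinf_on_compose[OF o o' _ _ smooth_atlas_transition[OF A(1) X(3) c(2)]])
      (auto simp: X intro!: Cinf_on_linear bounded_linear_fst o[unfolded X])
  then show "Cinf_on (\<kappa> ` (W \<inter> X \<inter> fst -` U')) (\<lambda>x. \<phi>' (fst (inv_into X \<kappa> x)))"
    by (rule Cinf_on_cong[OF o, rotated]) (auto simp: X inv_into_map_prod[OF A X(3,4)])
qed (rule W)

lemma smooth_on_open_snd:
  fixes A :: "('m::topological_space, 'e::finite_dim_normed) chart set"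
    and B :: "('n::topological_space, 'f::finite_dim_normed) chart set"
  assumes A: "smooth_atlas A" "smooth_atlas B" and W: "open W"
  shows "smooth_on_open (prod_atlas A B) B W snd"
proof (rule smooth_on_openI)
  show cont: "continuous_on W snd" by (intro continuous_intros)
  fix X \<kappa> V' \<psi>' assume c: "(X, \<kappa>) \<in> prod_atlas A B" "(V', \<psi>') \<in> B"
  obtain U \<phi> V \<psi> where X: "X = U \<times> V" "\<kappa> = map_prod \<phi> \<psi>" "(U, \<phi>) \<in> A" "(V, \<psi>) \<in> B"
    by (rule prod_atlasE[OF c(1)])
  have o: "open (\<kappa> ` (W \<inter> X \<inter> snd -` V'))"
    by (rule open_chart_domain(2)[OF smooth_atlas_prod[OF A] A(2) c W cont])
  have o': "open (\<psi> ` (V \<inter> V'))"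
    using smooth_atlas_chart(1,7)[OF A(2)] c(2) X(4) by (meson open_Int inf_le1)
  have "Cinf_on (\<kappa> ` (W \<inter> X \<inter> snd -` V')) (\<lambda>z. \<psi>' (inv_into V \<psi> (snd z)))"
    by (rule Cinf_on_compose[OF o o' _ _ smooth_atlas_transition[OF A(2) X(4) c(2)]])
      (auto simp: X intro!: Cinf_on_linear bounded_linear_snd o[unfolded X])
  then show "Cinf_on (\<kappa> ` (W \<inter> X \<inter> snd -` V')) (\<lambda>x. \<psi>' (snd (inv_into X \<kappa> x)))"
    by (rule Cinf_on_cong[OF o, rotated]) (auto simp: X inv_into_map_prod[OF A X(3,4)])
qed (rule W)

lemma smooth_on_open_chart:
  assumes "smooth_atlas A" "(U, \<phi>) \<in> A"
  shows "smooth_on_open A vec_atlas U \<phi>"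
  using smooth_atlas_chart[OF assms] assms
  by (intro smooth_on_openI)
    (auto simp: vec_atlas_def Int_commute intro: smooth_atlas_transition)

lemma smooth_on_open_inv_chart:
  fixes A :: "('m::topological_space, 'e::real_normed_vector) chart set"
  assumes "smooth_atlas A" "(U, \<phi>) \<in> A"
  shows "smooth_on_open vec_atlas A (\<phi> ` U) (inv_into U \<phi>)"
proof (rule smooth_on_openI)
  fix X \<kappa> U' \<phi>' assume c: "(X, \<kappa>) \<in> (vec_atlas :: ('e, 'e) chart set)" "(U', \<phi>') \<in> A"
  have "\<kappa> ` (\<phi> ` U \<inter> X \<inter> inv_into U \<phi> -` U') = \<phi> ` (U \<inter> U')"
    using c(1) smooth_atlas_chart(5)[OF assms] by (auto simp: vec_atlas_def)
  then show "Cinf_on (\<kappa> ` (\<phi> ` U \<inter> X \<inter> inv_into U \<phi> -` U')) (\<lambda>x. \<phi>' (inv_into U \<phi> (inv_into X \<kappa> x)))"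
    using smooth_atlas_transition[OF assms c(2)] c(1) by (simp add: vec_atlas_def)
qed (use smooth_atlas_chart[OF assms] in auto)

lemma smooth_on_open_const:
  assumes "smooth_atlas A" "smooth_atlas B" "open W"
  shows "smooth_on_open A B W (\<lambda>_. p)"
  by (rule smooth_on_openI) (auto intro: assms Cinf_on_const)

lemma smooth_on_open_ident:
  assumes "smooth_atlas A" "open W"
  shows "smooth_on_open A A W (\<lambda>x. x)"
  by (rule smooth_on_openI)
    (auto intro: assms Cinf_on_subset[OF smooth_atlas_transition[OF assms(1)]])

lemma smooth_map_open_iff:
  assumes "smooth_atlas A" "smooth_atlas B" "open W"
  shows "smooth_map A B W f \<longleftrightarrow> smooth_on_open A B W f"
  unfolding smooth_map_def
  using smooth_on_open_cong[OF assms(1,2)] smooth_on_open_subset assms(3) by (metis order_refl)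

lemma smooth_near_iff:
  assumes "smooth_atlas A"
  shows "smooth_near A p f \<longleftrightarrow> (\<exists>W. p \<in> W \<and> smooth_on_open A vec_atlas W f)"
  using smooth_map_open_iff[OF assms smooth_atlas_vec] smooth_on_openD(1)
  unfolding smooth_near_def by metis

section \<open>Partial derivatives in a vector factor\<close>

lemma has_derivative_right_slot:
  assumes "(f has_derivative f') (at (a, b))"
  shows "((\<lambda>y. f (a, y)) has_derivative (\<lambda>h. f' (0, h))) (at b)"
  by (rule has_derivative_compose[OF has_derivative_Pair[OF has_derivative_const has_derivative_ident] assms])

lemma smooth_on_open_section:
  fixes A :: "('m::topological_space, 'e::finite_dim_normed) chart set"
    and F :: "'m \<times> 'v::finite_dim_normed \<Rightarrow> 'w::real_normed_vector"
  assumes A: "smooth_atlas A" and F: "smooth_on_open (prod_atlas A vec_atlas) vec_atlas W F"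
  shows "smooth_on_open A vec_atlas ((\<lambda>q. (q, y)) -` W) (\<lambda>q. F (q, y))"
proof -
  have o: "open ((\<lambda>q. (q, y)) -` W)"
    by (rule open_vimage[OF smooth_on_openD(1)[OF F]]) (intro continuous_intros)
  show ?thesis
    by (rule smooth_on_open_compose[OF A _ _ smooth_on_open_Pair[OF A A smooth_atlas_vec
            smooth_on_open_ident[OF A o] smooth_on_open_const[OF A smooth_atlas_vec o]] F])
      (auto simp: A)
qed

lemma smooth_on_open_vec_section:
  fixes A :: "('m::topological_space, 'e::finite_dim_normed) chart set"
    and F :: "'m \<times> 'v::finite_dim_normed \<Rightarrow> 'w::real_normed_vector"
  assumes A: "smooth_atlas A" and F: "smooth_on_open (prod_atlas A vec_atlas) vec_atlas W F"
  shows "Cinf_on (Pair q -` W) (\<lambda>y. F (q, y))"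
proof -
  have o: "open (Pair q -` W)"
    by (rule open_vimage[OF smooth_on_openD(1)[OF F]]) (intro continuous_intros)
  have "smooth_on_open vec_atlas vec_atlas (Pair q -` W) (\<lambda>y. F (q, y))"
    by (rule smooth_on_open_compose[OF _ _ _ smooth_on_open_Pair[OF smooth_atlas_vec A smooth_atlas_vec
            smooth_on_open_const[OF smooth_atlas_vec A o] smooth_on_open_ident[OF smooth_atlas_vec o]] F])
      (auto simp: A)
  then show ?thesis by (simp add: smooth_on_open_vec_iff)
qed

lemma smooth_on_open_partial_has_derivative:
  fixes A :: "('m::topological_space, 'e::finite_dim_normed) chart set"
    and F :: "'m \<times> 'v::finite_dim_normed \<Rightarrow> 'w::real_normed_vector"
  assumes "smooth_atlas A" "smooth_on_open (prod_atlas A vec_atlas) vec_atlas W F" "(q, y) \<in> W"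
  shows "((\<lambda>y. F (q, y)) has_derivative frechet_derivative (\<lambda>y. F (q, y)) (at y)) (at y)"
  by (rule Cinf_on_has_derivative[OF smooth_on_open_vec_section[OF assms(1,2)]]) (use assms(3) in auto)

text \<open>In the chart \<open>\<phi>\<close> times the identity, the partial derivative is the
  full derivative of the local representative \<open>?G\<close> in the fixed direction
  \<open>(0, v)\<close>, hence smooth. The identity on the second factor ensures that the chart
  leaves the direction \<open>v\<close> unchanged.\<close>

lemma smooth_on_open_partial:
  fixes A :: "('m::topological_space, 'e::finite_dim_normed) chart set"
    and F :: "'m \<times> 'v::finite_dim_normed \<Rightarrow> 'w::real_normed_vector"
  assumes A: "smooth_atlas A" and F: "smooth_on_open (prod_atlas A vec_atlas) vec_atlas W F"
  shows "smooth_on_open (prod_atlas A vec_atlas) vec_atlas W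
    (\<lambda>z. frechet_derivative (\<lambda>y. F (fst z, y)) (at (snd z)) v)"
proof (rule smooth_on_open_local)
  show "open W" using F by (rule smooth_on_openD)
  fix z assume z: "z \<in> W"
  obtain U \<phi> where U: "(U, \<phi>) \<in> A" "fst z \<in> U" by (rule smooth_atlas_cover[OF A])
  note c = smooth_atlas_chart[OF A U(1)]
  let ?N = "W \<inter> (U \<times> UNIV)" and ?\<Phi> = "map_prod \<phi> id :: 'm \<times> 'v \<Rightarrow> 'e \<times> 'v"
  let ?G = "\<lambda>x. F (inv_into U \<phi> (fst x), snd x)"
  have pc: "(U \<times> UNIV, ?\<Phi>) \<in> prod_atlas A vec_atlas"
    by (rule prod_atlasI[OF U(1)]) (simp add: vec_atlas_def)
  have oN: "open ?N" using smooth_on_openD(1)[OF F] c(1) by (simp add: open_Int open_Times)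
  have oP: "open (?\<Phi> ` ?N)"
    by (rule smooth_atlas_chart(7)[OF _ pc oN]) (simp_all add: A)
  have idc: "(UNIV, id) \<in> (vec_atlas :: ('w, 'w) chart set)" by (simp add: vec_atlas_def)
  have inv: "inv_into (U \<times> UNIV) ?\<Phi> x = (inv_into U \<phi> (fst x), snd x)" if "x \<in> ?\<Phi> ` ?N" for x
    using that smooth_atlas_chart(5)[OF smooth_atlas_prod[OF A smooth_atlas_vec] pc] c(5) by fastforce
  have "Cinf_on (?\<Phi> ` ?N) (\<lambda>x. F (inv_into (U \<times> UNIV) ?\<Phi> x))"
    using smooth_on_openD(3)[OF F pc idc] by simp
  then have G: "Cinf_on (?\<Phi> ` ?N) ?G"
    by (rule Cinf_on_cong[OF oP, rotated]) (simp add: inv)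
  have \<Phi>: "smooth_on_open (prod_atlas A vec_atlas) vec_atlas ?N ?\<Phi>"
    by (rule smooth_on_open_subset[OF smooth_on_open_chart[OF smooth_atlas_prod[OF A smooth_atlas_vec] pc] oN])
      auto
  have 1: "smooth_on_open (prod_atlas A vec_atlas) vec_atlas ?N
      (\<lambda>z. frechet_derivative ?G (at (?\<Phi> z)) (0, v))"
    by (rule smooth_on_open_compose[OF _ _ _ \<Phi>, where W' = "?\<Phi> ` ?N"])
      (auto simp: A smooth_on_open_vec_iff oP intro!: Cinf_on_frechet_derivative[OF G])
  have "smooth_on_open (prod_atlas A vec_atlas) vec_atlas ?N
      (\<lambda>z. frechet_derivative (\<lambda>y. F (fst z, y)) (at (snd z)) v)"
  proof (rule smooth_on_open_cong[OF _ _ 1])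
    fix x assume x: "x \<in> ?N"
    have "((\<lambda>y. ?G (\<phi> (fst x), y)) has_derivative (\<lambda>h. frechet_derivative ?G (at (?\<Phi> x)) (0, h)))
        (at (snd x))"
      by (rule has_derivative_right_slot)
        (use Cinf_on_has_derivative[OF G imageI[OF x]] in \<open>simp add: map_prod_def split_beta\<close>)
    then have "((\<lambda>y. F (fst x, y)) has_derivative (\<lambda>h. frechet_derivative ?G (at (?\<Phi> x)) (0, h)))
        (at (snd x))"
      using x c(5)[of "fst x"] by (auto simp: mem_Times_iff)
    from fun_cong[OF frechet_derivative_at[OF this], of v]
    show "frechet_derivative ?G (at (?\<Phi> x)) (0, v) = frechet_derivative (\<lambda>y. F (fst x, y)) (at (snd x)) v" .
  qed (simp_all add: A)
  moreover have "z \<in> ?N" using z U(2) by (simp add: mem_Times_iff)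
  ultimately show "\<exists>N. z \<in> N \<and> smooth_on_open (prod_atlas A vec_atlas) vec_atlas N
      (\<lambda>z. frechet_derivative (\<lambda>y. F (fst z, y)) (at (snd z)) v)"
    by (intro exI[of _ ?N] conjI)
qed (simp_all add: A)

section \<open>Velocities and the chain rule along curves\<close>

lemma velocity_eqI:
  assumes "smooth_near A (c t) f" "((\<lambda>s. f (c s)) has_vector_derivative d) (at t)"
  shows "velocity A c t f = d"
  using assms by (auto simp: velocity_def DERIV_imp_deriv has_real_derivative_iff_has_vector_derivative)

text \<open>\<open>velocity\<close> is written with \<open>deriv\<close>, which carries information
  only when the composite is differentiable; the smoothness of \<open>c\<close> and \<open>f\<close>
  guarantees this.\<close>

lemma smooth_on_open_has_velocity:
  fixes A :: "('m::topological_space, 'e::finite_dim_normed) chart set"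
    and f :: "'m \<Rightarrow> real"
  assumes A: "smooth_atlas A" and c: "smooth_on_open vec_atlas A N c" "t \<in> N"
    and f: "smooth_on_open A vec_atlas W f" "c t \<in> W"
  shows "((\<lambda>s. f (c s)) has_vector_derivative velocity A c t f) (at t)"
proof -
  let ?M = "N \<inter> c -` W"
  have o: "open ?M"
    using continuous_open_preimage[OF smooth_on_openD(2,1)[OF c(1)] smooth_on_openD(1)[OF f(1)]] .
  have "smooth_on_open vec_atlas vec_atlas ?M (\<lambda>s. f (c s))"
    by (rule smooth_on_open_compose[OF _ A _ smooth_on_open_subset[OF c(1) o] f(1)]) auto
  then have "Cinf_on ?M (\<lambda>s. f (c s))" by (simp add: smooth_on_open_vec_iff)
  then have "((\<lambda>s. f (c s)) has_derivative frechet_derivative (\<lambda>s. f (c s)) (at t)) (at t)"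
    by (rule Cinf_on_has_derivative) (use c f in auto)
  then have "(\<lambda>s. f (c s)) differentiable (at t)" by (auto simp: differentiable_def)
  then have "((\<lambda>s. f (c s)) has_vector_derivative vector_derivative (\<lambda>s. f (c s)) (at t)) (at t)"
    by (simp add: vector_derivative_works)
  moreover from velocity_eqI[where f = f and c = c, OF _ this, of A]
  have "velocity A c t f = vector_derivative (\<lambda>s. f (c s)) (at t)"
    using f A by (auto simp: smooth_near_iff)
  ultimately show ?thesis by simp
qed

text \<open>Composing the manifold slot with \<open>c\<close> yields a smooth function
  \<open>?K\<close> of a real and a vector variable, where the ordinary chain rule applies. Its
  derivative in direction \<open>(1, y')\<close> splits along \<open>(1, 0)\<close>, the velocity
  term, and \<open>(0, y')\<close>, the partial derivative.\<close>

lemma has_vector_derivative_along_curve: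
  fixes A :: "('m::topological_space, 'e::finite_dim_normed) chart set"
    and F :: "'m \<times> 'v::finite_dim_normed \<Rightarrow> real"
  assumes A: "smooth_atlas A" and F: "smooth_on_open (prod_atlas A vec_atlas) vec_atlas W F"
    and c: "smooth_on_open vec_atlas A N c" "t \<in> N" and W: "(c t, y t) \<in> W"
    and y: "(y has_vector_derivative y') (at t)"
  shows "((\<lambda>s. F (c s, y s)) has_vector_derivative
    (velocity A c t (\<lambda>q. F (q, y t)) + frechet_derivative (\<lambda>y. F (c t, y)) (at (y t)) y')) (at t)"
proof -
  let ?K = "\<lambda>z. F (c (fst z), snd z)"
  let ?M = "(N \<times> UNIV) \<inter> (\<lambda>z. (c (fst z), snd z)) -` W"
  have oN: "open (N \<times> (UNIV :: 'v set))" using smooth_on_openD(1)[OF c(1)] by (simp add: open_Times)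
  have cf: "smooth_on_open vec_atlas A (N \<times> (UNIV :: 'v set)) (\<lambda>z. c (fst z))"
    by (rule smooth_on_open_compose[OF _ _ A _ c(1)])
      (auto simp: smooth_on_open_vec_iff oN intro!: Cinf_on_linear bounded_linear_fst)
  have pr: "smooth_on_open vec_atlas (prod_atlas A vec_atlas) (N \<times> (UNIV :: 'v set)) (\<lambda>z. (c (fst z), snd z))"
    by (rule smooth_on_open_Pair[OF _ A _ cf])
      (auto simp: smooth_on_open_vec_iff oN intro!: Cinf_on_linear bounded_linear_snd)
  have o: "open ?M"
    using continuous_open_preimage[OF smooth_on_openD(2,1)[OF pr] smooth_on_openD(1)[OF F]] .
  have "smooth_on_open vec_atlas vec_atlas ?M ?K"
    by (rule smooth_on_open_compose[OF _ _ _ smooth_on_open_subset[OF pr o] F]) (auto simp: A)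
  then have "Cinf_on ?M ?K" by (simp add: smooth_on_open_vec_iff)
  then have D: "(?K has_derivative frechet_derivative ?K (at (t, y t))) (at (t, y t))"
    by (rule Cinf_on_has_derivative) (use c W in auto)
  let ?D = "frechet_derivative ?K (at (t, y t))"
  have lin: "linear ?D" using D has_derivative_linear by blast
  have "((\<lambda>s. (s, y s)) has_vector_derivative (1, y')) (at t)"
    by (intro has_vector_derivative_Pair y has_vector_derivative_id)
  from has_vector_derivative_chain[OF this D]
  have main: "((\<lambda>s. F (c s, y s)) has_vector_derivative ?D (1, y')) (at t)" by simp
  have "((\<lambda>s. (s, y t)) has_vector_derivative (1, 0)) (at t)"
    by (intro has_vector_derivative_Pair has_vector_derivative_id has_vector_derivative_const)
  from has_vector_derivative_chain[OF this D]
  have 1: "((\<lambda>s. F (c s, y t)) has_vector_derivative ?D (1, 0)) (at t)" by simp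
  have "velocity A c t (\<lambda>q. F (q, y t)) = ?D (1, 0)"
    by (rule velocity_eqI[where c = c and f = "\<lambda>q. F (q, y t)", OF _ 1])
      (use W smooth_on_open_section[OF A F, of "y t"] A in \<open>auto simp: smooth_near_iff\<close>)
  moreover have "((\<lambda>y. F (c t, y)) has_derivative (\<lambda>h. ?D (0, h))) (at (y t))"
    using has_derivative_right_slot[OF D] by simp
  then have "frechet_derivative (\<lambda>y. F (c t, y)) (at (y t)) y' = ?D (0, y')"
    using fun_cong[OF frechet_derivative_at, of _ "\<lambda>h. ?D (0, h)" "y t" y'] by simp
  moreover have "?D (1, y') = ?D (1, 0) + ?D (0, y')"
    using linear_add[OF lin, of "(1, 0)" "(0, y')"] by simp
  ultimately show ?thesis using main by simp
qed

section \<open>The Lie bracket\<close>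

locale lie =
  fixes G :: "('g::{t2_space,second_countable_topology}, 'e::finite_dim_normed, 'a::finite_dim_normed)
    lie_group_data"
  assumes lie_group: "lie_group G"
begin

lemma atlas [simp]: "smooth_atlas (charts G)"
  using lie_group by (simp add: lie_group_def)

lemma mult_ident_left [simp]: "mult G (ident G) q = q"
proof -
  interpret group "mult G" "ident G" "inverse_of G" using lie_group by (simp add: lie_group_def)
  show ?thesis by (rule group_left_neutral)
qed

lemma smooth_mult: "smooth_on_open (prod_atlas (charts G) (charts G)) (charts G) UNIV (\<lambda>z. mult G (fst z) (snd z))"
  using lie_group by (simp add: lie_group_def smooth_map_open_iff case_prod_unfold)

lemma tvec_of_linear: "tvec_of G (r *\<^sub>R \<xi> + \<eta>) f = r * tvec_of G \<xi> f + tvec_of G \<eta> f"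
  using lie_group by (simp add: lie_group_def)

lemma inj_tvec_of: "tvec_of G \<xi> = tvec_of G \<eta> \<Longrightarrow> \<xi> = \<eta>"
  using lie_group by (auto simp: lie_group_def bij_betw_def inj_on_def)

text \<open>A curve representing \<open>\<xi>\<close>, in the role of the exponential curve: only
  its value and velocity at 0 are prescribed. It comes directly from the description of
  \<open>tangent_space\<close> by curves.\<close>

definition generates :: "(real \<Rightarrow> 'g) \<Rightarrow> real set \<Rightarrow> 'a \<Rightarrow> bool" where
  "generates c N \<xi> \<longleftrightarrow> smooth_on_open vec_atlas (charts G) N c \<and> 0 \<in> N \<and> c 0 = ident G \<and>
     tvec_of G \<xi> = velocity (charts G) c 0"

lemma exists_generates: "\<exists>c N. generates c N \<xi>"
proof -
  have "tvec_of G \<xi> \<in> tangent_space (charts G) (ident G)"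
    using lie_group by (auto simp: lie_group_def bij_betw_def)
  then obtain c \<epsilon> where "tvec_of G \<xi> = velocity (charts G) c 0" "c 0 = ident G" "\<epsilon> > 0"
    "smooth_map vec_atlas (charts G) {-\<epsilon><..<\<epsilon>} c"
    by (auto simp: tangent_space_def)
  then show ?thesis
    by (intro exI[of _ c] exI[of _ "{-\<epsilon><..<\<epsilon>}"]) (simp add: generates_def smooth_map_open_iff)
qed

lemma smooth_translate:
  assumes A: "smooth_atlas B"
    and c: "smooth_on_open B (charts G) N c" and d: "smooth_on_open B (charts G) N d"
  shows "smooth_on_open (B :: ('m::topological_space, 'f::finite_dim_normed) chart set) (charts G) N
    (\<lambda>x. mult G (c x) (d x))"
  using smooth_on_open_compose[OF A _ _ smooth_on_open_Pair[OF A _ _ c d] smooth_mult] by simp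

section \<open>Right invariant vector fields as derivations\<close>

text \<open>Treating \<open>s\<close> as the vector factor of
  \<open>(G \<times> 'v) \<times> real\<close> turns \<open>D\<close> into a partial derivative at
  \<open>s = 0\<close> in direction 1, so \<open>smooth_on_open_partial\<close> applies. The factor
  \<open>'v\<close> keeps smoothness joint in additional parameters; the values may be real, or
  vectors when \<open>F\<close> is a chart.\<close>

lemma smooth_translate_derivative:
  fixes F :: "'g \<times> 'v::finite_dim_normed \<Rightarrow> 'w::finite_dim_normed"
  assumes F: "smooth_on_open (prod_atlas (charts G) vec_atlas) vec_atlas W F"
    and c: "generates c N \<xi>"
  defines "D \<equiv> \<lambda>z. vector_derivative (\<lambda>s. F (mult G (c s) (fst z), snd z)) (at 0)"
  shows "smooth_on_open (prod_atlas (charts G) vec_atlas) vec_atlas W D"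
    and "(q, x) \<in> W \<Longrightarrow> ((\<lambda>s. F (mult G (c s) q, x)) has_vector_derivative D (q, x)) (at 0)"
proof -
  let ?B = "prod_atlas (charts G) (vec_atlas :: ('v, 'v) chart set)"
  let ?C = "prod_atlas ?B (vec_atlas :: (real, real) chart set)"
  let ?m = "\<lambda>z :: ('g \<times> 'v) \<times> real. (mult G (c (snd z)) (fst (fst z)), snd (fst z))"
  have N: "open N" "0 \<in> N" "c 0 = ident G" "smooth_on_open vec_atlas (charts G) N c"
    using c smooth_on_openD(1) by (auto simp: generates_def)
  have o: "open ((UNIV :: ('g \<times> 'v) set) \<times> N)" using N(1) by (simp add: open_Times)
  have s1: "smooth_on_open ?C ?B (UNIV \<times> N) fst" "smooth_on_open ?C vec_atlas (UNIV \<times> N) snd"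
    by (auto intro!: smooth_on_open_fst smooth_on_open_snd o)
  have cs: "smooth_on_open ?C (charts G) (UNIV \<times> N) (\<lambda>z. c (snd z))"
    by (rule smooth_on_open_compose[OF _ _ _ s1(2) N(4)]) auto
  have ff: "smooth_on_open ?C (charts G) (UNIV \<times> N) (\<lambda>z. fst (fst z))"
    by (rule smooth_on_open_compose[OF _ _ _ s1(1) smooth_on_open_fst[OF _ _ open_UNIV]]) auto
  have sf: "smooth_on_open ?C vec_atlas (UNIV \<times> N) (\<lambda>z. snd (fst z))"
    by (rule smooth_on_open_compose[OF _ _ _ s1(1) smooth_on_open_snd[OF _ _ open_UNIV]]) auto
  have m: "smooth_on_open ?C ?B (UNIV \<times> N) ?m"
    by (intro smooth_on_open_Pair smooth_translate cs ff sf) auto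
  let ?M = "(UNIV \<times> N) \<inter> ?m -` W"
  have oM: "open ?M"
    using continuous_open_preimage[OF smooth_on_openD(2,1)[OF m] smooth_on_openD(1)[OF F]] .
  have H: "smooth_on_open ?C vec_atlas ?M (\<lambda>z. F (?m z))"
    by (rule smooth_on_open_compose[OF _ _ _ smooth_on_open_subset[OF m oM] F]) auto
  have d: "((\<lambda>s. F (mult G (c s) q, x)) has_vector_derivative
      frechet_derivative (\<lambda>s. F (mult G (c s) q, x)) (at 0) 1) (at 0)" if "(q, x) \<in> W" for q x
  proof -
    have "((q, x), 0) \<in> ?M" using that N by simp
    from smooth_on_open_partial_has_derivative[OF _ H this]
    have *: "((\<lambda>s. F (mult G (c s) q, x)) has_derivative
        frechet_derivative (\<lambda>s. F (mult G (c s) q, x)) (at 0)) (at 0)" (is "(_ has_derivative ?f') _")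
      by simp
    have "?f' = (\<lambda>h. h *\<^sub>R ?f' 1)"
    proof
      fix h
      show "?f' h = h *\<^sub>R ?f' 1" using linear_cmul[OF has_derivative_linear[OF *], of h 1] by simp
    qed
    then show ?thesis unfolding has_vector_derivative_def by (rule has_derivative_eq_rhs[OF *])
  qed
  then have e: "D (q, x) = frechet_derivative (\<lambda>s. F (mult G (c s) q, x)) (at 0) 1" if "(q, x) \<in> W" for q x
    using vector_derivative_at[OF d[OF that]] by (simp add: D_def)
  show "((\<lambda>s. F (mult G (c s) q, x)) has_vector_derivative D (q, x)) (at 0)" if "(q, x) \<in> W"
    using d[OF that] e[OF that] by simp
  have W: "open W" using F by (rule smooth_on_openD)
  \<comment> \<open>The partial derivative is smooth jointly with \<open>s\<close>; the embedding
    \<open>z \<mapsto> (z, 0)\<close> restricts it to \<open>s = 0\<close>.\<close>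
  have z: "smooth_on_open ?B ?C W (\<lambda>z. (z, 0))"
    by (intro smooth_on_open_Pair smooth_on_open_ident smooth_on_open_const W) auto
  have "smooth_on_open ?B vec_atlas W
      (\<lambda>z. frechet_derivative (\<lambda>y. F (?m (fst (z, 0::real), y))) (at (snd (z, 0::real))) 1)"
    by (rule smooth_on_open_compose[OF _ _ _ z smooth_on_open_partial[OF _ H, of 1]])
      (use N in auto)
  then show "smooth_on_open ?B vec_atlas W D"
    by (rule smooth_on_open_cong[rotated 2]) (auto simp: e)
qed

text \<open>The tangent map precomposes \<open>f\<close> with right translation by \<open>q\<close>,
  so the derivation is taken along the curve \<open>c s\<close> multiplied by \<open>q\<close> on
  the right.\<close>

lemma T_right_derivative:
  assumes c: "generates c N \<xi>" and f: "smooth_on_open (charts G) vec_atlas W f" "q \<in> W"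
  shows "((\<lambda>s. f (mult G (c s) q)) has_vector_derivative T_right G q \<xi> f) (at 0)"
proof -
  have near: "smooth_near (charts G) q f" using f by (auto simp: smooth_near_iff)
  have m: "smooth_on_open (charts G) (charts G) UNIV (\<lambda>h. mult G h q)"
    by (intro smooth_translate smooth_on_open_ident smooth_on_open_const) auto
  let ?M = "(\<lambda>h. mult G h q) -` W"
  have o: "open ?M"
    using continuous_open_preimage[OF smooth_on_openD(2,1)[OF m] smooth_on_openD(1)[OF f(1)]] by simp
  have "smooth_on_open (charts G) vec_atlas ?M (\<lambda>h. f (mult G h q))"
    by (rule smooth_on_open_compose[OF _ _ _ smooth_on_open_subset[OF m o] f(1)]) auto
  from smooth_on_open_has_velocity[OF atlas _ _ this, of N c 0] show ?thesis
    using c f(2) near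
    by (auto simp: generates_def T_right_def tangent_map_def o_def)
qed

lemma T_right_linear: "T_right G q (r *\<^sub>R \<xi> + \<eta>) f = r * T_right G q \<xi> f + T_right G q \<eta> f"
  by (simp add: T_right_def tangent_map_def tvec_of_linear)

text \<open>Joint smoothness in the parameter is what later makes the group term of the
  Euler-Lagrange equations continuous in time, with the three Lie algebra curves as
  parameters.\<close>

lemma T_right_smooth:
  fixes F :: "'g \<times> 'v::finite_dim_normed \<Rightarrow> real"
  assumes F: "smooth_on_open (prod_atlas (charts G) vec_atlas) vec_atlas W F"
  shows "smooth_on_open (prod_atlas (charts G) vec_atlas) vec_atlas W
    (\<lambda>z. T_right G (fst z) \<xi> (\<lambda>h. F (h, snd z)))"
proof -
  obtain c N where c: "generates c N \<xi>" using exists_generates by blast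
  note d = smooth_translate_derivative[OF F c]
  have e: "vector_derivative (\<lambda>s. F (mult G (c s) q, x)) (at 0) = T_right G q \<xi> (\<lambda>h. F (h, x))"
    if "(q, x) \<in> W" for q x
    using T_right_derivative[OF c smooth_on_open_section[OF atlas F]] that
    by (intro vector_derivative_at) auto
  show ?thesis
    by (rule smooth_on_open_cong[OF _ _ d(1)]) (auto simp: e)
qed

text \<open>A dummy real parameter brings functions on \<open>G\<close> alone within reach of the
  results for \<open>G \<times> 'v\<close>; setting it to 0 removes it again.\<close>

lemma smooth_on_open_extend:
  assumes "smooth_on_open (charts G) B W f" "smooth_atlas B"
  shows "smooth_on_open (prod_atlas (charts G) (vec_atlas :: (real, real) chart set)) B (W \<times> UNIV)
    (\<lambda>z. f (fst z))"
proof -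
  have "open (W \<times> (UNIV :: real set))" using smooth_on_openD(1)[OF assms(1)] by (simp add: open_Times)
  then show ?thesis
    by (intro smooth_on_open_compose[OF _ _ assms(2) smooth_on_open_fst assms(1)]) auto
qed

lemma smooth_on_open_restrict:
  assumes "smooth_on_open (prod_atlas (charts G) (vec_atlas :: (real, real) chart set)) vec_atlas (W \<times> UNIV) F"
  shows "smooth_on_open (charts G) vec_atlas W (\<lambda>q. F (q, 0))"
  using smooth_on_open_section[OF atlas assms, of 0] by (simp add: vimage_def)

lemma T_right_smooth_fun:
  assumes f: "smooth_on_open (charts G) vec_atlas W f"
  shows "smooth_on_open (charts G) vec_atlas W (\<lambda>q. T_right G q \<xi> f)"
  using smooth_on_open_restrict[OF T_right_smooth[OF smooth_on_open_extend[OF f]]] by simp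

text \<open>Linearity in the function argument is not built into the type of tangent vectors. For
  functions smooth near \<open>q\<close> it is inherited from the derivative along a representing
  curve.\<close>

lemma T_right_linear_fun:
  assumes f: "smooth_on_open (charts G) vec_atlas W f" and g: "smooth_on_open (charts G) vec_atlas W g"
    and q: "q \<in> W"
  shows "T_right G q \<xi> (\<lambda>h. r * f h + g h) = r * T_right G q \<xi> f + T_right G q \<xi> g"
proof -
  obtain c N where c: "generates c N \<xi>" using exists_generates by blast
  have bl: "bounded_linear (\<lambda>z::real \<times> real. r * fst z + snd z)"
    by (intro bounded_linear_add bounded_linear_const_mult bounded_linear_fst bounded_linear_snd)
  have "smooth_on_open (charts G) vec_atlas W (\<lambda>h. (\<lambda>z. r * fst z + snd z) (f h, g h))"
    by (rule smooth_on_open_compose[OF _ _ _ smooth_on_open_Pair[OF _ _ _ f g], where W' = UNIV])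
      (auto simp: smooth_on_open_vec_iff intro: Cinf_on_linear[OF bl])
  then have h: "smooth_on_open (charts G) vec_atlas W (\<lambda>h. r * f h + g h)" by simp
  have "((\<lambda>s. r * f (mult G (c s) q) + g (mult G (c s) q)) has_vector_derivative
      r * T_right G q \<xi> f + T_right G q \<xi> g) (at 0)"
    by (intro has_vector_derivative_add has_vector_derivative_mult_right T_right_derivative[OF c _ q] f g)
  from vector_derivative_unique_at[OF T_right_derivative[OF c h q] this] show ?thesis .
qed

section \<open>Tangent vectors and the Jacobi-Lie bracket in a chart\<close>

text \<open>Every direction \<open>w\<close> of the model space is realized by the straight line
  through \<open>\<phi> p\<close> pulled back by the chart. The value 0 in the other case matches
  the convention in \<open>velocity\<close>, which makes this an identity for all functions.\<close>

lemma chart_tangent: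
  assumes U: "(U, \<phi>) \<in> charts G" "p \<in> U"
  shows "\<exists>v \<in> tangent_space (charts G) p. \<forall>f. v f =
    (if smooth_near (charts G) p f then frechet_derivative (\<lambda>x. f (inv_into U \<phi> x)) (at (\<phi> p)) w else 0)"
proof -
  note ch = smooth_atlas_chart[OF atlas U(1)]
  let ?l = "\<lambda>s. \<phi> p + s *\<^sub>R w" and ?c = "\<lambda>s. inv_into U \<phi> (\<phi> p + s *\<^sub>R w)"
  have "continuous_on UNIV ?l" by (intro continuous_intros)
  then have "open (?l -` (\<phi> ` U))" using open_vimage[OF ch(2)] by blast
  moreover have "0 \<in> ?l -` (\<phi> ` U)" using U by simp
  ultimately obtain \<epsilon> where \<epsilon>: "\<epsilon> > 0" "ball 0 \<epsilon> \<subseteq> ?l -` (\<phi> ` U)"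
    using open_contains_ball by blast
  have ball: "{-\<epsilon><..<\<epsilon>} = ball 0 \<epsilon>" by (auto simp: dist_real_def)
  have l: "Cinf_on {-\<epsilon><..<\<epsilon>} ?l"
    by (intro Cinf_on_add Cinf_on_const Cinf_on_linear bounded_linear_scaleR_left) auto
  have c: "smooth_on_open vec_atlas (charts G) {-\<epsilon><..<\<epsilon>} ?c"
    by (rule smooth_on_open_compose[OF _ _ _ _ smooth_on_open_inv_chart[OF atlas U(1)]])
      (use \<epsilon> l in \<open>auto simp: smooth_on_open_vec_iff ball\<close>)
  have c0: "?c 0 = p" using ch(5) U by simp
  have "velocity (charts G) ?c 0 f = frechet_derivative (\<lambda>x. f (inv_into U \<phi> x)) (at (\<phi> p)) w"
    if f: "smooth_near (charts G) p f" for f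
  proof (rule velocity_eqI)
    show "smooth_near (charts G) (?c 0) f" using f c0 by simp
    obtain W where W: "p \<in> W" "smooth_on_open (charts G) vec_atlas W f"
      using f by (auto simp: smooth_near_iff)
    have "Cinf_on (\<phi> ` (W \<inter> U \<inter> f -` UNIV)) (\<lambda>x. id (f (inv_into U \<phi> x)))"
      by (rule smooth_on_openD(3)[OF W(2) U(1)]) (simp add: vec_atlas_def id_def)
    then have "((\<lambda>x. f (inv_into U \<phi> x)) has_derivative
        frechet_derivative (\<lambda>x. f (inv_into U \<phi> x)) (at (?l 0))) (at (?l 0))"
      using Cinf_on_has_derivative[of _ "\<lambda>x. f (inv_into U \<phi> x)" "?l 0"] W U by auto
    moreover have "(?l has_vector_derivative w) (at 0)" by (auto intro!: derivative_eq_intros)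
    ultimately show "((\<lambda>s. f (?c s)) has_vector_derivative
        frechet_derivative (\<lambda>x. f (inv_into U \<phi> x)) (at (\<phi> p)) w) (at 0)"
      using has_vector_derivative_chain[of ?l w 0 UNIV "\<lambda>x. f (inv_into U \<phi> x)"] by simp
  qed
  moreover have "velocity (charts G) ?c 0 f = 0" if "\<not> smooth_near (charts G) p f" for f
    using that c0 by (simp add: velocity_def)
  moreover have "velocity (charts G) ?c 0 \<in> tangent_space (charts G) p"
    unfolding tangent_space_def using c0 c \<epsilon>(1) by (auto simp: smooth_map_open_iff)
  ultimately show ?thesis by (intro bexI[of _ "velocity (charts G) ?c 0"]) auto
qed

end

text \<open>The coordinate form of \<open>X (Y f)\<close> with \<open>u\<close> the value of
  \<open>X\<close> at \<open>x\<close>: a first-order term and the second derivative of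
  \<open>f\<close> in the directions \<open>u\<close> and \<open>Y x\<close>. Coordinates of
  \<open>Y\<close> reduce it to the product rule, and the symmetry of second derivatives moves
  \<open>u\<close> to the inner position.\<close>

lemma frechet_derivative_contraction:
  fixes f :: "'e::finite_dim_normed \<Rightarrow> real" and Y :: "'e \<Rightarrow> 'e"
  assumes f: "Cinf_on S f" and Y: "Cinf_on S Y" and S: "open S" "x \<in> S"
  shows "frechet_derivative (\<lambda>y. frechet_derivative f (at y) (Y y)) (at x) u =
    frechet_derivative f (at x) (frechet_derivative Y (at x) u) +
    frechet_derivative (\<lambda>y. frechet_derivative f (at y) u) (at x) (Y x)"
proof -
  obtain B :: "'e set" and c where c: "finite B" "\<And>b. bounded_linear (c b)"
      "\<And>x. (\<Sum>b\<in>B. c b x *\<^sub>R b) = x"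
    using finite_dim_coordinates by blast
  let ?D = "\<lambda>v y. frechet_derivative f (at y) v"
  have lin: "linear (frechet_derivative f (at y))" if "y \<in> S" for y
    using Cinf_on_has_derivative[OF f that] has_derivative_linear by blast
  have expand: "?D v y = (\<Sum>b\<in>B. c b v * ?D b y)" if "y \<in> S" for v y
  proof -
    have "?D v y = ?D (\<Sum>b\<in>B. c b v *\<^sub>R b) y" by (simp add: c(3))
    then show ?thesis by (simp add: linear_sum[OF lin[OF that]] linear_cmul[OF lin[OF that]])
  qed
  have "((\<lambda>y. \<Sum>b\<in>B. c b (Y y) * ?D b y) has_derivative
      (\<lambda>h. \<Sum>b\<in>B. c b (Y x) * frechet_derivative (?D b) (at x) h +
        c b (frechet_derivative Y (at x) h) * ?D b x)) (at x)"
    by (intro has_derivative_sum has_derivative_mult bounded_linear.has_derivative[OF c(2)]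
        Cinf_on_has_derivative[OF Y S(2)] Cinf_on_has_derivative[OF Cinf_on_frechet_derivative[OF f] S(2)])
  then have "((\<lambda>y. ?D (Y y) y) has_derivative
      (\<lambda>h. \<Sum>b\<in>B. c b (Y x) * frechet_derivative (?D b) (at x) h +
        c b (frechet_derivative Y (at x) h) * ?D b x)) (at x)"
    by (rule has_derivative_transform_within_open[OF _ S]) (simp add: expand)
  from fun_cong[OF frechet_derivative_at[OF this], of u]
  have 1: "frechet_derivative (\<lambda>y. ?D (Y y) y) (at x) u =
      (\<Sum>b\<in>B. c b (Y x) * frechet_derivative (?D b) (at x) u) + ?D (frechet_derivative Y (at x) u) x"
    by (simp add: sum.distrib expand[OF S(2), of "frechet_derivative Y (at x) u"])
  have lin2: "linear (frechet_derivative (?D u) (at x))"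
    using Cinf_on_has_derivative[OF Cinf_on_frechet_derivative[OF f] S(2)] has_derivative_linear by blast
  have "(\<Sum>b\<in>B. c b (Y x) * frechet_derivative (?D b) (at x) u) =
      (\<Sum>b\<in>B. c b (Y x) * frechet_derivative (?D u) (at x) b)"
    by (simp add: second_derivative_symmetric[OF f S, of u])
  also have "\<dots> = frechet_derivative (?D u) (at x) (\<Sum>b\<in>B. c b (Y x) *\<^sub>R b)"
    by (simp add: linear_sum[OF lin2] linear_cmul[OF lin2])
  finally show ?thesis using 1 by (simp add: c(3))
qed

context lie begin

text \<open>In a chart, the second-order parts of \<open>X (Y f)\<close> and \<open>Y (X f)\<close> cancel, so that the
  Jacobi--Lie bracket is again a derivative in a single direction.\<close>

lemma jacobi_lie_in_tangent_space:
  "jacobi_lie (charts G) (\<lambda>q. T_right G q \<xi>) (\<lambda>q. T_right G q \<eta>) (ident G) \<in> tangent_space (charts G) (ident G)"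
proof -
  obtain U \<phi> where U: "(U, \<phi>) \<in> charts G" "ident G \<in> U" by (rule smooth_atlas_cover[OF atlas])
  note ch = smooth_atlas_chart[OF atlas U(1)]
  define x0 where "x0 = \<phi> (ident G)"
  obtain c N where c: "\<And>\<zeta>. generates (c \<zeta>) (N \<zeta>) \<zeta>" using exists_generates by metis
  \<comment> \<open>The coordinate representative of the right invariant field generated by
    \<open>\<zeta>\<close>.\<close>
  define X where "X \<zeta> x = vector_derivative (\<lambda>s. \<phi> (mult G (c \<zeta> s) (inv_into U \<phi> x))) (at 0)" for \<zeta> x
  note chart' = smooth_on_open_extend[OF smooth_on_open_chart[OF atlas U(1)] smooth_atlas_vec]
  note td = smooth_translate_derivative[OF chart' c]
  have dX: "((\<lambda>s. \<phi> (mult G (c \<zeta> s) q)) has_vector_derivative X \<zeta> (\<phi> q)) (at 0)" if "q \<in> U" for \<zeta> q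
    using td(2)[of q 0 \<zeta>] that by (simp add: X_def ch(5))
  have sub: "inv_into U \<phi> ` \<phi> ` U \<subseteq> U" using ch(5) by auto
  have X: "Cinf_on (\<phi> ` U) (X \<zeta>)" for \<zeta>
    using smooth_on_open_compose[OF _ _ _ smooth_on_open_inv_chart[OF atlas U(1)]
        smooth_on_open_restrict[OF td(1)[of \<zeta>]] sub]
    by (simp add: smooth_on_open_vec_iff X_def[abs_def])
  have formula: "T_right G q \<zeta> f = frechet_derivative (\<lambda>x. f (inv_into U \<phi> x)) (at (\<phi> q)) (X \<zeta> (\<phi> q))"
    if W: "smooth_on_open (charts G) vec_atlas W f" "W \<subseteq> U" "q \<in> W"
      and fhat: "Cinf_on (\<phi> ` W) (\<lambda>x. f (inv_into U \<phi> x))" for \<zeta> f W q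
  proof -
    have cs: "smooth_on_open vec_atlas (charts G) (N \<zeta>) (\<lambda>s. mult G (c \<zeta> s) q)"
      using c[of \<zeta>] smooth_on_openD(1)
      by (intro smooth_translate smooth_on_open_const) (auto simp: generates_def)
    let ?M = "N \<zeta> \<inter> (\<lambda>s. mult G (c \<zeta> s) q) -` W"
    have M: "open ?M" "0 \<in> ?M"
      using continuous_open_preimage[OF smooth_on_openD(2,1)[OF cs] smooth_on_openD(1)[OF W(1)]]
        c[of \<zeta>] W(3) by (auto simp: generates_def)
    have 0: "\<phi> (mult G (c \<zeta> 0) q) = \<phi> q" using c[of \<zeta>] by (simp add: generates_def)
    have "((\<lambda>s. f (inv_into U \<phi> (\<phi> (mult G (c \<zeta> s) q)))) has_vector_derivative
        frechet_derivative (\<lambda>x. f (inv_into U \<phi> x)) (at (\<phi> q)) (X \<zeta> (\<phi> q))) (at 0)"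
      by (rule has_vector_derivative_chain[where f = "\<lambda>x. f (inv_into U \<phi> x)"
            and c = "\<lambda>s. \<phi> (mult G (c \<zeta> s) q)"])
        (use dX[of q \<zeta>] Cinf_on_has_derivative[OF fhat imageI[OF W(3)]] W 0 in auto)
    then have "((\<lambda>s. f (mult G (c \<zeta> s) q)) has_vector_derivative
        frechet_derivative (\<lambda>x. f (inv_into U \<phi> x)) (at (\<phi> q)) (X \<zeta> (\<phi> q))) (at 0)"
      by (rule has_vector_derivative_transform_within_open[OF _ M]) (use W(2) ch(5) in auto)
    from vector_derivative_unique_at[OF T_right_derivative[OF c W(1,3)] this] show ?thesis .
  qed
  \<comment> \<open>The classical coordinate expression of the bracket of the vector fields
    \<open>X \<xi>\<close> and \<open>X \<eta>\<close> at \<open>x0\<close>.\<close>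
  define w where "w = frechet_derivative (X \<eta>) (at x0) (X \<xi> x0) - frechet_derivative (X \<xi>) (at x0) (X \<eta> x0)"
  have main: "jacobi_lie (charts G) (\<lambda>q. T_right G q \<xi>) (\<lambda>q. T_right G q \<eta>) (ident G) f =
      frechet_derivative (\<lambda>x. f (inv_into U \<phi> x)) (at x0) w"
    if near: "smooth_near (charts G) (ident G) f" for f
  proof -
    obtain W0 where W0: "ident G \<in> W0" "smooth_on_open (charts G) vec_atlas W0 f"
      using near by (auto simp: smooth_near_iff)
    define W where "W = W0 \<inter> U"
    have W: "open W" "ident G \<in> W" "W \<subseteq> U"
      using smooth_on_openD(1)[OF W0(2)] ch(1) W0(1) U(2) by (auto simp: W_def)
    have f: "smooth_on_open (charts G) vec_atlas W f"
      by (rule smooth_on_open_subset[OF W0(2) W(1)]) (simp add: W_def)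
    have hat: "Cinf_on (\<phi> ` W) (\<lambda>x. h (inv_into U \<phi> x))" if "smooth_on_open (charts G) vec_atlas W h"
      for h :: "'g \<Rightarrow> real"
    proof -
      have "Cinf_on (\<phi> ` (W \<inter> U \<inter> h -` UNIV)) (\<lambda>x. id (h (inv_into U \<phi> x)))"
        by (rule smooth_on_openD(3)[OF that U(1)]) (simp add: vec_atlas_def id_def)
      then show ?thesis using W(3) by (simp add: Int_absorb2)
    qed
    let ?O = "\<phi> ` W" and ?f = "\<lambda>x. f (inv_into U \<phi> x)"
    have O: "open ?O" "x0 \<in> ?O" using ch(7)[OF W(1,3)] W(2) by (auto simp: x0_def)
    have XO: "Cinf_on ?O (X \<zeta>)" for \<zeta> by (rule Cinf_on_subset[OF X]) (use W(3) in auto)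
    \<comment> \<open>Near \<open>x0\<close> the derivative of \<open>f\<close> along the field of
      \<open>\<theta>\<close> is the contraction of the derivative of \<open>?f\<close> with
      \<open>X \<theta>\<close>; the formula in the chart is then applied to this new function along
      \<open>\<zeta>\<close>.\<close>
    have second: "T_right G (ident G) \<zeta> (\<lambda>q. T_right G q \<theta> f) =
        frechet_derivative ?f (at x0) (frechet_derivative (X \<theta>) (at x0) (X \<zeta> x0)) +
        frechet_derivative (\<lambda>y. frechet_derivative ?f (at y) (X \<zeta> x0)) (at x0) (X \<theta> x0)" for \<zeta> \<theta>
    proof -
      note s = T_right_smooth_fun[OF f, of \<theta>]
      have "frechet_derivative ?f (at x) (X \<theta> x) = T_right G (inv_into U \<phi> x) \<theta> f" if "x \<in> ?O" for x
        using that formula[OF f W(3) _ hat[OF f], of "inv_into U \<phi> x" \<theta>] W(3) ch(5) by auto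
      note e = this
      have "((\<lambda>x. T_right G (inv_into U \<phi> x) \<theta> f) has_derivative
          frechet_derivative (\<lambda>x. T_right G (inv_into U \<phi> x) \<theta> f) (at x0)) (at x0)"
        by (rule Cinf_on_has_derivative[OF hat[OF s] O(2)])
      then have "((\<lambda>x. frechet_derivative ?f (at x) (X \<theta> x)) has_derivative
          frechet_derivative (\<lambda>x. T_right G (inv_into U \<phi> x) \<theta> f) (at x0)) (at x0)"
        by (rule has_derivative_transform_within_open[OF _ O]) (simp add: e)
      from frechet_derivative_at[OF this]
      have "frechet_derivative (\<lambda>x. T_right G (inv_into U \<phi> x) \<theta> f) (at x0) =
        frechet_derivative (\<lambda>x. frechet_derivative ?f (at x) (X \<theta> x)) (at x0)" .
      then show ?thesis
        using formula[OF s W(3,2) hat[OF s], of \<zeta>] frechet_derivative_contraction[OF hat[OF f] XO O]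
        by (simp add: x0_def)
    qed
    have lin: "linear (frechet_derivative ?f (at x0))"
      using Cinf_on_has_derivative[OF hat[OF f] O(2)] has_derivative_linear by blast
    show ?thesis
      using second_derivative_symmetric[OF hat[OF f] O, of "X \<xi> x0" "X \<eta> x0"] near
      by (simp add: jacobi_lie_def second w_def linear_diff[OF lin])
  qed
  obtain v where v: "v \<in> tangent_space (charts G) (ident G)" "\<And>f. v f =
      (if smooth_near (charts G) (ident G) f then frechet_derivative (\<lambda>x. f (inv_into U \<phi> x)) (at x0) w else 0)"
    using chart_tangent[OF U, of w] unfolding x0_def by blast
  \<comment> \<open>Equality of tangent vectors is equality as functionals, so functions that are
    not smooth near the identity count too; both sides are 0 there.\<close>
  have "jacobi_lie (charts G) (\<lambda>q. T_right G q \<xi>) (\<lambda>q. T_right G q \<eta>) (ident G) = v"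
  proof (rule ext)
    fix f
    show "jacobi_lie (charts G) (\<lambda>q. T_right G q \<xi>) (\<lambda>q. T_right G q \<eta>) (ident G) f = v f"
    proof (cases "smooth_near (charts G) (ident G) f")
      case True
      then show ?thesis by (simp only: main v(2) if_True)
    next
      case False
      then show ?thesis by (simp add: v(2) jacobi_lie_def)
    qed
  qed
  then show ?thesis using v(1) by simp
qed

section \<open>Algebraic properties of the bracket and the dual maps\<close>

text \<open>The Jacobi-Lie bracket lies in the range of \<open>tvec_of\<close>, so
  \<open>inv\<close> returns a genuine preimage. Identities between brackets then follow from
  identities between functionals, by injectivity of \<open>tvec_of\<close>.\<close>

lemma tvec_of_lie_bracket:
  "tvec_of G (lie_bracket G \<xi> \<eta>) =
    jacobi_lie (charts G) (\<lambda>q. T_right G q \<xi>) (\<lambda>q. T_right G q \<eta>) (ident G)"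
proof -
  have "range (tvec_of G) = tangent_space (charts G) (ident G)"
    using lie_group by (simp add: lie_group_def bij_betw_def)
  then show ?thesis
    unfolding lie_bracket_def using jacobi_lie_in_tangent_space by (intro f_inv_into_f) simp
qed

lemma lie_bracket_skew: "lie_bracket G \<xi> \<eta> = - lie_bracket G \<eta> \<xi>"
proof -
  have z: "tvec_of G 0 f = 0" for f using tvec_of_linear[of 1 0 0 f] by simp
  have "tvec_of G (lie_bracket G \<xi> \<eta>) f = tvec_of G ((-1) *\<^sub>R lie_bracket G \<eta> \<xi> + 0) f" for f
    unfolding tvec_of_linear z by (simp add: tvec_of_lie_bracket jacobi_lie_def)
  from inj_tvec_of[OF ext[OF this]] show ?thesis by simp
qed

text \<open>The two halves of the bracket differ: in one, the combination is the differentiating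
  vector and \<open>T_right_linear\<close> suffices; in the other, it sits inside the differentiated
  function, which calls for \<open>T_right_linear_fun\<close> and smoothness.\<close>

lemma lie_bracket_linear_left:
  "lie_bracket G (r *\<^sub>R \<xi> + \<zeta>) \<eta> = r *\<^sub>R lie_bracket G \<xi> \<eta> + lie_bracket G \<zeta> \<eta>"
proof (rule inj_tvec_of, rule ext)
  fix f
  show "tvec_of G (lie_bracket G (r *\<^sub>R \<xi> + \<zeta>) \<eta>) f =
      tvec_of G (r *\<^sub>R lie_bracket G \<xi> \<eta> + lie_bracket G \<zeta> \<eta>) f"
  proof (cases "smooth_near (charts G) (ident G) f")
    case True
    then obtain W where W: "ident G \<in> W" "smooth_on_open (charts G) vec_atlas W f"
      by (auto simp: smooth_near_iff)
    have "T_right G (ident G) \<eta> (\<lambda>q. r * T_right G q \<xi> f + T_right G q \<zeta> f) =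
        r * T_right G (ident G) \<eta> (\<lambda>q. T_right G q \<xi> f) + T_right G (ident G) \<eta> (\<lambda>q. T_right G q \<zeta> f)"
      by (rule T_right_linear_fun[OF T_right_smooth_fun[OF W(2)] T_right_smooth_fun[OF W(2)] W(1)])
    then show ?thesis
      unfolding tvec_of_linear tvec_of_lie_bracket jacobi_lie_def T_right_linear
      by (simp add: algebra_simps)
  next
    case False
    then show ?thesis unfolding tvec_of_linear tvec_of_lie_bracket jacobi_lie_def by simp
  qed
qed

lemma bounded_bilinear_lie_bracket: "bounded_bilinear (lie_bracket G)"
proof (rule bilinear_imp_bounded_bilinear)
  have l: "lie_bracket G (x + y) z = lie_bracket G x z + lie_bracket G y z" for x y z
    using lie_bracket_linear_left[of 1 x y z] by simp
  have z: "lie_bracket G 0 z = 0" for z using l[of 0 0 z] by simp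
  have s: "lie_bracket G (r *\<^sub>R x) z = r *\<^sub>R lie_bracket G x z" for r x z
    using lie_bracket_linear_left[of r x 0 z] z by simp
  have "lie_bracket G z (x + y) = lie_bracket G z x + lie_bracket G z y"
    "lie_bracket G z (r *\<^sub>R x) = r *\<^sub>R lie_bracket G z x" for r x y z
    by (simp_all add: lie_bracket_skew[of z] l s)
  then show "bilinear (lie_bracket G)"
    by (simp add: bilinear_def linear_iff l s)
qed

text \<open>\<open>Blinfun\<close> is meaningful only on bounded linear maps; boundedness of the
  bracket in its second argument provides this.\<close>

lemma blinfun_apply_ad_star:
  "blinfun_apply (ad_star G \<xi> \<mu>) \<eta> = blinfun_apply \<mu> (lie_bracket G \<xi> \<eta>)"
  unfolding ad_star_def
  by (subst bounded_linear_Blinfun_apply)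
    (auto intro: bounded_linear_compose[OF blinfun.bounded_linear_right]
      bounded_bilinear.bounded_linear_right[OF bounded_bilinear_lie_bracket])

lemma blinfun_apply_T_right_dual_pd_g:
  "blinfun_apply (T_right_dual G q (pd_g L g x1 x2 x3)) \<eta> = T_right G q \<eta> (\<lambda>h. L (h, x1, x2, x3))"
proof -
  have "T_right G q 0 f = 0" for f using T_right_linear[of q 1 0 0 f] by simp
  then have "linear (\<lambda>\<eta>. T_right G q \<eta> f)" for f
    using T_right_linear[of q 1 _ _ f] T_right_linear[of q _ _ 0 f] by (intro linearI) simp_all
  then show ?thesis
    unfolding T_right_dual_def pd_g_def
    by (subst bounded_linear_Blinfun_apply) (auto intro: linear_imp_bounded_linear)
qed

end

section \<open>The first variation\<close>

text \<open>With \<open>r\<close> uniformly within \<open>e\<close> of \<open>h\<close>, the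
  weighted integral \<open>S\<close> of the square of \<open>h\<close> is at most
  \<open>e * K\<close>, hence zero. The weight is positive inside the interval, which forces
  \<open>h\<close> to vanish there; continuity gives the end points.\<close>

lemma fundamental_lemma_polynomial:
  fixes h :: "real \<Rightarrow> real"
  assumes h: "continuous_on {a..b} h" and ab: "a < b"
    and 0: "\<And>r. real_polynomial_function r \<Longrightarrow> ((\<lambda>t. (t - a) * (b - t) * r t * h t) has_integral 0) {a..b}"
    and t: "t \<in> {a..b}"
  shows "h t = 0"
proof -
  let ?w = "\<lambda>t. (t - a) * (b - t)"
  have w: "?w t \<ge> 0" if "t \<in> {a..b}" for t using that by auto
  have cw: "continuous_on {a..b} ?w" by (intro continuous_intros)
  have c1: "continuous_on {a..b} (\<lambda>t. ?w t * (h t * h t))" and c2: "continuous_on {a..b} (\<lambda>t. ?w t * \<bar>h t\<bar>)"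
    by (intro continuous_intros cw h)+
  define S where "S = integral {a..b} (\<lambda>t. ?w t * (h t * h t))"
  define K where "K = integral {a..b} (\<lambda>t. ?w t * \<bar>h t\<bar>)"
  have S: "((\<lambda>t. ?w t * (h t * h t)) has_integral S) {a..b}"
    unfolding S_def by (intro integrable_integral integrable_continuous_real c1)
  have K: "((\<lambda>t. ?w t * \<bar>h t\<bar>) has_integral K) {a..b}"
    unfolding K_def by (intro integrable_integral integrable_continuous_real c2)
  have SK: "S \<le> e * K" if e: "e > 0" for e
  proof -
    obtain r where r: "real_polynomial_function r" "\<And>t. t \<in> {a..b} \<Longrightarrow> \<bar>h t - r t\<bar> < e"
      using Stone_Weierstrass_real_polynomial_function[OF compact_Icc h e] by blast
    \<comment> \<open>Subtracting the vanishing integral replaces one factor \<open>h\<close> by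
      \<open>h - r\<close>, which is small.\<close>
    have "((\<lambda>t. ?w t * (h t * h t) - ?w t * r t * h t) has_integral S - 0) {a..b}"
      by (intro has_integral_diff S 0 r)
    moreover have "((\<lambda>t. e * (?w t * \<bar>h t\<bar>)) has_integral e * K) {a..b}"
      by (intro has_integral_mult_right K)
    moreover have "?w t * (h t * h t) - ?w t * r t * h t \<le> e * (?w t * \<bar>h t\<bar>)" if "t \<in> {a..b}" for t
    proof -
      have "(h t - r t) * h t \<le> \<bar>h t - r t\<bar> * \<bar>h t\<bar>" by (metis abs_ge_self abs_mult)
      also have "\<dots> \<le> e * \<bar>h t\<bar>" using r(2)[OF that] by (intro mult_right_mono) auto
      finally have "?w t * ((h t - r t) * h t) \<le> ?w t * (e * \<bar>h t\<bar>)"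
        using w[OF that] by (rule mult_left_mono)
      then show ?thesis by (simp add: algebra_simps)
    qed
    ultimately have "S - 0 \<le> e * K" by (rule has_integral_le)
    then show ?thesis by simp
  qed
  have K0: "K \<ge> 0" by (rule has_integral_nonneg[OF K]) (use w in auto)
  have "S \<le> 0"
  proof (rule field_le_epsilon)
    fix e :: real assume e: "e > 0"
    \<comment> \<open>The denominator is \<open>K + 1\<close> because \<open>K\<close> may be
      zero.\<close>
    have "S \<le> (e / (K + 1)) * K" by (rule SK) (use e K0 in auto)
    also have "\<dots> \<le> e" using e K0 by (simp add: field_simps)
    finally show "S \<le> 0 + e" by simp
  qed
  moreover have nn: "?w t * (h t * h t) \<ge> 0" if "t \<in> {a..b}" for t
    by (rule mult_nonneg_nonneg[OF w[OF that] zero_le_square])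
  then have "S \<ge> 0" by (rule has_integral_nonneg[OF S])
  ultimately have "integral {a..b} (\<lambda>t. ?w t * (h t * h t)) = 0" by (simp add: S_def)
  then have "\<forall>t\<in>{a..b}. ?w t * (h t * h t) = 0"
    using integral_eq_0_iff[OF c1 ab nn] by simp
  then have "h t = 0" if "t \<in> {a<..<b}" for t using that by fastforce
  with continuous_constant_on_closure[of "{a<..<b}" h 0 t] h t ab show ?thesis by simp
qed

section \<open>Smooth curves in the dual space\<close>

text \<open>The derivatives of all evaluations are collected into one map \<open>D t\<close>. It is
  linear by uniqueness of derivatives and bounded by finite dimension, so the componentwise
  criterion identifies it as the derivative of \<open>P\<close>.\<close>

lemma blinfun_curve_derivative:
  fixes P :: "real \<Rightarrow> 'a::finite_dim_normed \<Rightarrow>\<^sub>L real"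
  assumes P: "\<And>v. Cinf_on W (\<lambda>t. blinfun_apply (P t) v)"
  shows "\<exists>P'. (\<forall>t\<in>W. (P has_vector_derivative P' t) (at t)) \<and>
    (\<forall>v. continuous_on W (\<lambda>t. blinfun_apply (P' t) v))"
proof -
  define D where "D t v = frechet_derivative (\<lambda>t. blinfun_apply (P t) v) (at t) 1" for t v
  have d: "((\<lambda>t. blinfun_apply (P t) v) has_vector_derivative D t v) (at t)" if "t \<in> W" for t v
  proof -
    have *: "((\<lambda>t. blinfun_apply (P t) v) has_derivative frechet_derivative (\<lambda>t. blinfun_apply (P t) v) (at t)) (at t)"
      (is "(_ has_derivative ?f) _")
      by (rule Cinf_on_has_derivative[OF P that])
    have "?f = (\<lambda>h. h *\<^sub>R ?f 1)"
    proof
      fix h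
      show "?f h = h *\<^sub>R ?f 1" using linear_cmul[OF has_derivative_linear[OF *], of h 1] by simp
    qed
    then show ?thesis
      unfolding has_vector_derivative_def D_def by (rule has_derivative_eq_rhs[OF *])
  qed
  have lin: "linear (D t)" if t: "t \<in> W" for t
  proof (rule linearI)
    fix u v :: 'a and r :: real
    have "((\<lambda>t. blinfun_apply (P t) (u + v)) has_vector_derivative D t u + D t v) (at t)"
      using has_vector_derivative_add[OF d[OF t, of u] d[OF t, of v]] by (simp add: blinfun.add_right)
    from vector_derivative_unique_at[OF d[OF t] this] show "D t (u + v) = D t u + D t v" .
    have "((\<lambda>t. blinfun_apply (P t) (r *\<^sub>R v)) has_vector_derivative r *\<^sub>R D t v) (at t)"
      using bounded_linear.has_vector_derivative[OF bounded_linear_scaleR_right[of r] d[OF t, of v]]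
      by (simp add: blinfun.scaleR_right)
    from vector_derivative_unique_at[OF d[OF t] this] show "D t (r *\<^sub>R v) = r *\<^sub>R D t v" .
  qed
  have ap: "blinfun_apply (Blinfun (D t)) v = D t v" if "t \<in> W" for t v
    by (simp add: bounded_linear_Blinfun_apply[OF linear_imp_bounded_linear[OF lin[OF that]]])
  show ?thesis
  proof (intro exI[of _ "\<lambda>t. Blinfun (D t)"] conjI ballI allI)
    show "(P has_vector_derivative Blinfun (D t)) (at t)" if "t \<in> W" for t
      using d[OF that] by (simp add: has_vector_derivative_blinfun_componentwise ap[OF that])
    have "continuous_on W (\<lambda>t. D t v)" for v
      unfolding D_def by (intro Cinf_on_imp_continuous_on Cinf_on_frechet_derivative P)
    then show "continuous_on W (\<lambda>t. blinfun_apply (Blinfun (D t)) v)" for v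
      by (simp add: ap cong: continuous_on_cong)
  qed
qed

lemma continuous_on_blinfun_curve:
  fixes P :: "real \<Rightarrow> 'a::finite_dim_normed \<Rightarrow>\<^sub>L real"
  assumes "\<And>v. Cinf_on W (\<lambda>t. blinfun_apply (P t) v)"
  shows "continuous_on W P"
proof -
  obtain P' where "\<forall>t\<in>W. (P has_vector_derivative P' t) (at t)"
    using blinfun_curve_derivative[OF assms] by metis
  then show ?thesis
    by (auto intro!: continuous_at_imp_continuous_on dest: has_vector_derivative_continuous)
qed

lemma Cinf_on_along_curve:
  fixes A :: "('m::topological_space, 'e::finite_dim_normed) chart set"
    and F :: "'m \<times> 'v::finite_dim_normed \<Rightarrow> 'w::finite_dim_normed"
  assumes A: "smooth_atlas A" and F: "smooth_on_open (prod_atlas A vec_atlas) vec_atlas UNIV F"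
    and c: "smooth_on_open vec_atlas A W c" and x: "Cinf_on W x"
  shows "Cinf_on (W :: 'u::finite_dim_normed set) (\<lambda>t. F (c t, x t))"
proof -
  have "open W" using c by (rule smooth_on_openD)
  then have "smooth_on_open vec_atlas vec_atlas W (\<lambda>t. F (c t, x t))"
    by (intro smooth_on_open_compose[OF _ _ _ smooth_on_open_Pair[OF _ A _ c] F])
      (auto simp: smooth_on_open_vec_iff x A)
  then show ?thesis by (simp add: smooth_on_open_vec_iff)
qed

text \<open>The smooth extension provides a derivative within \<open>S\<close> at every point, end
  points of an interval included, so the choice made by \<open>vector_derivative\<close> is a
  genuine derivative.\<close>

lemma smooth_map_vec_has_vector_derivative:
  fixes \<eta> :: "real \<Rightarrow> 'a::finite_dim_normed"
  assumes "smooth_map vec_atlas vec_atlas S \<eta>" "t \<in> S"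
  shows "(\<eta> has_vector_derivative vector_derivative \<eta> (at t within S)) (at t within S)"
proof -
  obtain W F where F: "open W" "S \<subseteq> W" "Cinf_on W F" "\<And>x. x \<in> S \<Longrightarrow> F x = \<eta> x"
    using assms(1) by (auto simp: smooth_map_def smooth_on_open_vec_iff)
  have "(F has_derivative frechet_derivative F (at t)) (at t within S)"
    using Cinf_on_has_derivative[OF F(3)] F(2) assms(2) by (blast intro: has_derivative_at_withinI)
  then have "(\<eta> has_derivative frechet_derivative F (at t)) (at t within S)"
    by (rule has_derivative_transform[OF assms(2), rotated]) (simp add: F(4))
  then show ?thesis by (auto simp: vector_derivative_works[symmetric] differentiable_def)
qed

section \<open>Momenta and forces along a curve\<close>

text \<open>\<open>W\<close> is a common open domain of extensions of the four curves, which gives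
  two-sided time derivatives even at \<open>a\<close> and \<open>b\<close>.\<close>

locale lagrangian_curve = lie G
  for G :: "('g::{t2_space,second_countable_topology}, 'e::finite_dim_normed, 'a::finite_dim_normed)
    lie_group_data" +
  fixes L :: "'g \<times> 'a \<times> 'a \<times> 'a \<Rightarrow> real" and a b :: real and W :: "real set"
    and g :: "real \<Rightarrow> 'g" and \<xi>1 \<xi>2 \<xi>3 :: "real \<Rightarrow> 'a"
  assumes smooth_L: "smooth_on_open (prod_atlas (charts G) vec_atlas) vec_atlas UNIV L"
    and ab: "a < b" and W: "open W" "{a..b} \<subseteq> W"
    and smooth_g: "smooth_on_open vec_atlas (charts G) W g"
    and smooth_\<xi>: "Cinf_on W \<xi>1" "Cinf_on W \<xi>2" "Cinf_on W \<xi>3"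
begin

definition D1 where "D1 t = pd_1 L (g t) (\<xi>1 t) (\<xi>2 t) (\<xi>3 t)"
definition D2 where "D2 t = pd_2 L (g t) (\<xi>1 t) (\<xi>2 t) (\<xi>3 t)"
definition D3 where "D3 t = pd_3 L (g t) (\<xi>1 t) (\<xi>2 t) (\<xi>3 t)"

definition rhs2 where
  "rhs2 t = T_right_dual G (g t) (pd_g L (g t) (\<xi>1 t) (\<xi>2 t) (\<xi>3 t))
     + ad_star G (\<xi>1 t) (D1 t) + ad_star G (\<xi>2 t) (D2 t) + ad_star G (\<xi>3 t) (D3 t)"

definition rhs3 where "rhs3 t = D1 t + ad_star G (\<xi>2 t) (D3 t)"

lemma L_has_derivative:
  "((\<lambda>y. L (q, y)) has_derivative frechet_derivative (\<lambda>y. L (q, y)) (at y)) (at y)"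
  by (rule smooth_on_open_partial_has_derivative[OF atlas smooth_L]) simp

text \<open>The three partial derivatives are restrictions of one derivative with respect to the
  triple. Smoothness in time thus reduces to a single statement about that derivative in a fixed
  direction.\<close>

lemma blinfun_apply_pd:
  "blinfun_apply (pd_1 L q x1 x2 x3) v = frechet_derivative (\<lambda>y. L (q, y)) (at (x1, x2, x3)) (v, 0, 0)"
  "blinfun_apply (pd_2 L q x1 x2 x3) v = frechet_derivative (\<lambda>y. L (q, y)) (at (x1, x2, x3)) (0, v, 0)"
  "blinfun_apply (pd_3 L q x1 x2 x3) v = frechet_derivative (\<lambda>y. L (q, y)) (at (x1, x2, x3)) (0, 0, v)"
proof -
  let ?D = "frechet_derivative (\<lambda>y. L (q, y)) (at (x1, x2, x3))"
  have "((\<lambda>y. L (q, y, x2, x3)) has_derivative (\<lambda>h. ?D (h, 0, 0))) (at x1)"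
    using has_derivative_compose[OF has_derivative_Pair[OF has_derivative_ident
          has_derivative_const[of "(x2, x3)"]] L_has_derivative]
    by (simp add: zero_prod_def)
  from frechet_derivative_at[OF this, symmetric] has_derivative_bounded_linear[OF this]
  show "blinfun_apply (pd_1 L q x1 x2 x3) v = ?D (v, 0, 0)"
    by (simp add: pd_1_def bounded_linear_Blinfun_apply)
  have "((\<lambda>y. L (q, x1, y, x3)) has_derivative (\<lambda>h. ?D (0, h, 0))) (at x2)"
    by (rule has_derivative_compose[OF has_derivative_Pair[OF has_derivative_const
            has_derivative_Pair[OF has_derivative_ident has_derivative_const]] L_has_derivative])
  from frechet_derivative_at[OF this, symmetric] has_derivative_bounded_linear[OF this]
  show "blinfun_apply (pd_2 L q x1 x2 x3) v = ?D (0, v, 0)"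
    by (simp add: pd_2_def bounded_linear_Blinfun_apply)
  have "((\<lambda>y. L (q, x1, x2, y)) has_derivative (\<lambda>h. ?D (0, 0, h))) (at x3)"
    by (rule has_derivative_compose[OF has_derivative_Pair[OF has_derivative_const
            has_derivative_Pair[OF has_derivative_const has_derivative_ident]] L_has_derivative])
  from frechet_derivative_at[OF this, symmetric] has_derivative_bounded_linear[OF this]
  show "blinfun_apply (pd_3 L q x1 x2 x3) v = ?D (0, 0, v)"
    by (simp add: pd_3_def bounded_linear_Blinfun_apply)
qed

lemma Cinf_on_\<xi>: "Cinf_on W (\<lambda>t. (\<xi>1 t, \<xi>2 t, \<xi>3 t))"
  by (intro Cinf_on_Pair W smooth_\<xi>)

lemma Cinf_on_partial: "Cinf_on W (\<lambda>t. frechet_derivative (\<lambda>y. L (g t, y)) (at (\<xi>1 t, \<xi>2 t, \<xi>3 t)) w)"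
  using Cinf_on_along_curve[OF atlas smooth_on_open_partial[OF atlas smooth_L, of w] smooth_g Cinf_on_\<xi>]
  by simp

lemma Cinf_on_D:
  "Cinf_on W (\<lambda>t. blinfun_apply (D1 t) v)" "Cinf_on W (\<lambda>t. blinfun_apply (D2 t) v)"
  "Cinf_on W (\<lambda>t. blinfun_apply (D3 t) v)"
  unfolding D1_def D2_def D3_def blinfun_apply_pd by (rule Cinf_on_partial)+

lemma continuous_on_D: "continuous_on W D1" "continuous_on W D2" "continuous_on W D3"
  by (intro continuous_on_blinfun_curve Cinf_on_D)+

text \<open>Evaluated at \<open>v\<close>, a coadjoint term is a momentum applied to a bracket with
  \<open>v\<close>, continuous by bilinearity; the group term is smooth by joint smoothness of
  \<open>T_right\<close>.\<close>

lemma continuous_on_rhs: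
  "continuous_on W (\<lambda>t. blinfun_apply (rhs2 t) v)" "continuous_on W (\<lambda>t. blinfun_apply (rhs3 t) v)"
proof -
  have 1: "continuous_on W (\<lambda>t. T_right G (g t) v (\<lambda>h. L (h, \<xi>1 t, \<xi>2 t, \<xi>3 t)))"
    using Cinf_on_imp_continuous_on[OF Cinf_on_along_curve[OF atlas T_right_smooth[OF smooth_L]
          smooth_g Cinf_on_\<xi>]] by simp
  note \<xi> = smooth_\<xi>[THEN Cinf_on_imp_continuous_on]
  note br = bounded_bilinear.continuous_on[OF bounded_bilinear_lie_bracket _ continuous_on_const]
  show "continuous_on W (\<lambda>t. blinfun_apply (rhs2 t) v)" "continuous_on W (\<lambda>t. blinfun_apply (rhs3 t) v)"
    unfolding rhs2_def rhs3_def blinfun.add_left blinfun_apply_ad_star blinfun_apply_T_right_dual_pd_g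
    by (intro continuous_on_add 1 bounded_bilinear.continuous_on[OF bounded_bilinear_blinfun_apply]
        continuous_on_D br \<xi> continuous_on_const)+
qed

definition D2' where "D2' = (SOME P'. (\<forall>t\<in>W. (D2 has_vector_derivative P' t) (at t)) \<and>
    (\<forall>v. continuous_on W (\<lambda>t. blinfun_apply (P' t) v)))"
definition D3' where "D3' = (SOME P'. (\<forall>t\<in>W. (D3 has_vector_derivative P' t) (at t)) \<and>
    (\<forall>v. continuous_on W (\<lambda>t. blinfun_apply (P' t) v)))"

lemma D2': "t \<in> W \<Longrightarrow> (D2 has_vector_derivative D2' t) (at t)"
    "continuous_on W (\<lambda>t. blinfun_apply (D2' t) v)"
  and D3': "t \<in> W \<Longrightarrow> (D3 has_vector_derivative D3' t) (at t)"
    "continuous_on W (\<lambda>t. blinfun_apply (D3' t) v)"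
proof -
  from someI_ex[OF blinfun_curve_derivative[OF Cinf_on_D(2)]] someI_ex[OF blinfun_curve_derivative[OF Cinf_on_D(3)]]
  show "t \<in> W \<Longrightarrow> (D2 has_vector_derivative D2' t) (at t)"
    "continuous_on W (\<lambda>t. blinfun_apply (D2' t) v)"
    "t \<in> W \<Longrightarrow> (D3 has_vector_derivative D3' t) (at t)"
    "continuous_on W (\<lambda>t. blinfun_apply (D3' t) v)"
    unfolding D2'_def D3'_def by auto
qed

definition E2 where "E2 t = rhs2 t - D2' t"
definition E3 where "E3 t = rhs3 t - D3' t"

lemma continuous_on_E:
  "continuous_on {a..b} (\<lambda>t. blinfun_apply (E2 t) v)" "continuous_on {a..b} (\<lambda>t. blinfun_apply (E3 t) v)"
  unfolding E2_def E3_def blinfun.diff_left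
  using continuous_on_subset[OF continuous_on_diff[OF continuous_on_rhs(1) D2'(2)] W(2)]
    continuous_on_subset[OF continuous_on_diff[OF continuous_on_rhs(2) D3'(2)] W(2)] by auto

text \<open>The two-sided derivative restricts to \<open>{a..b}\<close>, and derivatives within a
  nondegenerate closed interval are unique, so the equation holds exactly when its right-hand side
  is the known derivative.\<close>

lemma euler_lagrange_iff:
  assumes "t \<in> {a..b}"
  shows "(D2 has_vector_derivative rhs2 t) (at t within {a..b}) \<longleftrightarrow> E2 t = 0"
    and "(D3 has_vector_derivative rhs3 t) (at t within {a..b}) \<longleftrightarrow> E3 t = 0"
proof -
  have "t \<in> W" using assms W by auto
  from has_vector_derivative_at_within[OF D2'(1)[OF this]] has_vector_derivative_at_within[OF D3'(1)[OF this]]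
  show "(D2 has_vector_derivative rhs2 t) (at t within {a..b}) \<longleftrightarrow> E2 t = 0"
    "(D3 has_vector_derivative rhs3 t) (at t within {a..b}) \<longleftrightarrow> E3 t = 0"
    using vector_derivative_unique_within_closed_interval[of a b t D2 "rhs2 t" "D2' t"]
      vector_derivative_unique_within_closed_interval[of a b t D3 "rhs3 t" "D3' t"] ab assms
    by (auto simp: E2_def E3_def)
qed

section \<open>The first variation formula\<close>

text \<open>Bilinearity and skew-symmetry of the bracket are all that is used of the Lie algebra here:
  the integrand minus the total derivative of \<open>D2 t (\<eta>2 t) + D3 t (\<eta>3 t)\<close> is linear in \<open>\<eta>2 t\<close>
  and \<open>\<eta>3 t\<close>, with coefficients \<open>E2 t\<close> and \<open>E3 t\<close>.\<close>

lemma first_variation: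
  fixes \<eta>2 \<eta>3 \<eta>2' \<eta>3' :: "real \<Rightarrow> 'a"
  assumes \<eta>2: "\<And>t. t \<in> {a..b} \<Longrightarrow> (\<eta>2 has_vector_derivative \<eta>2' t) (at t within {a..b})"
    and \<eta>3: "\<And>t. t \<in> {a..b} \<Longrightarrow> (\<eta>3 has_vector_derivative \<eta>3' t) (at t within {a..b})"
    and bd: "\<eta>2 a = 0" "\<eta>2 b = 0" "\<eta>3 a = 0" "\<eta>3 b = 0"
    and \<epsilon>: "\<epsilon> > 0"
    and \<Gamma>: "smooth_map vec_atlas (prod_atlas (charts G) vec_atlas) ({-\<epsilon><..<\<epsilon>} \<times> {a..b}) \<Gamma>"
    and \<Gamma>0: "\<And>t. t \<in> {a..b} \<Longrightarrow> \<Gamma> (0, t) = (g t, \<xi>1 t, \<xi>2 t, \<xi>3 t)"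
    and vel: "\<And>t. t \<in> {a..b} \<Longrightarrow> velocity (charts G) (\<lambda>s. fst (\<Gamma> (s, t))) 0 = T_right G (g t) (\<eta>2 t)"
    and der: "\<And>t. t \<in> {a..b} \<Longrightarrow> ((\<lambda>s. snd (\<Gamma> (s, t))) has_vector_derivative
      (\<eta>3 t + lie_bracket G (\<xi>1 t) (\<eta>2 t), \<eta>2' t + lie_bracket G (\<xi>2 t) (\<eta>2 t),
       \<eta>3' t + lie_bracket G (\<xi>2 t) (\<eta>3 t) - lie_bracket G (\<eta>2 t) (\<xi>3 t))) (at 0)"
  obtains J where "((\<lambda>s. integral {a..b} (\<lambda>t. L (\<Gamma> (s, t)))) has_real_derivative J) (at 0)"
    "((\<lambda>t. blinfun_apply (E2 t) (\<eta>2 t) + blinfun_apply (E3 t) (\<eta>3 t)) has_integral J) {a..b}"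
proof -
  let ?R = "{-\<epsilon><..<\<epsilon>} \<times> {a..b}"
  obtain M \<Gamma>' where M: "open M" "?R \<subseteq> M" and \<Gamma>': "smooth_on_open vec_atlas (prod_atlas (charts G) vec_atlas) M \<Gamma>'"
    "\<And>z. z \<in> ?R \<Longrightarrow> \<Gamma>' z = \<Gamma> z"
    using \<Gamma> unfolding smooth_map_def by blast
  \<comment> \<open>On the open set \<open>M\<close> the composite of \<open>L\<close> with the
    extended deformation is smooth in both real variables, which supplies the continuity demanded by
    the Leibniz rule.\<close>
  define F where "F z = L (\<Gamma>' z)" for z
  have F: "Cinf_on M F"
    using smooth_on_open_compose[OF _ _ _ \<Gamma>'(1) smooth_L] by (simp add: smooth_on_open_vec_iff F_def[abs_def])
  let ?Fs = "\<lambda>z. frechet_derivative F (at z) (1, 0)"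
  have Fs: "((\<lambda>s. F (s, t)) has_vector_derivative ?Fs (s, t)) (at s within S)" if "(s, t) \<in> M" for s t S
    by (rule has_vector_derivative_chain[OF has_vector_derivative_Pair[OF has_vector_derivative_id
            has_vector_derivative_const] Cinf_on_has_derivative[OF F that]])
  have cF: "continuous_on M F" "continuous_on M ?Fs"
    by (intro Cinf_on_imp_continuous_on Cinf_on_frechet_derivative F)+
  have ct: "continuous_on {a..b} (\<lambda>t. f (s, t))" if "continuous_on M f" "s \<in> {-\<epsilon><..<\<epsilon>}"
    for s and f :: "real \<times> real \<Rightarrow> real"
    by (rule continuous_on_compose2[OF that(1)]) (use that M in \<open>auto intro!: continuous_intros\<close>)
  define J where "J = integral {a..b} (\<lambda>t. ?Fs (0, t))"
  have "((\<lambda>s. integral (cbox a b) (\<lambda>t. F (s, t))) has_field_derivative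
      integral (cbox a b) (\<lambda>t. ?Fs (0, t))) (at 0 within {-\<epsilon><..<\<epsilon>})"
  proof (rule leibniz_rule_field_derivative[where fx = "\<lambda>s t. ?Fs (s, t)"])
    fix s t assume "s \<in> {-\<epsilon><..<\<epsilon>}" "t \<in> cbox a b"
    then have "(s, t) \<in> M" using M(2) by auto
    from Fs[OF this]
    show "((\<lambda>s. F (s, t)) has_real_derivative ?Fs (s, t)) (at s within {-\<epsilon><..<\<epsilon>})"
      by (simp only: has_real_derivative_iff_has_vector_derivative)
  next
    fix s assume "s \<in> {-\<epsilon><..<\<epsilon>}"
    then show "(\<lambda>t. F (s, t)) integrable_on cbox a b"
      using ct[OF cF(1)] by (auto intro: integrable_continuous_real)
  next
    show "continuous_on ({-\<epsilon><..<\<epsilon>} \<times> cbox a b) (\<lambda>(s, t). ?Fs (s, t))"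
      using continuous_on_subset[OF cF(2) M(2)] by simp
  qed (use \<epsilon> in auto)
  then have dF: "((\<lambda>s. integral {a..b} (\<lambda>t. F (s, t))) has_real_derivative J) (at 0)"
    using \<epsilon> by (simp add: J_def at_within_open[of 0 "{-\<epsilon><..<\<epsilon>}"])
  \<comment> \<open>The extension agrees with \<open>\<Gamma>\<close> for all small
    \<open>s\<close>, which is enough for a derivative at 0.\<close>
  have "integral {a..b} (\<lambda>t. F (s, t)) = integral {a..b} (\<lambda>t. L (\<Gamma> (s, t)))"
    if "s \<in> {-\<epsilon><..<\<epsilon>}" for s
    using that \<Gamma>'(2) by (intro integral_cong) (simp add: F_def)
  from has_field_derivative_transform_within_open[OF dF open_greaterThanLessThan[of "-\<epsilon>" \<epsilon>] _ this]
  have 1: "((\<lambda>s. integral {a..b} (\<lambda>t. L (\<Gamma> (s, t)))) has_real_derivative J) (at 0)"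
    using \<epsilon> by simp
  let ?B = "\<lambda>t. blinfun_apply (D2 t) (\<eta>2 t) + blinfun_apply (D3 t) (\<eta>3 t)"
  let ?B' = "\<lambda>t. (blinfun_apply (D2 t) (\<eta>2' t) + blinfun_apply (D2' t) (\<eta>2 t)) +
    (blinfun_apply (D3 t) (\<eta>3' t) + blinfun_apply (D3' t) (\<eta>3 t))"
  \<comment> \<open>Integration by parts: the boundary terms vanish with \<open>\<eta>2\<close> and
    \<open>\<eta>3\<close>, so subtracting \<open>?B'\<close> keeps the integral \<open>J\<close>
    and removes the derivatives \<open>\<eta>2'\<close> and \<open>\<eta>3'\<close> from the
    integrand.\<close>
  have "(?B' has_integral ?B b - ?B a) {a..b}"
  proof (rule fundamental_theorem_of_calculus)
    fix t assume t: "t \<in> {a..b}"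
    then have "t \<in> W" using W by auto
    then show "(?B has_vector_derivative ?B' t) (at t within {a..b})"
      by (intro has_vector_derivative_add
          bounded_bilinear.has_vector_derivative[OF bounded_bilinear_blinfun_apply]
          has_vector_derivative_at_within[OF D2'(1)] has_vector_derivative_at_within[OF D3'(1)]
          \<eta>2[OF t] \<eta>3[OF t])
  qed (use ab in simp)
  then have B: "(?B' has_integral 0) {a..b}" by (simp add: bd blinfun.zero_right)
  have "(\<lambda>t. ?Fs (0, t)) integrable_on {a..b}"
    using ct[OF cF(2)] \<epsilon> by (auto intro: integrable_continuous_real)
  then have "((\<lambda>t. ?Fs (0, t)) has_integral J) {a..b}" by (simp add: J_def integrable_integral)
  from has_integral_diff[OF this B]
  have 2: "((\<lambda>t. ?Fs (0, t) - ?B' t) has_integral J) {a..b}" by simp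
  have I: "?Fs (0, t) - ?B' t = blinfun_apply (E2 t) (\<eta>2 t) + blinfun_apply (E3 t) (\<eta>3 t)"
    if t: "t \<in> {a..b}" for t
  proof -
    let ?N = "{-\<epsilon><..<\<epsilon>}"
    have st: "smooth_on_open vec_atlas vec_atlas ?N (\<lambda>s. (s, t))"
      unfolding smooth_on_open_vec_iff
      by (intro conjI Cinf_on_Pair Cinf_on_linear[OF bounded_linear_ident] Cinf_on_const) auto
    have "smooth_on_open vec_atlas (prod_atlas (charts G) vec_atlas) ?N (\<lambda>s. \<Gamma>' (s, t))"
      by (rule smooth_on_open_compose[OF _ _ _ st \<Gamma>'(1)]) (use t M(2) in auto)
    from smooth_on_open_compose[OF _ _ _ this smooth_on_open_fst[OF _ _ open_UNIV]]
    have "smooth_on_open vec_atlas (charts G) ?N (\<lambda>s. fst (\<Gamma>' (s, t)))" by simp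
    then have c: "smooth_on_open vec_atlas (charts G) ?N (\<lambda>s. fst (\<Gamma> (s, t)))"
      by (rule smooth_on_open_cong[rotated 2]) (use \<Gamma>'(2) t in auto)
    have "((\<lambda>s. L (fst (\<Gamma> (s, t)), snd (\<Gamma> (s, t)))) has_vector_derivative
        (velocity (charts G) (\<lambda>s. fst (\<Gamma> (s, t))) 0 (\<lambda>q. L (q, snd (\<Gamma> (0, t)))) +
         frechet_derivative (\<lambda>y. L (fst (\<Gamma> (0, t)), y)) (at (snd (\<Gamma> (0, t))))
          (\<eta>3 t + lie_bracket G (\<xi>1 t) (\<eta>2 t), \<eta>2' t + lie_bracket G (\<xi>2 t) (\<eta>2 t),
            \<eta>3' t + lie_bracket G (\<xi>2 t) (\<eta>3 t) - lie_bracket G (\<eta>2 t) (\<xi>3 t)))) (at 0)"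
      by (rule has_vector_derivative_along_curve[OF atlas smooth_L c _ _ der[OF t]]) (use \<epsilon> in auto)
    then have d1: "((\<lambda>s. L (\<Gamma> (s, t))) has_vector_derivative
        (T_right G (g t) (\<eta>2 t) (\<lambda>q. L (q, \<xi>1 t, \<xi>2 t, \<xi>3 t)) +
         frechet_derivative (\<lambda>y. L (g t, y)) (at (\<xi>1 t, \<xi>2 t, \<xi>3 t))
          (\<eta>3 t + lie_bracket G (\<xi>1 t) (\<eta>2 t), \<eta>2' t + lie_bracket G (\<xi>2 t) (\<eta>2 t),
            \<eta>3' t + lie_bracket G (\<xi>2 t) (\<eta>3 t) - lie_bracket G (\<eta>2 t) (\<xi>3 t)))) (at 0)"
      by (simp add: vel[OF t] \<Gamma>0[OF t])
    have "(0, t) \<in> M" using M(2) t \<epsilon> by auto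
    from Fs[OF this, of UNIV]
    have d2: "((\<lambda>s. L (\<Gamma> (s, t))) has_vector_derivative ?Fs (0, t)) (at 0)"
      by (rule has_vector_derivative_transform_within_open[of _ _ _ ?N])
        (use \<epsilon> \<Gamma>'(2) t in \<open>auto simp: F_def\<close>)
    let ?D = "frechet_derivative (\<lambda>y. L (g t, y)) (at (\<xi>1 t, \<xi>2 t, \<xi>3 t))"
    have lin: "linear ?D" using L_has_derivative has_derivative_linear by blast
    have split: "?D (u1, u2, u3) = blinfun_apply (D1 t) u1 + blinfun_apply (D2 t) u2 + blinfun_apply (D3 t) u3"
      for u1 u2 u3
      using linear_add[OF lin, of "(u1, 0, 0)" "(0, u2, u3)"] linear_add[OF lin, of "(0, u2, 0)" "(0, 0, u3)"]
      by (simp add: D1_def D2_def D3_def blinfun_apply_pd)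
    \<comment> \<open>The same derivative at \<open>s = 0\<close> computed in two ways: in the
      plane, as in the Leibniz rule, and by the chain rule through the prescribed
      variations.\<close>
    have "?Fs (0, t) = T_right G (g t) (\<eta>2 t) (\<lambda>q. L (q, \<xi>1 t, \<xi>2 t, \<xi>3 t)) +
        ?D (\<eta>3 t + lie_bracket G (\<xi>1 t) (\<eta>2 t), \<eta>2' t + lie_bracket G (\<xi>2 t) (\<eta>2 t),
            \<eta>3' t + lie_bracket G (\<xi>2 t) (\<eta>3 t) - lie_bracket G (\<eta>2 t) (\<xi>3 t))"
      by (rule vector_derivative_unique_at[OF d2 d1])
    \<comment> \<open>Skew-symmetry turns the term
      \<open>- lie_bracket G (\<eta>2 t) (\<xi>3 t)\<close> into the bracket of
      \<open>\<xi>3 t\<close> with \<open>\<eta>2 t\<close>, the form required by the coadjoint term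
      of \<open>\<xi>3\<close>.\<close>
    then show ?thesis
      unfolding split E2_def E3_def rhs2_def rhs3_def blinfun.add_left blinfun.diff_left
        blinfun_apply_ad_star blinfun_apply_T_right_dual_pd_g lie_bracket_skew[of "\<eta>2 t" "\<xi>3 t"]
      by (simp add: blinfun.add_right blinfun.diff_right blinfun.minus_right)
  qed
  have "((\<lambda>t. blinfun_apply (E2 t) (\<eta>2 t) + blinfun_apply (E3 t) (\<eta>3 t)) has_integral J) {a..b}"
    by (rule has_integral_eq[OF _ 2]) (rule I)
  with 1 show thesis by (rule that)
qed

section \<open>Realization of variations by deformations\<close>

text \<open>Multiplying \<open>g t\<close> from the left by \<open>c (s * p t)\<close>, where the curve \<open>c\<close> represents \<open>v\<close>,
  realizes the variation \<open>T_right G (g t) (p t *\<^sub>R v)\<close> without the exponential map.\<close>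

lemma exists_deformation:
  assumes p: "Cinf_on UNIV p" and q: "Cinf_on UNIV q"
    and p': "\<And>t. (p has_real_derivative p' t) (at t)" and q': "\<And>t. (q has_real_derivative q' t) (at t)"
  obtains \<Gamma> where "deformation (charts G) a b (g, \<xi>1, \<xi>2, \<xi>3)
    (\<lambda>t. T_right G (g t) (p t *\<^sub>R v),
     \<lambda>t. q t *\<^sub>R w + lie_bracket G (\<xi>1 t) (p t *\<^sub>R v),
     \<lambda>t. p' t *\<^sub>R v + lie_bracket G (\<xi>2 t) (p t *\<^sub>R v),
     \<lambda>t. q' t *\<^sub>R w + lie_bracket G (\<xi>2 t) (q t *\<^sub>R w) - lie_bracket G (p t *\<^sub>R v) (\<xi>3 t)) \<Gamma>"
proof -
  obtain c N where c: "generates c N v" using exists_generates by blast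
  then have N: "open N" "0 \<in> N" "c 0 = ident G" "smooth_on_open vec_atlas (charts G) N c"
    using smooth_on_openD(1) by (auto simp: generates_def)
  define \<delta>1 where "\<delta>1 t = q t *\<^sub>R w + lie_bracket G (\<xi>1 t) (p t *\<^sub>R v)" for t
  define \<delta>2 where "\<delta>2 t = p' t *\<^sub>R v + lie_bracket G (\<xi>2 t) (p t *\<^sub>R v)" for t
  define \<delta>3 where "\<delta>3 t = q' t *\<^sub>R w + lie_bracket G (\<xi>2 t) (q t *\<^sub>R w) - lie_bracket G (p t *\<^sub>R v) (\<xi>3 t)" for t
  \<comment> \<open>The variations contain \<open>p'\<close> and \<open>q'\<close>, which must be
    smooth for the deformation to be smooth.\<close>
  have D: "Cinf_on UNIV f'" if f: "Cinf_on UNIV f" "\<And>t. (f has_real_derivative f' t) (at t)" for f f' :: "real \<Rightarrow> real"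
  proof -
    have "frechet_derivative f (at t) 1 = f' t" for t
      using fun_cong[OF frechet_derivative_at[OF f(2)[of t, unfolded has_field_derivative_def]], of 1] by simp
    then show ?thesis using Cinf_on_frechet_derivative[OF f(1), of 1] by simp
  qed
  note pq = Cinf_on_subset[OF _ subset_UNIV[of W]]
  note br = Cinf_on_bilinear[OF bounded_bilinear_lie_bracket W(1)]
  note sc = Cinf_on_bilinear[OF bounded_bilinear_scaleR]
  have skew3: "\<delta>3 t = q' t *\<^sub>R w + lie_bracket G (\<xi>2 t) (q t *\<^sub>R w) + lie_bracket G (\<xi>3 t) (p t *\<^sub>R v)" for t
    unfolding \<delta>3_def lie_bracket_skew[of "p t *\<^sub>R v"] by simp
  have \<delta>: "Cinf_on W (\<lambda>t. (\<delta>1 t, \<delta>2 t, \<delta>3 t))"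
    unfolding skew3 \<delta>1_def \<delta>2_def
    by (intro Cinf_on_Pair Cinf_on_add br sc W smooth_\<xi> pq[OF p] pq[OF q] pq[OF D[OF p p']]
        pq[OF D[OF q q']] Cinf_on_const)
  \<comment> \<open>The vector components are affine in \<open>s\<close>, with the prescribed
    variations as slope.\<close>
  define \<Gamma> where "\<Gamma> z = (mult G (c (fst z * p (snd z))) (g (snd z)),
      (\<xi>1 (snd z), \<xi>2 (snd z), \<xi>3 (snd z)) + fst z *\<^sub>R (\<delta>1 (snd z), \<delta>2 (snd z), \<delta>3 (snd z)))" for z
  let ?m = "\<lambda>z :: real \<times> real. fst z * p (snd z)"
  define M where "M = ?m -` N \<inter> (UNIV \<times> W)"
  have Us: "Cinf_on S snd" "Cinf_on S fst" if "open S" for S :: "(real \<times> real) set"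
    by (auto intro!: Cinf_on_linear bounded_linear_snd bounded_linear_fst that)
  have m: "Cinf_on UNIV ?m"
    by (intro Cinf_on_bilinear[OF bounded_bilinear_mult] Us Cinf_on_compose[OF _ _ _ _ p]) (auto intro: Us)
  have oM: "open M"
    unfolding M_def using open_vimage[OF N(1) Cinf_on_imp_continuous_on[OF m]] W(1)
    by (simp add: open_Int open_Times)
  have sW: "snd ` M \<subseteq> W" by (auto simp: M_def)
  have mM: "smooth_on_open vec_atlas vec_atlas M ?m"
    using Cinf_on_subset[OF m subset_UNIV] oM by (simp add: smooth_on_open_vec_iff)
  have sM: "smooth_on_open vec_atlas vec_atlas M snd" using Us[OF oM] oM by (simp add: smooth_on_open_vec_iff)
  have s1: "smooth_on_open vec_atlas (charts G) M (\<lambda>z. mult G (c (?m z)) (g (snd z)))"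
    by (intro smooth_translate smooth_on_open_compose[OF _ _ _ mM N(4)]
        smooth_on_open_compose[OF _ _ _ sM smooth_g] sW) (auto simp: M_def)
  have s2: "smooth_on_open vec_atlas vec_atlas M (\<lambda>z. (\<xi>1 (snd z), \<xi>2 (snd z), \<xi>3 (snd z)) +
      fst z *\<^sub>R (\<delta>1 (snd z), \<delta>2 (snd z), \<delta>3 (snd z)))"
    unfolding smooth_on_open_vec_iff
    by (intro conjI oM Cinf_on_add sc Us Cinf_on_compose[OF oM W(1) sW _ \<delta>]
        Cinf_on_compose[OF oM W(1) sW _ Cinf_on_\<xi>])
  have \<Gamma>: "smooth_on_open vec_atlas (prod_atlas (charts G) vec_atlas) M \<Gamma>"
    using smooth_on_open_Pair[OF _ _ _ s1 s2] by (simp add: \<Gamma>_def[abs_def])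
  obtain r where r: "r > 0" "ball 0 r \<subseteq> N" using N open_contains_ball by blast
  have "continuous_on {a..b} p" using continuous_on_subset[OF Cinf_on_imp_continuous_on[OF p]] by simp
  then have "bounded (p ` {a..b})" by (intro compact_imp_bounded compact_continuous_image) auto
  then obtain K where K: "K > 0" "\<And>t. t \<in> {a..b} \<Longrightarrow> \<bar>p t\<bar> \<le> K" by (auto simp: bounded_pos)
  have sub: "{-(r / K)<..<r / K} \<times> {a..b} \<subseteq> M"
  \<comment> \<open>\<open>K\<close> bounds \<open>p\<close> on \<open>{a..b}\<close> and
    \<open>r\<close> is the radius of a ball inside \<open>N\<close>; for
    \<open>\<bar>s\<bar> < r / K\<close> the argument \<open>s * p t\<close> stays in the domain of
    \<open>c\<close>, uniformly in \<open>t\<close>.\<close>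
  proof
    fix z assume "z \<in> {-(r / K)<..<r / K} \<times> {a..b}"
    then obtain s t where z: "z = (s, t)" "\<bar>s\<bar> < r / K" "t \<in> {a..b}" by auto
    have "\<bar>s * p t\<bar> \<le> \<bar>s\<bar> * K" using K(2)[OF z(3)] by (simp add: abs_mult mult_left_mono)
    also have "\<dots> < r" using z(2) K(1) by (simp add: field_simps)
    finally show "z \<in> M" using r(2) z W(2) by (auto simp: M_def dist_norm)
  qed
  have smooth: "smooth_map vec_atlas (prod_atlas (charts G) vec_atlas) ({-(r / K)<..<r / K} \<times> {a..b}) \<Gamma>"
    unfolding smooth_map_def using oM sub \<Gamma> by blast
  have T0: "T_right G x (k *\<^sub>R v) f = k * T_right G x v f" for x k f
    using T_right_linear[of x 1 0 0 f] T_right_linear[of x k v 0 f] by simp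
  have vel: "velocity (charts G) (\<lambda>s. fst (\<Gamma> (s, t))) 0 = T_right G (g t) (p t *\<^sub>R v)" for t
  proof (rule ext)
    fix f
    have \<Gamma>0: "fst (\<Gamma> (0, t)) = g t" by (simp add: \<Gamma>_def N)
    show "velocity (charts G) (\<lambda>s. fst (\<Gamma> (s, t))) 0 f = T_right G (g t) (p t *\<^sub>R v) f"
    proof (cases "smooth_near (charts G) (g t) f")
      case True
      then obtain V where V: "g t \<in> V" "smooth_on_open (charts G) vec_atlas V f"
        by (auto simp: smooth_near_iff)
      \<comment> \<open>The reparametrization contributes the factor \<open>p t\<close> by the chain
        rule, matching the homogeneity \<open>T0\<close> of \<open>T_right\<close>.\<close>
      have "((\<lambda>s. s * p t) has_vector_derivative p t) (at 0)"
        by (auto intro!: derivative_eq_intros)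
      from has_vector_derivative_chain[OF this, of "\<lambda>s. f (mult G (c s) (g t))"]
        T_right_derivative[OF c V(2,1)]
      have "((\<lambda>s. f (mult G (c (s * p t)) (g t))) has_vector_derivative p t * T_right G (g t) v f) (at 0)"
        by (auto simp: has_vector_derivative_def)
      then show ?thesis
        by (intro velocity_eqI) (use True \<Gamma>0 in \<open>simp_all add: \<Gamma>_def T0\<close>)
    next
      case False
      then show ?thesis using \<Gamma>0 by (simp add: velocity_def T_right_def tangent_map_def)
    qed
  qed
  have der: "((\<lambda>s. snd (\<Gamma> (s, t))) has_vector_derivative (\<delta>1 t, \<delta>2 t, \<delta>3 t)) (at 0)" for t
  proof -
    have "((\<lambda>s. (\<xi>1 t, \<xi>2 t, \<xi>3 t) + s *\<^sub>R (\<delta>1 t, \<delta>2 t, \<delta>3 t)) has_vector_derivative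
        0 + 1 *\<^sub>R (\<delta>1 t, \<delta>2 t, \<delta>3 t)) (at 0)"
      by (intro has_vector_derivative_add has_vector_derivative_const
          bounded_linear.has_vector_derivative[OF bounded_linear_scaleR_left] has_vector_derivative_id)
    then show ?thesis by (simp add: \<Gamma>_def)
  qed
  have "\<Gamma> (0, t) = (g t, \<xi>1 t, \<xi>2 t, \<xi>3 t)" for t by (simp add: \<Gamma>_def N)
  moreover have "r / K > 0" using r K by simp
  ultimately have "deformation (charts G) a b (g, \<xi>1, \<xi>2, \<xi>3) (\<lambda>t. T_right G (g t) (p t *\<^sub>R v), \<delta>1, \<delta>2, \<delta>3) \<Gamma>"
    using smooth vel der unfolding deformation_def by auto
  then show thesis
    unfolding \<delta>1_def[abs_def] \<delta>2_def[abs_def] \<delta>3_def[abs_def] by (rule that)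
qed

section \<open>Extremality and the Euler-Lagrange equations\<close>

text \<open>The realizing deformation makes extremality applicable: its action has derivative 0,
  while the first variation formula gives the displayed integral as derivative.\<close>

lemma reduced_variations_polynomial:
  assumes p: "real_polynomial_function p" "p a = 0" "p b = 0" and q: "real_polynomial_function q" "q a = 0" "q b = 0"
    and ext: "extremal (charts G) L a b (reduced_variations G a b (g, \<xi>1, \<xi>2, \<xi>3)) (g, \<xi>1, \<xi>2, \<xi>3)"
  shows "((\<lambda>t. p t * blinfun_apply (E2 t) v + q t * blinfun_apply (E3 t) w) has_integral 0) {a..b}"
proof -
  have C: "Cinf_on UNIV p" "Cinf_on UNIV q"
    using p(1) q(1) by (auto intro: Cinf_on_real_polynomial_function)
  obtain p' q' where p': "\<And>t. (p has_real_derivative p' t) (at t)" and q': "\<And>t. (q has_real_derivative q' t) (at t)"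
    using has_real_derivative_polynomial_function[of p] has_real_derivative_polynomial_function[of q] p(1) q(1)
    by metis
  obtain \<Gamma> where \<Gamma>: "deformation (charts G) a b (g, \<xi>1, \<xi>2, \<xi>3)
    (\<lambda>t. T_right G (g t) (p t *\<^sub>R v),
     \<lambda>t. q t *\<^sub>R w + lie_bracket G (\<xi>1 t) (p t *\<^sub>R v),
     \<lambda>t. p' t *\<^sub>R v + lie_bracket G (\<xi>2 t) (p t *\<^sub>R v),
     \<lambda>t. q' t *\<^sub>R w + lie_bracket G (\<xi>2 t) (q t *\<^sub>R w) - lie_bracket G (p t *\<^sub>R v) (\<xi>3 t)) \<Gamma>"
    by (rule exists_deformation[OF C p' q'])
  have d: "((\<lambda>t. p t *\<^sub>R v) has_vector_derivative p' t *\<^sub>R v) (at t within S)"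
    "((\<lambda>t. q t *\<^sub>R w) has_vector_derivative q' t *\<^sub>R w) (at t within S)" for t S
    using has_vector_derivative_scaleR[OF has_field_derivative_at_within[OF p'] has_vector_derivative_const]
      has_vector_derivative_scaleR[OF has_field_derivative_at_within[OF q'] has_vector_derivative_const]
    by fastforce+
  \<comment> \<open>\<open>reduced_variations\<close> is written with derivatives within
    \<open>{a..b}\<close>; they agree with \<open>p'\<close> and \<open>q'\<close> on that interval,
    the only place where \<open>deformation\<close> inspects the variation.\<close>
  have vd: "vector_derivative (\<lambda>t. p t *\<^sub>R v) (at t within {a..b}) = p' t *\<^sub>R v"
    "vector_derivative (\<lambda>t. q t *\<^sub>R w) (at t within {a..b}) = q' t *\<^sub>R w" if "t \<in> {a..b}" for t
    using vector_derivative_within_cbox[of a b t, unfolded box_real(2), OF ab that d(1)]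
      vector_derivative_within_cbox[of a b t, unfolded box_real(2), OF ab that d(2)] by auto
  have sm: "smooth_map vec_atlas vec_atlas {a..b} (\<lambda>t. f t *\<^sub>R u)"
    if "Cinf_on UNIV f" for f :: "real \<Rightarrow> real" and u :: 'a
    using Cinf_on_bilinear[OF bounded_bilinear_scaleR open_UNIV that Cinf_on_const[of _ u]]
    by (auto simp: smooth_map_def smooth_on_open_vec_iff)
  have "((\<lambda>s. integral {a..b} (\<lambda>t. L (\<Gamma> (s, t)))) has_real_derivative 0) (at 0)"
  proof -
    let ?\<delta> = "(\<lambda>t. T_right G (g t) (p t *\<^sub>R v),
       \<lambda>t. q t *\<^sub>R w + lie_bracket G (\<xi>1 t) (p t *\<^sub>R v),
       \<lambda>t. vector_derivative (\<lambda>t. p t *\<^sub>R v) (at t within {a..b}) + lie_bracket G (\<xi>2 t) (p t *\<^sub>R v),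
       \<lambda>t. vector_derivative (\<lambda>t. q t *\<^sub>R w) (at t within {a..b}) + lie_bracket G (\<xi>2 t) (q t *\<^sub>R w)
         - lie_bracket G (p t *\<^sub>R v) (\<xi>3 t))"
    have "?\<delta> \<in> reduced_variations G a b (g, \<xi>1, \<xi>2, \<xi>3)"
      unfolding reduced_variations_def prod.case
      by (rule CollectI, rule exI[of _ "\<lambda>t. p t *\<^sub>R v"], rule exI[of _ "\<lambda>t. q t *\<^sub>R w"])
        (use sm C p q in simp)
    moreover have "deformation (charts G) a b (g, \<xi>1, \<xi>2, \<xi>3) ?\<delta> \<Gamma>"
      using \<Gamma> vd unfolding deformation_def by simp
    ultimately show ?thesis using ext unfolding extremal_def by blast
  qed
  moreover obtain \<epsilon> where \<epsilon>: "\<epsilon> > 0"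
    "smooth_map vec_atlas (prod_atlas (charts G) vec_atlas) ({-\<epsilon><..<\<epsilon>} \<times> {a..b}) \<Gamma>"
    using \<Gamma> unfolding deformation_def by auto
  obtain J where J: "((\<lambda>s. integral {a..b} (\<lambda>t. L (\<Gamma> (s, t)))) has_real_derivative J) (at 0)"
    "((\<lambda>t. blinfun_apply (E2 t) (p t *\<^sub>R v) + blinfun_apply (E3 t) (q t *\<^sub>R w)) has_integral J) {a..b}"
    by (rule first_variation[OF d(1) d(2) _ _ _ _ \<epsilon>])
      (use \<Gamma> p q in \<open>auto simp: deformation_def\<close>)
  ultimately have "J = 0" using DERIV_unique by blast
  then show ?thesis using J(2) by (simp add: blinfun.scaleR_right)
qed

lemma extremal_iff:
  "extremal (charts G) L a b (reduced_variations G a b (g, \<xi>1, \<xi>2, \<xi>3)) (g, \<xi>1, \<xi>2, \<xi>3) \<longleftrightarrow>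
    (\<forall>t\<in>{a..b}. E2 t = 0 \<and> E3 t = 0)"
proof
  assume ext: "extremal (charts G) L a b (reduced_variations G a b (g, \<xi>1, \<xi>2, \<xi>3)) (g, \<xi>1, \<xi>2, \<xi>3)"
  have poly: "real_polynomial_function (\<lambda>t. (t - a) * (b - t) * r t)" if r: "real_polynomial_function r" for r
    by (intro real_polynomial_function.intros(4) real_polynomial_function_diff real_polynomial_function.intros(2)
        real_polynomial_function.intros(1)[OF bounded_linear_ident] r)
  have z: "real_polynomial_function (\<lambda>t::real. 0)" by (rule real_polynomial_function.intros(2))
  \<comment> \<open>Taking the zero polynomial for \<open>q\<close> isolates \<open>E2\<close>;
    below, the zero polynomial for \<open>p\<close> isolates \<open>E3\<close>.\<close>
  have "blinfun_apply (E2 t) v = 0" if "t \<in> {a..b}" for t v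
    by (rule fundamental_lemma_polynomial[OF continuous_on_E(1) ab _ that])
      (use reduced_variations_polynomial[OF poly _ _ z _ _ ext] in simp)
  moreover have "blinfun_apply (E3 t) v = 0" if "t \<in> {a..b}" for t v
    by (rule fundamental_lemma_polynomial[OF continuous_on_E(2) ab _ that])
      (use reduced_variations_polynomial[OF z _ _ poly _ _ ext] in simp)
  ultimately show "\<forall>t\<in>{a..b}. E2 t = 0 \<and> E3 t = 0" by (auto intro!: blinfun_eqI)
next
  assume E: "\<forall>t\<in>{a..b}. E2 t = 0 \<and> E3 t = 0"
  show "extremal (charts G) L a b (reduced_variations G a b (g, \<xi>1, \<xi>2, \<xi>3)) (g, \<xi>1, \<xi>2, \<xi>3)"
    unfolding extremal_def
  proof (intro ballI allI impI)
    fix \<delta> \<Gamma>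
    assume \<delta>: "\<delta> \<in> reduced_variations G a b (g, \<xi>1, \<xi>2, \<xi>3)"
      and \<Gamma>: "deformation (charts G) a b (g, \<xi>1, \<xi>2, \<xi>3) \<delta> \<Gamma>"
    obtain \<eta>2 \<eta>3 where \<eta>: "\<delta> = (\<lambda>t. T_right G (g t) (\<eta>2 t),
       \<lambda>t. \<eta>3 t + lie_bracket G (\<xi>1 t) (\<eta>2 t),
       \<lambda>t. vector_derivative \<eta>2 (at t within {a..b}) + lie_bracket G (\<xi>2 t) (\<eta>2 t),
       \<lambda>t. vector_derivative \<eta>3 (at t within {a..b}) + lie_bracket G (\<xi>2 t) (\<eta>3 t)
             - lie_bracket G (\<eta>2 t) (\<xi>3 t))"
       "smooth_map vec_atlas vec_atlas {a..b} \<eta>2" "smooth_map vec_atlas vec_atlas {a..b} \<eta>3"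
       "\<eta>2 a = 0" "\<eta>2 b = 0" "\<eta>3 a = 0" "\<eta>3 b = 0"
      using \<delta> unfolding reduced_variations_def prod.case by blast
    obtain \<epsilon> where \<epsilon>: "\<epsilon> > 0"
      "smooth_map vec_atlas (prod_atlas (charts G) vec_atlas) ({-\<epsilon><..<\<epsilon>} \<times> {a..b}) \<Gamma>"
      using \<Gamma> unfolding deformation_def \<eta>(1) by auto
    obtain J where J: "((\<lambda>s. integral {a..b} (\<lambda>t. L (\<Gamma> (s, t)))) has_real_derivative J) (at 0)"
      "((\<lambda>t. blinfun_apply (E2 t) (\<eta>2 t) + blinfun_apply (E3 t) (\<eta>3 t)) has_integral J) {a..b}"
      by (rule first_variation[OF smooth_map_vec_has_vector_derivative[OF \<eta>(2)]
            smooth_map_vec_has_vector_derivative[OF \<eta>(3)] \<eta>(4-7) \<epsilon>])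
        (use \<Gamma> in \<open>auto simp: deformation_def \<eta>(1)\<close>)
    have "((\<lambda>t. 0) has_integral J) {a..b}"
      by (rule has_integral_eq[OF _ J(2)]) (use E in simp)
    then have "J = 0" by simp
    then show "((\<lambda>s. integral {a..b} (\<lambda>t. L (\<Gamma> (s, t)))) has_real_derivative 0) (at 0)"
      using J(1) by simp
  qed
qed

end

text \<open>The same \<open>\<eta>2\<close>, \<open>\<eta>3\<close> and the same
  \<open>\<Gamma>\<close> serve both curves. Their variations may differ outside
  \<open>{a..b}\<close>, but \<open>deformation\<close> compares them only inside.\<close>

lemma extremal_cong:
  assumes "\<And>t. t \<in> {a..b} \<Longrightarrow> g t = h t \<and> \<xi>1 t = \<zeta>1 t \<and> \<xi>2 t = \<zeta>2 t \<and> \<xi>3 t = \<zeta>3 t"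
    and "extremal A L a b (reduced_variations G a b (h, \<zeta>1, \<zeta>2, \<zeta>3)) (h, \<zeta>1, \<zeta>2, \<zeta>3)"
  shows "extremal A L a b (reduced_variations G a b (g, \<xi>1, \<xi>2, \<xi>3)) (g, \<xi>1, \<xi>2, \<xi>3)"
  unfolding extremal_def
proof (intro ballI allI impI)
  fix \<delta> \<Gamma>
  assume \<delta>: "\<delta> \<in> reduced_variations G a b (g, \<xi>1, \<xi>2, \<xi>3)" and \<Gamma>: "deformation A a b (g, \<xi>1, \<xi>2, \<xi>3) \<delta> \<Gamma>"
  let ?V = "\<lambda>(g, \<xi>1, \<xi>2, \<xi>3) \<eta>2 \<eta>3. (\<lambda>t. T_right G (g t) (\<eta>2 t),
     \<lambda>t. \<eta>3 t + lie_bracket G (\<xi>1 t) (\<eta>2 t),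
     \<lambda>t. vector_derivative \<eta>2 (at t within {a..b}) + lie_bracket G (\<xi>2 t) (\<eta>2 t),
     \<lambda>t. vector_derivative \<eta>3 (at t within {a..b}) + lie_bracket G (\<xi>2 t) (\<eta>3 t)
           - lie_bracket G (\<eta>2 t) (\<xi>3 t))"
  obtain \<eta>2 \<eta>3 where \<eta>: "\<delta> = ?V (g, \<xi>1, \<xi>2, \<xi>3) \<eta>2 \<eta>3"
     "smooth_map vec_atlas vec_atlas {a..b} \<eta>2" "smooth_map vec_atlas vec_atlas {a..b} \<eta>3"
     "\<eta>2 a = 0" "\<eta>2 b = 0" "\<eta>3 a = 0" "\<eta>3 b = 0"
    using \<delta> unfolding reduced_variations_def prod.case by blast
  have "?V (h, \<zeta>1, \<zeta>2, \<zeta>3) \<eta>2 \<eta>3 \<in> reduced_variations G a b (h, \<zeta>1, \<zeta>2, \<zeta>3)"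
    unfolding reduced_variations_def prod.case using \<eta>(2-) by blast
  moreover have "deformation A a b (h, \<zeta>1, \<zeta>2, \<zeta>3) (?V (h, \<zeta>1, \<zeta>2, \<zeta>3) \<eta>2 \<eta>3) \<Gamma>"
    using \<Gamma> assms(1) unfolding deformation_def \<eta>(1) prod.case by simp
  ultimately show "((\<lambda>s. integral {a..b} (\<lambda>t. L (\<Gamma> (s, t)))) has_real_derivative 0) (at 0)"
    using assms(2) unfolding extremal_def by blast
qed

theorem mainTheorem1:
  fixes G :: "('g::{t2_space,second_countable_topology}, 'e::finite_dim_normed,
                'a::finite_dim_normed) lie_group_data"
    and L :: "'g \<times> 'a \<times> 'a \<times> 'a \<Rightarrow> real"
    and a b :: real
    and g :: "real \<Rightarrow> 'g"
    and \<xi>1 \<xi>2 \<xi>3 :: "real \<Rightarrow> 'a"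
  assumes "lie_group G"
    and "smooth_map (prod_atlas (charts G) vec_atlas) vec_atlas UNIV L"
    and "a < b"
    and "smooth_map vec_atlas (charts G) {a..b} g"
    and "smooth_map vec_atlas vec_atlas {a..b} \<xi>1"
    and "smooth_map vec_atlas vec_atlas {a..b} \<xi>2"
    and "smooth_map vec_atlas vec_atlas {a..b} \<xi>3"
  shows "extremal (charts G) L a b (reduced_variations G a b (g, \<xi>1, \<xi>2, \<xi>3)) (g, \<xi>1, \<xi>2, \<xi>3)
    \<longleftrightarrow>
    (\<forall>t\<in>{a..b}.
       ((\<lambda>t. pd_2 L (g t) (\<xi>1 t) (\<xi>2 t) (\<xi>3 t)) has_vector_derivative
          (T_right_dual G (g t) (pd_g L (g t) (\<xi>1 t) (\<xi>2 t) (\<xi>3 t))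
           + ad_star G (\<xi>1 t) (pd_1 L (g t) (\<xi>1 t) (\<xi>2 t) (\<xi>3 t))
           + ad_star G (\<xi>2 t) (pd_2 L (g t) (\<xi>1 t) (\<xi>2 t) (\<xi>3 t))
           + ad_star G (\<xi>3 t) (pd_3 L (g t) (\<xi>1 t) (\<xi>2 t) (\<xi>3 t)))) (at t within {a..b}) \<and>
       ((\<lambda>t. pd_3 L (g t) (\<xi>1 t) (\<xi>2 t) (\<xi>3 t)) has_vector_derivative
          (pd_1 L (g t) (\<xi>1 t) (\<xi>2 t) (\<xi>3 t)
           + ad_star G (\<xi>2 t) (pd_3 L (g t) (\<xi>1 t) (\<xi>2 t) (\<xi>3 t)))) (at t within {a..b}))"
proof -
  have lie: "lie G" using assms(1) by (rule lie.intro)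
  interpret lie G by (rule lie)
  obtain W0 \<gamma> where W0: "open W0" "{a..b} \<subseteq> W0" "smooth_on_open vec_atlas (charts G) W0 \<gamma>" "\<And>t. t \<in> {a..b} \<Longrightarrow> \<gamma> t = g t"
    using assms(4) unfolding smooth_map_def by blast
  obtain W1 \<zeta>1 where W1: "open W1" "{a..b} \<subseteq> W1" "Cinf_on W1 \<zeta>1" "\<And>t. t \<in> {a..b} \<Longrightarrow> \<zeta>1 t = \<xi>1 t"
    using assms(5) unfolding smooth_map_def smooth_on_open_vec_iff by blast
  obtain W2 \<zeta>2 where W2: "open W2" "{a..b} \<subseteq> W2" "Cinf_on W2 \<zeta>2" "\<And>t. t \<in> {a..b} \<Longrightarrow> \<zeta>2 t = \<xi>2 t"
    using assms(6) unfolding smooth_map_def smooth_on_open_vec_iff by blast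
  obtain W3 \<zeta>3 where W3: "open W3" "{a..b} \<subseteq> W3" "Cinf_on W3 \<zeta>3" "\<And>t. t \<in> {a..b} \<Longrightarrow> \<zeta>3 t = \<xi>3 t"
    using assms(7) unfolding smooth_map_def smooth_on_open_vec_iff by blast
  \<comment> \<open>Each curve comes with an extension of its own; the locale asks for one common
    domain.\<close>
  define W where "W = W0 \<inter> W1 \<inter> W2 \<inter> W3"
  have W: "open W" using W0(1) W1(1) W2(1) W3(1) by (auto simp: W_def)
  interpret lagrangian_curve G L a b W \<gamma> \<zeta>1 \<zeta>2 \<zeta>3
  proof
    show "smooth_on_open (prod_atlas (charts G) vec_atlas) vec_atlas UNIV L"
      using assms(2) by (simp add: smooth_map_open_iff)
    show "{a..b} \<subseteq> W" using W0(2) W1(2) W2(2) W3(2) by (auto simp: W_def)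
    show "smooth_on_open vec_atlas (charts G) W \<gamma>"
      by (rule smooth_on_open_subset[OF W0(3) W]) (auto simp: W_def)
    show "Cinf_on W \<zeta>1" "Cinf_on W \<zeta>2" "Cinf_on W \<zeta>3"
      by (rule Cinf_on_subset[OF W1(3)] Cinf_on_subset[OF W2(3)] Cinf_on_subset[OF W3(3)], force simp: W_def)+
  qed (use assms(3) W in auto)
  note eq = W0(4) W1(4) W2(4) W3(4)
  have "extremal (charts G) L a b (reduced_variations G a b (g, \<xi>1, \<xi>2, \<xi>3)) (g, \<xi>1, \<xi>2, \<xi>3) \<longleftrightarrow>
      extremal (charts G) L a b (reduced_variations G a b (\<gamma>, \<zeta>1, \<zeta>2, \<zeta>3)) (\<gamma>, \<zeta>1, \<zeta>2, \<zeta>3)"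
    by (intro iffI; rule extremal_cong[rotated], assumption) (simp_all add: eq)
  \<comment> \<open>Derivatives within \<open>{a..b}\<close> see only values on the interval, where
    the extensions agree with the given curves.\<close>
  moreover have D: "((\<lambda>t. pd_2 L (g t) (\<xi>1 t) (\<xi>2 t) (\<xi>3 t)) has_vector_derivative v) (at t within {a..b}) \<longleftrightarrow>
      (D2 has_vector_derivative v) (at t within {a..b})"
    "((\<lambda>t. pd_3 L (g t) (\<xi>1 t) (\<xi>2 t) (\<xi>3 t)) has_vector_derivative v) (at t within {a..b}) \<longleftrightarrow>
      (D3 has_vector_derivative v) (at t within {a..b})"
    if "t \<in> {a..b}" for t v
    by (intro iffI; rule has_vector_derivative_transform[OF that, rotated], assumption;
        simp add: D2_def D3_def eq)+
  moreover have "rhs2 t = T_right_dual G (g t) (pd_g L (g t) (\<xi>1 t) (\<xi>2 t) (\<xi>3 t))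
      + ad_star G (\<xi>1 t) (pd_1 L (g t) (\<xi>1 t) (\<xi>2 t) (\<xi>3 t))
      + ad_star G (\<xi>2 t) (pd_2 L (g t) (\<xi>1 t) (\<xi>2 t) (\<xi>3 t))
      + ad_star G (\<xi>3 t) (pd_3 L (g t) (\<xi>1 t) (\<xi>2 t) (\<xi>3 t))"
    "rhs3 t = pd_1 L (g t) (\<xi>1 t) (\<xi>2 t) (\<xi>3 t) + ad_star G (\<xi>2 t) (pd_3 L (g t) (\<xi>1 t) (\<xi>2 t) (\<xi>3 t))"
    if "t \<in> {a..b}" for t
    using that by (simp_all add: rhs2_def rhs3_def D1_def D2_def D3_def eq)
  ultimately show ?thesis
    using extremal_iff euler_lagrange_iff by simp
qed

end
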